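(* Let $f:\mathbb{R}^n\to\mathbb{R}$ be a convex, continuously differentiable function whose gradient is locally $\nu$-Hölder for some $\nu\in(0,1]$, with $\mathcal{X}^*:=\arg\min f\neq\emptyset$ and optimal value $f^*$. Let $x^0$ be such that $\Lambda(x^0):=\{x:f(x)\le f(x^0)\}$ is bounded; let $r:=\max\{\|x\|:x\in\Lambda(x^0)\}$, $\Omega:=\overline B(0;(1+2(1+\nu)^{1/\nu})r)$, and $L_\Omega>0$ with $\|\nabla f(x)-\nabla f(y)\|\le L_\Omega\|x-y\|^\nu$ on $\Omega$. Suppose $f$ satisfies the KL inequality, and let $\vartheta_\Omega\in(0,1)$, $\rho_\Omega>0$ be such that $(f(x)-f^* )^{\vartheta_\Omega}\le\rho_\Omega\|\nabla f(x)\|$ for all $x\in\Omega$. Let $(x^k)$ be generated by $x^{k+1}=x^k-\alpha_k\|\nabla f(x^k)\|^{\frac{1-\nu}{\nu}}\nabla f(x^k)$ with $\alpha_k\in\big[\bar\alpha,\frac{2\nu}{(1+\nu)L_\Omega^{1/\nu}}\big]$, $0<\bar\alpha<\frac{2\nu}{(1+\nu)L_\Omega^{1/\nu}}$, and let $x^*$ be the limit point of $(x^k)$. Then: (a) if $\vartheta_\Omega=\frac{\nu}{1+\nu}$, with $q_2:=(1-\vartheta_\Omega)L_\Omega\bar\alpha^{\frac{1}{1-\vartheta_\Omega}}\rho_\Omega^{-\frac1{\vartheta_\Omega}}$, $$\|x^k-x^*\|\le\frac{2\vartheta_\Omega\rho_\Omega(f(x^0)-f^* )^{1-\vartheta_\Omega}}{(1-\vartheta_\Omega)^2L_\Omega^{\frac1{\vartheta_\Omega}}\bar\alpha^{\frac1{1-\vartheta_\Omega}}}(1-q_2)^{k(1-\vartheta_\Omega)}\qquad\forall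 k\in\mathbb{N}_0;$$ (b) if $\vartheta_\Omega>\frac{\nu}{1+\nu}$, there exists $\sigma>0$ such that for all sufficiently large $k\in\mathbb{N}_0$, $$\|x^k-x^*\|\le\frac{2\nu\rho_\Omega\sigma^{1-\vartheta_\Omega}}{(1-\vartheta_\Omega)L_\Omega^{\frac{1+\nu}{\nu}}\bar\alpha^{1+\nu}}k^{-\frac{\nu(1-\vartheta_\Omega)}{\vartheta_\Omega(1+\nu)-\nu}}.$$
   Context: Locally $\nu$-Hölder gradient: each point has a neighbourhood on which $\|\nabla f(x)-\nabla f(y)\|\le L\|x-y\|^\nu$. KL inequality: for every $x^*\in\mathcal{X}^*$ there exist $\rho,\delta>0$, $\vartheta\in(0,1)$ with $(f(x)-f^* )^\vartheta\le\rho\|\nabla f(x)\|$ for all $x\in B(x^*;\delta)$. *)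

theory Defs
  imports "HOL-Analysis.Analysis"
begin

definition locally_hoelder :: "real \<Rightarrow> ('a::real_normed_vector \<Rightarrow> 'b::real_normed_vector) \<Rightarrow> bool" where
  "locally_hoelder \<nu> g \<longleftrightarrow>
     (\<forall>x. \<exists>U L. open U \<and> x \<in> U \<and>
        (\<forall>y\<in>U. \<forall>z\<in>U. norm (g y - g z) \<le> L * norm (y - z) powr \<nu>))"

definition KL_inequality :: "('a::real_normed_vector \<Rightarrow> real) \<Rightarrow> ('a \<Rightarrow> 'a) \<Rightarrow> real \<Rightarrow> bool" where
  "KL_inequality f g fstar \<longleftrightarrow>
     (\<forall>xs \<in> {x. f x = fstar}. \<exists>\<rho> \<delta> \<theta>. \<rho> > 0 \<and> \<delta> > 0 \<and> 0 < \<theta> \<and> \<theta> < 1 \<and>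
        (\<forall>x \<in> ball xs \<delta>. (f x - fstar) powr \<theta> \<le> \<rho> * norm (g x)))"

end

theory Submission
  imports Defs
begin

text \<open>
  Dividing \<open>f - f\<^sup>*\<close> and \<open>\<nabla>f\<close> by \<open>L\<close> turns the Hoelder constant into \<open>1\<close>. Let \<open>s = f - f\<^sup>*\<close>,
  \<open>p = (1 + \<nu>) / \<nu>\<close>, \<open>R = \<rho>\<^sup>p\<close>, let \<open>b \<le> 2\<nu> / (1 + \<nu>)\<close> be the step parameter and let
  \<open>\<kappa> = (2\<nu> / (1 + \<nu>))\<^sup>\<nu> / (1 + \<nu>)\<close>. The descent lemma only gives a decrease of
  \<open>(1 - \<kappa>) b \<parallel>\<nabla>s\<parallel>\<^sup>p\<close>, which for \<open>\<nu> < 1\<close> is too little for the constants of part (a). These follow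
  from two sharper facts.

  Every step decreases \<open>s\<close> by at least \<open>\<kappa> b s / R\<close>: if the decrease is small, then cocoercivity makes
  the next gradient small, and the Kurdyka-Lojasiewicz inequality at the next point (or, for small
  \<open>\<nu>\<close>, integrated along the way to a lower level set) bounds \<open>s\<close> by less than what was left.

  With \<open>U = (1 + \<nu>) \<rho> s powr (1 / (1 + \<nu>))\<close>, the bound for the distance to the minimizers which the
  Kurdyka-Lojasiewicz inequality provides, every later iterate is within \<open>U / \<kappa>\<close> of the current one.
  For large \<open>\<nu>\<close> the length of the trajectory is that short. For small \<open>\<nu>\<close> its length is not controlled;
  instead a potential made of the squared displacement, of \<open>U\<^sup>2\<close> and of a mixed term increases so
  slowly that it bounds the displacement.

  Part (b) is not sensitive to constants: Fejer monotonicity bounds the distance to the limit by twice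
  the distance to the minimizers, and \<open>s\<close> satisfies a recurrence with a superlinear decrease.
\<close>

text \<open>The constants of (a) match because the maximal step
  \<open>be = 2 * \<nu> / (1 + \<nu>)\<close> satisfies
  \<open>be powr (1 + \<nu>) = 2 * \<nu> * kappa \<nu>\<close>. For a lower bound \<open>bb\<close>
  of the steps this gives \<open>1 / kappa \<nu> \<le> 2 * \<nu> / bb powr (1 + \<nu>)\<close> as
  well as \<open>bb powr (1 + \<nu>) / (1 + \<nu>) \<le> kappa \<nu> * b\<close>. The case
  distinctions stem from \<open>kappa \<nu>\<close>, which grows from 1/2 at \<nu> = 1 to 1 as \<nu>
  tends to 0. At \<nu> = 1 the numerical conditions hold with equality, so near it the bounds must
  be linear in 1 - \<nu>. Near 0 two arguments degenerate. Cocoercivity at two points no longer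
  forces a smaller next gradient, hence the third point below 1/7. The error of the potential, of
  order sqrt (\<nu> / ln (1 / \<nu>)), exceeds the available room of order \<nu> ln (1 / \<nu>),
  hence a direct count of squared step lengths below 1/64. In the parameter t = (1 - \<nu>) / (1 +
  \<nu>), the thresholds 13/27 and 1/7 are 35/100 and 3/4.\<close>

section \<open>Bernoulli inequalities, convexity and the Hoelder descent lemma\<close>

lemma powr_le_tangent:
  fixes a z :: real
  assumes "0 \<le> a" "a \<le> 1" "z \<ge> -1"
  shows "(1 + z) powr a \<le> 1 + a * z"
proof (cases "z = -1")
  case True
  then show ?thesis using assms by simp
next
  case False
  then have "(1 + z) powr a * 1 powr (1 - a) \<le> a * (1 + z) + (1 - a) * 1"
    using assms by (intro Youngs_inequality_0) auto
  then show ?thesis by (simp add: algebra_simps)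
qed

text \<open>Inverts the preceding bound, since (1 - a z)(1 + a z) never exceeds 1.\<close>

lemma powr_neg_ge_tangent:
  fixes a z :: real
  assumes "0 \<le> a" "a \<le> 1" "z > -1"
  shows "(1 + z) powr (- a) \<ge> 1 - a * z"
proof -
  have "(1 + z) powr a \<le> 1 + a * z" using assms by (intro powr_le_tangent) auto
  moreover have "(1 + z) powr a > 0" using assms by simp
  moreover have "(1 - a * z) * (1 + a * z) \<le> 1"
    using assms(1) by (simp add: algebra_simps flip: power2_eq_square)
  ultimately have "(1 - a * z) * (1 + z) powr a \<le> 1"
    by (cases "1 - a * z \<ge> 0") (smt (verit) mult_left_mono, smt (verit) mult_nonneg_nonneg mult_minus_left)
  then show ?thesis using \<open>(1 + z) powr a > 0\<close>
    by (simp add: powr_minus field_simps)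
qed

lemma has_real_derivative_along_line:
  fixes f :: "'a::real_inner \<Rightarrow> real"
  assumes "(f has_derivative (\<lambda>h. v \<bullet> h)) (at (a + t *\<^sub>R d))"
  shows "((\<lambda>t. f (a + t *\<^sub>R d)) has_real_derivative (v \<bullet> d)) (at t)"
proof -
  have "((\<lambda>t. f (a + t *\<^sub>R d)) has_derivative (\<lambda>s. v \<bullet> (s *\<^sub>R d))) (at t)"
    by (rule has_derivative_compose[where g = f]) (auto intro!: derivative_eq_intros assms)
  moreover have "(\<lambda>s. v \<bullet> (s *\<^sub>R d)) = (*) (v \<bullet> d)" by (auto simp: fun_eq_iff)
  ultimately show ?thesis by (simp add: has_field_derivative_def)
qed

lemma gradient_convex_ineq:
  fixes f :: "'a::real_inner \<Rightarrow> real"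
  assumes "convex_on UNIV f" and "(f has_derivative (\<lambda>h. v \<bullet> h)) (at a)"
  shows "f y \<ge> f a + v \<bullet> (y - a)"
proof -
  let ?h = "\<lambda>t::real. f (a + t *\<^sub>R (y - a))"
  have "convex_on UNIV ?h"
  proof (rule convex_onI)
    fix t u w :: real assume t: "0 < t" "t < 1"
    have "a + ((1 - t) *\<^sub>R u + t *\<^sub>R w) *\<^sub>R (y - a)
        = (1 - t) *\<^sub>R (a + u *\<^sub>R (y - a)) + t *\<^sub>R (a + w *\<^sub>R (y - a))"
      by (simp add: algebra_simps)
    then show "?h ((1 - t) *\<^sub>R u + t *\<^sub>R w) \<le> (1 - t) * ?h u + t * ?h w"
      using convex_onD[OF assms(1), of t] t by simp
  qed auto
  moreover have "(?h has_real_derivative (v \<bullet> (y - a))) (at 0)"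
    using assms(2) by (intro has_real_derivative_along_line) simp
  ultimately have "v \<bullet> (y - a) * (1 - 0) \<le> ?h 1 - ?h 0"
    by (intro convex_on_imp_above_tangent[of UNIV ?h 0 1]) auto
  then show ?thesis by simp
qed

text \<open>The difference \<open>h\<close> between \<open>f\<close> on the segment and its Hoelder
  model is nonincreasing; this replaces integration of the gradient.\<close>

lemma hoelder_descent:
  fixes f :: "'a::real_inner \<Rightarrow> real"
  assumes grad: "\<And>y. (f has_derivative (\<lambda>h. g y \<bullet> h)) (at y)"
    and nu: "\<nu> > 0"
    and hoelder: "\<And>y. y \<in> closed_segment a b \<Longrightarrow> norm (g y - g a) \<le> norm (y - a) powr \<nu>"
  shows "f b \<le> f a + g a \<bullet> (b - a) + norm (b - a) powr (1 + \<nu>) / (1 + \<nu>)"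
proof -
  define N where "N = norm (b - a)"
  define h where "h t = f (a + t *\<^sub>R (b - a)) - t * (g a \<bullet> (b - a)) - t powr (1 + \<nu>) * N powr (1 + \<nu>) / (1 + \<nu>)" for t
  have fd: "((\<lambda>t. f (a + t *\<^sub>R (b - a))) has_real_derivative (g (a + t *\<^sub>R (b - a)) \<bullet> (b - a))) (at t)" for t
    by (intro has_real_derivative_along_line grad)
  have "h 0 \<ge> h 1"
  proof (rule DERIV_nonpos_imp_decreasing_open[of 0 1 h])
    fix t :: real assume t: "0 < t" "t < 1"
    let ?y = "a + t *\<^sub>R (b - a)"
    have hd: "(h has_real_derivative (g ?y \<bullet> (b - a) - g a \<bullet> (b - a) - ((1 + \<nu>) * t powr \<nu>) * N powr (1 + \<nu>) / (1 + \<nu>))) (at t)"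
      unfolding h_def using t nu
      by (auto intro!: derivative_eq_intros fd)
    have "?y \<in> closed_segment a b"
      using t by (auto simp: closed_segment_def algebra_simps intro!: exI[of _ t])
    then have "norm (g ?y - g a) \<le> (t * N) powr \<nu>"
      using hoelder[of ?y] t by (simp add: N_def)
    then have "(g ?y - g a) \<bullet> (b - a) \<le> (t * N) powr \<nu> * N"
      using norm_cauchy_schwarz[of "g ?y - g a" "b - a"] unfolding N_def
      by (meson mult_right_mono norm_ge_zero order_trans)
    also have "\<dots> = t powr \<nu> * N powr (1 + \<nu>)"
      using t nu by (simp add: powr_mult powr_add N_def)
    finally have "g ?y \<bullet> (b - a) - g a \<bullet> (b - a) - ((1 + \<nu>) * t powr \<nu>) * N powr (1 + \<nu>) / (1 + \<nu>) \<le> 0"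
      using nu by (simp add: inner_diff_left)
    with hd show "\<exists>y. (h has_real_derivative y) (at t) \<and> y \<le> 0" by blast
  next
    have "continuous_on {0..1} (\<lambda>t. f (a + t *\<^sub>R (b - a)))"
      using fd by (intro DERIV_continuous_on) (auto intro: DERIV_subset)
    then show "continuous_on {0..1} h"
      unfolding h_def using nu by (intro continuous_on_powr' continuous_intros) auto
  qed simp
  then show ?thesis using nu by (simp add: h_def N_def)
qed

section \<open>The constant of the descent inequality\<close>

text \<open>The share of the first-order decrease that the Hoelder error can consume at the maximal
  step.\<close>

definition kappa :: "real \<Rightarrow> real" where "kappa \<nu> = (2 * \<nu> / (1 + \<nu>)) powr \<nu> / (1 + \<nu>)"

lemma kappa_pos: "0 < \<nu> \<Longrightarrow> 0 < kappa \<nu>" by (simp add: kappa_def)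

lemma kappa_exp:
  assumes "0 < \<nu>"
  shows "kappa \<nu> = exp (\<nu> * ln (2 * \<nu>) - (1 + \<nu>) * ln (1 + \<nu>))"
  using assms by (simp add: kappa_def powr_def ln_div exp_diff algebra_simps exp_add)

text \<open>The logarithm of \<open>kappa\<close> has derivative ln (2 x / (1 + x)), which is
  nonpositive up to 1. Interval estimates may thus evaluate \<open>kappa\<close> at the left
  end.\<close>

lemma kappa_antimono:
  assumes "0 < a" "a \<le> b" "b \<le> 1"
  shows "kappa b \<le> kappa a"
proof -
  have "a * ln (2 * a) - (1 + a) * ln (1 + a) \<ge> b * ln (2 * b) - (1 + b) * ln (1 + b)"
  proof (rule DERIV_nonpos_imp_nonincreasing[OF assms(2), of "\<lambda>x. x * ln (2 * x) - (1 + x) * ln (1 + x)"])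
    fix x assume x: "a \<le> x" "x \<le> b"
    have "((\<lambda>x. x * ln (2 * x) - (1 + x) * ln (1 + x)) has_real_derivative (ln (2 * x) - ln (1 + x))) (at x)"
      using x assms by (auto intro!: derivative_eq_intros simp: field_simps)
    moreover have "ln (2 * x) - ln (1 + x) \<le> 0" using x assms by simp
    ultimately show "\<exists>y. ((\<lambda>x. x * ln (2 * x) - (1 + x) * ln (1 + x)) has_real_derivative y) (at x) \<and> y \<le> 0" by blast
  qed
  then show ?thesis using assms by (simp add: kappa_exp)
qed

text \<open>The parameter \<open>t = (1 - \<nu>) / (1 + \<nu>)\<close> rationalises the maximal step: \<open>2\<nu> / (1 + \<nu>) = 1 - t\<close>.\<close>

lemma powr_le_quadratic:
  fixes t a :: real
  assumes "0 \<le> t" "t < 1" "0 \<le> a" "a \<le> 1"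
  shows "(1 - t) powr a \<le> 1 - a * t - a * (1 - a) / 2 * t\<^sup>2"
proof -
  let ?F = "\<lambda>x. 1 - a * x - a * (1 - a) / 2 * x\<^sup>2 - (1 - x) powr a"
  have "?F 0 \<le> ?F t"
  proof (rule DERIV_nonneg_imp_nondecreasing[OF assms(1)])
    fix x assume x: "0 \<le> x" "x \<le> t"
    have "(?F has_real_derivative (- a - a * (1 - a) * x + a * (1 - x) powr (a - 1))) (at x)"
      using x assms by (auto intro!: derivative_eq_intros simp: field_simps)
    moreover have "(1 + (- x)) powr (- (1 - a)) \<ge> 1 - (1 - a) * (- x)"
      using x assms by (intro powr_neg_ge_tangent) auto
    then have "a * (1 + (1 - a) * x) \<le> a * (1 - x) powr (a - 1)"
      using assms by (intro mult_left_mono) auto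
    then have "- a - a * (1 - a) * x + a * (1 - x) powr (a - 1) \<ge> 0" by (simp add: algebra_simps)
    ultimately show "\<exists>y. (?F has_real_derivative y) (at x) \<and> 0 \<le> y" by blast
  qed
  then show ?thesis by simp
qed

text \<open>Because \<nu> (1 + t) = 1 - t, the linear terms of the expansion cancel:
  \<open>2 * kappa \<nu> - 1\<close> is only of second order in t.\<close>

lemma kappa_t:
  assumes "0 < \<nu>" "\<nu> \<le> 1" defines "t \<equiv> (1 - \<nu>) / (1 + \<nu>)"
  shows "2 * kappa \<nu> \<le> 1 + t\<^sup>2 * (1 + t\<^sup>2) / (1 + t)"
proof -
  have t: "0 \<le> t" "t < 1" "2 * \<nu> / (1 + \<nu>) = 1 - t" using assms by (auto simp: t_def field_simps)
  have nut: "\<nu> = (1 - t) / (1 + t)" using assms by (simp add: t_def field_simps)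
  have "2 * kappa \<nu> = (1 - t) powr \<nu> * (1 + t)"
    unfolding kappa_def t(3) using t by (simp add: nut field_simps)
  also have "\<dots> \<le> (1 - \<nu> * t - \<nu> * (1 - \<nu>) / 2 * t\<^sup>2) * (1 + t)"
    using powr_le_quadratic[of t \<nu>] t assms by (intro mult_right_mono) auto
  also have "\<dots> = 1 + t - (\<nu> * (1 + t)) * t - (\<nu> * (1 + t)) * ((1 - \<nu>) / 2) * t\<^sup>2"
    by (simp add: algebra_simps)
  also have "\<dots> = 1 + t - (1 - t) * t - (1 - t) * (t / (1 + t)) * t\<^sup>2"
  proof -
    have "\<nu> * (1 + t) = 1 - t" "(1 - \<nu>) / 2 = t / (1 + t)" using t by (auto simp: nut field_simps)
    then show ?thesis by (simp only:)
  qed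
  also have "\<dots> = 1 + t\<^sup>2 * (1 + t\<^sup>2) / (1 + t)"
    using t by (simp add: field_simps power2_eq_square)
  finally show ?thesis .
qed

text \<open>Sharp: with u = w powr (2 / (1 - t)) the left side is u powr (1 - t) - u, maximal at u =
  (1 - t) powr (1 / t), and \<open>E\<close> is chosen so that the weighted mean inequality is an
  equality there. For t = (1 - \<nu>) / (1 + \<nu>) the exponent 2 / (1 - t) is (1 + \<nu>) /
  \<nu>.\<close>

lemma sq_minus_powr_le:
  fixes w t :: real
  assumes w: "0 \<le> w" "w \<le> 1" and t: "0 < t" "t < 1"
  shows "w\<^sup>2 - w powr (2 / (1 - t)) \<le> t * (1 - t) powr ((1 - t) / t)"
proof (cases "w = 0")
  case True
  then show ?thesis using w t by auto
next
  case False
  then have w0: "0 < w" using w by auto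
  define E where "E = (1 - t) powr ((1 - t) / t)"
  have E0: "E > 0" using t by (simp add: E_def)
  have "(w powr (2 / (1 - t)) / (1 - t)) powr (1 - t) * E powr t
      \<le> (1 - t) * (w powr (2 / (1 - t)) / (1 - t)) + t * E"
    using t w0 E0 by (intro Youngs_inequality_0) auto
  moreover have "(w powr (2 / (1 - t)) / (1 - t)) powr (1 - t) * E powr t = w\<^sup>2"
  proof -
    have "2 / (1 - t) * (1 - t) = 2" "(1 - t) / t * t = 1 - t" using t by (auto simp: field_simps)
    then have "(w powr (2 / (1 - t))) powr (1 - t) = w\<^sup>2" "E powr t = (1 - t) powr (1 - t)"
      using w0 unfolding E_def powr_powr by (auto simp: powr_numeral)
    then show ?thesis using t w0 by (simp add: powr_divide)
  qed
  ultimately show ?thesis using t by (simp add: E_def)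
qed

text \<open>In logarithms, the second factor of the sharp bound is at most 1/2 iff (1 - t) ln (1 -
  t) + t ln 2 is nonpositive; this function is convex and vanishes at 0 and 1/2.\<close>

lemma sq_minus_powr_le_half:
  fixes w t :: real
  assumes w: "0 \<le> w" "w \<le> 1" and t: "0 \<le> t" "t \<le> 1/2"
  shows "w\<^sup>2 - w powr (2 / (1 - t)) \<le> t / 2"
proof (cases "t = 0")
  case True
  then show ?thesis using w by (auto simp: powr_numeral)
next
  case False
  then have t0: "0 < t" using t by simp
  let ?h = "\<lambda>t::real. (1 - t) * ln (1 - t) + t * ln 2"
  have c: "convex_on {0..1/2} ?h"
  proof (rule f''_ge0_imp_convex[where f' = "\<lambda>t. - 1 - ln (1 - t) + ln 2" and f'' = "\<lambda>t. 1 / (1 - t)"])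
    fix x :: real assume x: "x \<in> {0..1/2}"
    have "(?h has_real_derivative ((1 - x) * (- 1 / (1 - x)) - ln (1 - x) + ln 2)) (at x)"
      using x by (auto intro!: derivative_eq_intros)
    moreover have "(1 - x) * (- 1 / (1 - x)) = - 1" using x by simp
    ultimately show "(?h has_real_derivative - 1 - ln (1 - x) + ln 2) (at x)" by simp
    show "((\<lambda>t. - 1 - ln (1 - t) + ln 2) has_real_derivative 1 / (1 - x)) (at x)"
      using x by (auto intro!: derivative_eq_intros simp: field_simps)
    show "0 \<le> 1 / (1 - x)" using x by simp
  qed auto
  have "?h ((1 - 2 * t) *\<^sub>R 0 + (2 * t) *\<^sub>R (1/2)) \<le> (1 - 2 * t) * ?h 0 + (2 * t) * ?h (1/2)"
    using t t0 by (intro convex_onD[OF c]) auto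
  then have "?h t \<le> 0" by (simp add: ln_div)
  then have "(1 - t) / t * ln (1 - t) \<le> ln (1 / 2)"
    using t0 by (simp add: field_simps ln_div)
  then have "exp ((1 - t) / t * ln (1 - t)) \<le> exp (ln (1 / 2))" by (simp only: exp_le_cancel_iff)
  then have "(1 - t) powr ((1 - t) / t) \<le> 1 / 2" using t by (simp add: powr_def)
  then have "t * (1 - t) powr ((1 - t) / t) \<le> t / 2" using t0 by (simp add: field_simps)
  then show ?thesis using sq_minus_powr_le[of w t] w t t0 by linarith
qed

text \<open>Reduces a numerical bound with rational exponent m / n to integer powers, which can be
  evaluated.\<close>

lemma powr_le_of_power:
  fixes z c a :: real
  assumes "0 < n" "0 < z" "0 \<le> c" "real n * a = real m" "z ^ m \<le> c ^ n"
  shows "z powr a \<le> c"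
proof -
  have "(z powr a) ^ n = z powr (real n * a)"
    using assms by (simp add: powr_powr mult.commute flip: powr_realpow)
  also have "\<dots> = z ^ m" unfolding assms(4) using assms(2) by (intro powr_realpow)
  finally have "(z powr a) ^ n \<le> c ^ n" using assms(5) by simp
  then show ?thesis using assms(1,3) by (cases n) (auto intro: power_le_imp_le_base)
qed

lemma powr_ge_of_power:
  fixes z c a :: real
  assumes "0 < n" "0 < z" "real n * a = real m" "c ^ n \<le> z ^ m"
  shows "c \<le> z powr a"
proof -
  have "(z powr a) ^ n = z powr (real n * a)"
    using assms by (simp add: powr_powr mult.commute flip: powr_realpow)
  also have "\<dots> = z ^ m" unfolding assms(3) using assms(2) by (intro powr_realpow)
  finally have "c ^ n \<le> (z powr a) ^ n" using assms(4) by simp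
  then show ?thesis using assms(1) by (cases n) (auto intro: power_le_imp_le_base)
qed

text \<open>Rests on - ln \<sigma> \<le> (1 - \<sigma>) / sqrt \<sigma>. Compared with the tangent
  bound, whose denominator is \<sigma>, the root is what makes small \<sigma> manageable.\<close>

lemma one_minus_powr_le:
  fixes \<sigma> a :: real
  assumes s: "0 < \<sigma>" "\<sigma> \<le> 1" and a: "0 \<le> a"
  shows "1 - \<sigma> powr a \<le> a * ((1 - \<sigma>) / sqrt \<sigma>)"
proof -
  define q where "q = sqrt \<sigma>"
  have q: "0 < q" "q \<le> 1" "\<sigma> = q\<^sup>2" using s by (auto simp: q_def)
  have "1 - q\<^sup>2 + 2 * q * ln q \<ge> 1 - 1\<^sup>2 + 2 * 1 * ln 1"
  proof (rule DERIV_nonpos_imp_nonincreasing[OF q(2), of "\<lambda>q. 1 - q\<^sup>2 + 2 * q * ln q"])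
    fix x :: real assume x: "q \<le> x" "x \<le> 1"
    have "((\<lambda>q. 1 - q\<^sup>2 + 2 * q * ln q) has_real_derivative (2 + 2 * ln x - 2 * x)) (at x)"
      using x q by (auto intro!: derivative_eq_intros simp: field_simps)
    moreover have "2 + 2 * ln x - 2 * x \<le> 0" using ln_le_minus_one[of x] x q by simp
    ultimately show "\<exists>y. ((\<lambda>q. 1 - q\<^sup>2 + 2 * q * ln q) has_real_derivative y) (at x) \<and> y \<le> 0" by blast
  qed
  then have "- ln \<sigma> \<le> (1 - \<sigma>) / q" using q by (simp add: field_simps ln_realpow)
  then have "a * (- ln \<sigma>) \<le> a * ((1 - \<sigma>) / q)" using a by (intro mult_left_mono)
  moreover have "\<sigma> powr a \<ge> 1 + a * ln \<sigma>" using s by (simp add: powr_def)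
  ultimately show ?thesis by (simp add: q_def)
qed

section \<open>Two-point estimates for \<nu> between 1/7 and 1\<close>

text \<open>The right side minus the left is (1 - z)(m - V z). It turns an affine bound on a squared
  gradient into a multiple of z squared, whose power p / 2 is a multiple of z powr p.\<close>

lemma quadratic_frac_le:
  fixes z V m :: real
  assumes "z \<le> 1" "V * z \<le> m" 
  shows "(V + m) * z - m \<le> V * z\<^sup>2"
proof -
  have "(1 - z) * (m - V * z) \<ge> 0" using assms by simp
  then show ?thesis by (simp add: algebra_simps power2_eq_square)
qed

text \<open>Both versions of the two-point estimate. Here \<open>x\<close> is the decrease of a step and \<open>y\<close> the new
  gradient norm, in units in which the old gradient and the full decrease are \<open>1\<close>.\<close>

lemma two_point_weak:
  fixes \<nu> x y w b \<mu> V E :: real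
  assumes nu: "0 < \<nu>" "\<nu> \<le> 1" and x: "0 \<le> x" "x \<le> kappa \<nu>"
    and y: "0 \<le> y" "y\<^sup>2 \<le> 2 * x - 1 + w\<^sup>2 - w powr ((1 + \<nu>) / \<nu>)"
    and mu: "w\<^sup>2 - w powr ((1 + \<nu>) / \<nu>) \<le> \<mu>" "\<mu> \<le> 1"
    and V: "2 * kappa \<nu> - 1 + \<mu> \<le> V" "0 \<le> V"
    and E: "V powr ((1 + \<nu>) / \<nu> / 2) \<le> E" "E \<le> 1 - (1 + \<nu>) * kappa \<nu> * b"
  shows "kappa \<nu> * y powr ((1 + \<nu>) / \<nu>) \<le> x * (1 - (1 + \<nu>) * kappa \<nu> * b)"
proof -
  define p where "p = (1 + \<nu>) / \<nu>"
  have p: "p \<ge> 2" using nu by (simp add: p_def field_simps)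
  have k: "kappa \<nu> > 0" using nu by (simp add: kappa_pos)
  define z where "z = x / kappa \<nu>"
  have z: "0 \<le> z" "z \<le> 1" "x = z * kappa \<nu>" using x k by (auto simp: z_def)
  have "y\<^sup>2 \<le> 2 * x - 1 + \<mu>" using y mu by simp
  \<comment> \<open>The left side is affine in z, nonpositive at 0 and equal to the right side at
    1.\<close>
  also have "\<dots> \<le> z * (2 * kappa \<nu> - 1 + \<mu>)"
  proof -
    have "(1 - z) * (1 - \<mu>) \<ge> 0" using z mu by simp
    then show ?thesis by (simp add: z(3) algebra_simps)
  qed
  also have "\<dots> \<le> z * V" using V z by (intro mult_left_mono)
  finally have y2: "y\<^sup>2 \<le> z * V" .
  have "y powr p = (y powr 2) powr (p / 2)" by (simp add: powr_powr)
  also have "\<dots> \<le> (z * V) powr (p / 2)"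
    using y y2 p by (intro powr_mono2) (auto simp: powr_numeral)
  also have "\<dots> = z powr (p / 2) * V powr (p / 2)" using z V by (simp add: powr_mult)
  also have "\<dots> \<le> z * V powr (p / 2)"
    using z p powr_le_one_le[of z "p / 2"] by (intro mult_right_mono) (cases "z = 0", auto)
  also have "\<dots> \<le> z * (1 - (1 + \<nu>) * kappa \<nu> * b)"
    using E z by (intro mult_left_mono) (auto simp: p_def)
  finally have "kappa \<nu> * y powr p \<le> kappa \<nu> * (z * (1 - (1 + \<nu>) * kappa \<nu> * b))"
    using k by (intro mult_left_mono) auto
  then show ?thesis by (simp add: p_def z(3) mult_ac)
qed

lemma two_point_strong:
  fixes \<nu> x y w b \<mu> V E Z :: real
  assumes nu: "0 < \<nu>" "\<nu> \<le> 1" and x: "1 - kappa \<nu> \<le> x" "x \<le> kappa \<nu>" and b: "0 \<le> b"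
    and y: "0 \<le> y" "y\<^sup>2 \<le> 2 * x - 1 + w\<^sup>2 - w powr ((1 + \<nu>) / \<nu>)"
    and mu: "w\<^sup>2 - w powr ((1 + \<nu>) / \<nu>) \<le> \<mu>" "0 \<le> \<mu>"
    and V: "2 * kappa \<nu> - 1 + \<mu> \<le> V" "0 \<le> V" "V + \<mu> \<le> 1"
    and E: "V powr ((1 + \<nu>) / \<nu> / 2) \<le> E" "E \<le> 1"
    and Z: "Z \<le> ((1 - kappa \<nu>) / kappa \<nu>) powr (1 / \<nu>)" "kappa \<nu> < 1"
    and K: "(1 + \<nu>) * kappa \<nu> * b \<le> Z * (1 - E)"
  shows "y powr ((1 + \<nu>) / \<nu>) + (1 + \<nu>) * b * x \<le> (x / kappa \<nu>) powr ((1 + \<nu>) / \<nu>)"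
proof -
  define p where "p = (1 + \<nu>) / \<nu>"
  have p: "p \<ge> 2" "p = 1 + 1 / \<nu>" using nu by (auto simp: p_def field_simps)
  have k: "kappa \<nu> > 0" using nu by (simp add: kappa_pos)
  define z where "z = x / kappa \<nu>"
  have z: "0 < z" "z \<le> 1" "x = z * kappa \<nu>" using x k Z(2) by (auto simp: z_def)
  have zge: "(1 - kappa \<nu>) / kappa \<nu> \<le> z" using x k by (simp add: z_def divide_right_mono)
  have "y\<^sup>2 \<le> 2 * x - 1 + \<mu>" using y mu by simp
  also have "\<dots> \<le> (V + (1 - \<mu>)) * z - (1 - \<mu>)"
  proof -
    have "2 * kappa \<nu> * z \<le> (V + 1 - \<mu>) * z" using V z by (intro mult_right_mono) auto
    then show ?thesis by (simp add: z(3) algebra_simps)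
  qed
  also have "\<dots> \<le> V * z\<^sup>2"
  proof (rule quadratic_frac_le[OF z(2)])
    have "V * z \<le> V * 1" using V z by (intro mult_left_mono) auto
    then show "V * z \<le> 1 - \<mu>" using V by simp
  qed
  finally have y2: "y\<^sup>2 \<le> V * z\<^sup>2" .
  have "y powr p = (y powr 2) powr (p / 2)" by (simp add: powr_powr)
  also have "\<dots> \<le> (V * z\<^sup>2) powr (p / 2)"
    using y y2 p by (intro powr_mono2) (auto simp: powr_numeral)
  also have "\<dots> = V powr (p / 2) * z powr p"
    using z V by (simp add: powr_mult powr_powr flip: powr_numeral)
  also have "\<dots> \<le> E * z powr p" using E by (intro mult_right_mono) (auto simp: p_def)
  finally have yp: "y powr p \<le> E * z powr p" .
  \<comment> \<open>A share 1 - E of z powr p is left to pay for a term linear in z; the worst case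
    is the smallest z that the descent lemma admits.\<close>
  have "((1 - kappa \<nu>) / kappa \<nu>) powr (1 / \<nu>) \<le> z powr (1 / \<nu>)"
    using zge nu Z(2) k by (intro powr_mono2) auto
  then have "Z * (1 - E) \<le> z powr (1 / \<nu>) * (1 - E)"
    using Z E by (intro mult_right_mono) auto
  then have "(1 + \<nu>) * kappa \<nu> * b \<le> z powr (1 / \<nu>) * (1 - E)" using K by simp
  then have "z * ((1 + \<nu>) * kappa \<nu> * b) \<le> z * (z powr (1 / \<nu>) * (1 - E))"
    using z by (intro mult_left_mono) auto
  also have "\<dots> = z powr p * (1 - E)" using z by (simp add: p(2) powr_add)
  finally have "(1 + \<nu>) * b * x \<le> z powr p * (1 - E)" by (simp add: z(3) mult_ac)
  then show ?thesis using yp by (simp add: p_def z_def algebra_simps)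
qed

lemma kappa_le_of_power:
  assumes "0 < \<nu>" "0 < n" "0 \<le> c" "real n * \<nu> = real m"
    and "(2 * \<nu> / (1 + \<nu>)) ^ m \<le> (c * (1 + \<nu>)) ^ n"
  shows "kappa \<nu> \<le> c"
  using powr_le_of_power[of n "2 * \<nu> / (1 + \<nu>)" "c * (1 + \<nu>)" \<nu> m] assms
  by (simp add: kappa_def field_simps)

text \<open>\<open>n\<close> is the exponent \<open>(1 + \<nu>) / \<nu>\<close> at the left
  end of the interval \<open>[1 / (n - 1), \<nu>\<^sub>2]\<close> on which \<open>\<nu>\<close> is enclosed.\<close>

lemma two_point_weak_interval:
  fixes \<nu> x y w b k1 V E e n2 n :: real
  assumes nu: "0 < \<nu>" "1 / (n - 1) \<le> \<nu>" "\<nu> \<le> n2" "n2 \<le> 1" and n: "n > 2"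
    and x: "0 \<le> x" "x \<le> kappa \<nu>" and w: "0 \<le> w" "w \<le> 1" and b: "0 \<le> b" "b \<le> 2 * \<nu> / (1 + \<nu>)"
    and y: "0 \<le> y" "y\<^sup>2 \<le> 2 * x - 1 + w\<^sup>2 - w powr ((1 + \<nu>) / \<nu>)"
    and k1: "kappa (1 / (n - 1)) \<le> k1"
    and e: "(2 / n) powr (2 / (n - 2)) \<le> e" "e \<le> 1"
    and V: "2 * k1 - 1 + (1 - 2 / n) * e \<le> V" "0 < V" "V \<le> 1"
    and E: "V powr ((1 + n2) / n2 / 2) \<le> E" "E \<le> 1 - 2 * n2 * k1"
  shows "kappa \<nu> * y powr ((1 + \<nu>) / \<nu>) \<le> x * (1 - (1 + \<nu>) * kappa \<nu> * b)"
proof (rule two_point_weak[where \<mu> = "(1 - 2 / n) * e" and V = V and E = E and w = w])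
  define t where "t = 1 - 2 / n"
  have t: "0 < t" "t < 1" "1 - t = 2 / n" "2 / (1 - t) = n" "(1 - t) / t = 2 / (n - 2)"
    using n by (auto simp: t_def field_simps)
  have pn: "(1 + \<nu>) / \<nu> \<le> n" using nu n by (simp add: field_simps)
  have "w powr n \<le> w powr ((1 + \<nu>) / \<nu>)" using pn w by (intro powr_mono') auto
  moreover have "w\<^sup>2 - w powr n \<le> t * (2 / n) powr (2 / (n - 2))"
    using sq_minus_powr_le[OF w t(1,2)] t by simp
  moreover have "\<dots> \<le> t * e" using e t by (intro mult_left_mono) auto
  ultimately show "w\<^sup>2 - w powr ((1 + \<nu>) / \<nu>) \<le> (1 - 2 / n) * e" by (simp add: t_def)
  have "0 \<le> e" using e(1) powr_ge_zero[of "2/n" "2 / (n - 2)"] by linarith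
  then have "(1 - 2 / n) * e \<le> 1 * 1" using e t by (intro mult_mono) (auto simp: t_def)
  then show "(1 - 2 / n) * e \<le> 1" by simp
  have kk: "kappa \<nu> \<le> k1" using kappa_antimono[of "1 / (n - 1)" \<nu>] nu n k1 by simp
  then show "2 * kappa \<nu> - 1 + (1 - 2 / n) * e \<le> V" using V by simp
  have "(1 + n2) / n2 \<le> (1 + \<nu>) / \<nu>" using nu by (simp add: field_simps)
  then have "V powr ((1 + \<nu>) / \<nu> / 2) \<le> V powr ((1 + n2) / n2 / 2)"
    using V by (intro powr_mono') auto
  then show "V powr ((1 + \<nu>) / \<nu> / 2) \<le> E" using E by simp
  have "(1 + \<nu>) * kappa \<nu> * b \<le> (1 + \<nu>) * kappa \<nu> * (2 * \<nu> / (1 + \<nu>))"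
    using b nu kappa_pos[of \<nu>] by (intro mult_left_mono) auto
  also have "\<dots> = 2 * \<nu> * kappa \<nu>" using nu by simp
  also have "\<dots> \<le> 2 * n2 * k1" using nu kk kappa_pos[of \<nu>] by (intro mult_mono) auto
  finally show "E \<le> 1 - (1 + \<nu>) * kappa \<nu> * b" using E by simp
qed (use nu x y V in auto)

text \<open>There is slack throughout this range, so four intervals with constant bounds suffice:
  \<open>kappa\<close> and the maximum over \<open>w\<close> are taken at the left end, the power of
  \<open>V\<close> and the step at the right end.\<close>

lemma two_point_weak_range:
  fixes \<nu> x y w b :: real
  assumes nu: "1 / 7 \<le> \<nu>" "\<nu> \<le> 13 / 27"
    and x: "0 \<le> x" "x \<le> kappa \<nu>" and w: "0 \<le> w" "w \<le> 1" and b: "0 \<le> b" "b \<le> 2 * \<nu> / (1 + \<nu>)"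
    and y: "0 \<le> y" "y\<^sup>2 \<le> 2 * x - 1 + w\<^sup>2 - w powr ((1 + \<nu>) / \<nu>)"
  shows "kappa \<nu> * y powr ((1 + \<nu>) / \<nu>) \<le> x * (1 - (1 + \<nu>) * kappa \<nu> * b)"
proof -
  consider "\<nu> \<le> 1/6" | "1/6 \<le> \<nu>" "\<nu> \<le> 1/4" | "1/4 \<le> \<nu>" "\<nu> \<le> 1/3" | "1/3 \<le> \<nu>" by linarith
  then show ?thesis
  proof cases
    case 1
    have k: "kappa (1/7) \<le> 718/1000"
      by (rule kappa_le_of_power[of _ 7 _ 1]) (simp_all add: power_divide)
    have e: "(2 / 8) powr (2 / (8 - 2)) \<le> (63/100::real)"
      by (rule powr_le_of_power[of 3 _ _ _ 1]) (simp_all add: power_divide)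
    have E: "(909/1000) powr ((1 + 1/6) / (1/6) / 2) \<le> (717/1000::real)"
      by (rule powr_le_of_power[of 2 _ _ _ 7]) (simp_all add: power_divide)
    show ?thesis
      by (rule two_point_weak_interval[where n = 8 and ?n2.0 = "1/6" and w = w and V = "909/1000", OF _ _ _ _ _ x w b y _ e _ _ _ _ E])
         (use nu 1 k in auto)
  next
    case 2
    have k: "kappa (1/6) \<le> 696/1000"
      by (rule kappa_le_of_power[of _ 6 _ 1]) (simp_all add: power_divide)
    have e: "(2 / 7) powr (2 / (7 - 2)) \<le> (606/1000::real)"
      by (rule powr_le_of_power[of 5 _ _ _ 2]) (simp_all add: power_divide)
    have E: "(825/1000) powr ((1 + 1/4) / (1/4) / 2) \<le> (619/1000::real)"
      by (rule powr_le_of_power[of 2 _ _ _ 5]) (simp_all add: power_divide)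
    show ?thesis
      by (rule two_point_weak_interval[where n = 7 and ?n2.0 = "1/4" and w = w and V = "825/1000", OF _ _ _ _ _ x w b y _ e _ _ _ _ E])
         (use nu 2 k in auto)
  next
    case 3
    have k: "kappa (1/4) \<le> 637/1000"
      by (rule kappa_le_of_power[of _ 4 _ 1]) (simp_all add: power_divide)
    have e: "(2 / 5) powr (2 / (5 - 2)) \<le> (543/1000::real)"
      by (rule powr_le_of_power[of 3 _ _ _ 2]) (simp_all add: power_divide)
    have E: "(6/10) powr ((1 + 1/3) / (1/3) / 2) \<le> (36/100::real)"
      by (rule powr_le_of_power[of 1 _ _ _ 2]) (simp_all add: power_divide)
    show ?thesis
      by (rule two_point_weak_interval[where n = 5 and ?n2.0 = "1/3" and w = w and V = "6/10", OF _ _ _ _ _ x w b y _ e _ _ _ _ E])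
         (use nu 3 k in auto)
  next
    case 4
    have k: "kappa (1/3) \<le> 596/1000"
      by (rule kappa_le_of_power[of _ 3 _ 1]) (simp_all add: power_divide)
    have e: "(2 / 4) powr (2 / (4 - 2)) \<le> (1/2::real)" by simp
    \<comment> \<open>The exponent is 20/13; lowering it to 3/2 keeps the integer powers
      small.\<close>
    have "(442/1000) powr ((1 + 13/27) / (13/27) / 2) \<le> (442/1000::real) powr (3/2)"
      by (rule powr_mono') auto
    also have "\<dots> \<le> (294/1000::real)"
      by (rule powr_le_of_power[of 2 _ _ _ 3]) (simp_all add: power_divide)
    finally have E: "(442/1000) powr ((1 + 13/27) / (13/27) / 2) \<le> (294/1000::real)" .
    show ?thesis
      by (rule two_point_weak_interval[where n = 4 and ?n2.0 = "13/27" and w = w and V = "442/1000", OF _ _ _ _ _ x w b y _ e _ _ _ _ E])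
         (use nu 4 k in auto)
  qed
qed

lemma kappa_less_1: assumes "0 < \<nu>" "\<nu> \<le> 1" shows "kappa \<nu> < 1"
proof -
  have "2 * \<nu> / (1 + \<nu>) \<le> 1" "0 < 2 * \<nu> / (1 + \<nu>)" using assms by auto
  then have "(2 * \<nu> / (1 + \<nu>)) powr \<nu> \<le> 1" using assms by (simp add: powr_le1)
  then show ?thesis using assms by (simp add: kappa_def field_simps)
qed

text \<open>The strong estimate in terms of t: \<open>T\<close> bounds
  \<open>2 * kappa \<nu> - 1\<close>, t / 2 bounds the maximum over \<open>w\<close>, and the
  longest admissible step is the worst one.\<close>

lemma two_point_strong_t:
  fixes \<nu> x y w b T E Z :: real
  assumes nu: "13 / 27 \<le> \<nu>" "\<nu> \<le> 1" and x: "1 - kappa \<nu> \<le> x" "x \<le> kappa \<nu>"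
    and w: "0 \<le> w" "w \<le> 1" and b: "0 \<le> b" "b \<le> 2 * \<nu> / (1 + \<nu>)"
    and y: "0 \<le> y" "y\<^sup>2 \<le> 2 * x - 1 + w\<^sup>2 - w powr ((1 + \<nu>) / \<nu>)"
  defines "t \<equiv> (1 - \<nu>) / (1 + \<nu>)"
  assumes T: "t\<^sup>2 * (1 + t\<^sup>2) / (1 + t) \<le> T" "0 \<le> T" "T + t \<le> 1" "T < 1"
    and E: "(T + t / 2) powr (1 / (1 - t)) \<le> E" "E \<le> 1"
    and Z: "Z \<le> ((1 - T) / (1 + T)) powr ((1 + t) / (1 - t))"
    and K: "(1 - t) * (1 + t\<^sup>2 * (1 + t\<^sup>2) / (1 + t)) / (1 + t) \<le> Z * (1 - E)"
  shows "y powr ((1 + \<nu>) / \<nu>) + (1 + \<nu>) * b * x \<le> (x / kappa \<nu>) powr ((1 + \<nu>) / \<nu>)"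
proof (rule two_point_strong[where \<mu> = "t / 2" and V = "T + t / 2" and E = E and Z = Z and w = w])
  have t: "0 \<le> t" "t \<le> 35 / 100" using nu by (auto simp: t_def field_simps)
  have nut: "\<nu> = (1 - t) / (1 + t)" "1 / \<nu> = (1 + t) / (1 - t)" "(1 + \<nu>) / \<nu> = 2 / (1 - t)" "1 + \<nu> = 2 / (1 + t)"
  proof -
    have "1 + t = 2 / (1 + \<nu>)" "1 - t = 2 * \<nu> / (1 + \<nu>)" using nu by (auto simp: t_def field_simps)
    note tt = this
    have "\<nu> \<noteq> 0" "1 + \<nu> \<noteq> 0" using nu by auto
    then show "\<nu> = (1 - t) / (1 + t)" "1 / \<nu> = (1 + t) / (1 - t)" "(1 + \<nu>) / \<nu> = 2 / (1 - t)" "1 + \<nu> = 2 / (1 + t)"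
      unfolding tt by (simp_all add: divide_simps)
  qed
  have k2: "2 * kappa \<nu> \<le> 1 + t\<^sup>2 * (1 + t\<^sup>2) / (1 + t)" using kappa_t[of \<nu>] nu by (simp add: t_def)
  have kpos: "kappa \<nu> > 0" using nu by (simp add: kappa_pos)
  show "w\<^sup>2 - w powr ((1 + \<nu>) / \<nu>) \<le> t / 2" unfolding nut(3) using w t by (intro sq_minus_powr_le_half) auto
  show "2 * kappa \<nu> - 1 + t / 2 \<le> T + t / 2" using k2 T by simp
  have "(1 + \<nu>) / \<nu> / 2 = 1 / (1 - t)" unfolding nut(3) using t by (simp add: field_simps)
  then show "(T + t / 2) powr ((1 + \<nu>) / \<nu> / 2) \<le> E" using E by simp
  have "2 * kappa \<nu> \<le> 1 + T" using k2 T by simp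
  then have "(1 - T) / (1 + T) \<le> (1 - kappa \<nu>) / kappa \<nu>"
    using kpos T by (simp add: field_simps)
  then have "((1 - T) / (1 + T)) powr ((1 + t) / (1 - t)) \<le> ((1 - kappa \<nu>) / kappa \<nu>) powr (1 / \<nu>)"
    unfolding nut(2) using t T by (intro powr_mono2) auto
  then show "Z \<le> ((1 - kappa \<nu>) / kappa \<nu>) powr (1 / \<nu>)" using Z by simp
  have "(1 + \<nu>) * kappa \<nu> * b \<le> (1 + \<nu>) * kappa \<nu> * (2 * \<nu> / (1 + \<nu>))"
    using b nu kpos by (intro mult_left_mono) auto
  also have "\<dots> = \<nu> * (2 * kappa \<nu>)" using nu by simp
  also have "\<dots> \<le> \<nu> * (1 + t\<^sup>2 * (1 + t\<^sup>2) / (1 + t))" using k2 nu by (intro mult_left_mono) auto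
  also have "\<dots> = (1 - t) * (1 + t\<^sup>2 * (1 + t\<^sup>2) / (1 + t)) / (1 + t)" by (simp add: nut(1))
  finally show "(1 + \<nu>) * kappa \<nu> * b \<le> Z * (1 - E)" using K by simp
  show "0 \<le> t / 2" "0 \<le> T + t / 2" "T + t / 2 + t / 2 \<le> 1" using t T by auto
qed (use nu x b y E kappa_less_1[of \<nu>] in auto)

lemma tau_mono:
  fixes t u :: real
  assumes "0 \<le> t" "t \<le> u"
  shows "t\<^sup>2 * (1 + t\<^sup>2) / (1 + t) \<le> u\<^sup>2 * (1 + u\<^sup>2) / (1 + u)"
proof -
  have "t / (1 + t) \<le> u / (1 + u)" using assms by (simp add: field_simps)
  moreover have "t * (1 + t\<^sup>2) \<le> u * (1 + u\<^sup>2)"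
    using assms by (intro mult_mono add_left_mono power_mono) auto
  ultimately have "t / (1 + t) * (t * (1 + t\<^sup>2)) \<le> u / (1 + u) * (u * (1 + u\<^sup>2))"
    using assms by (intro mult_mono) auto
  then show ?thesis by (simp add: power2_eq_square mult_ac)
qed

text \<open>Every ingredient is monotone in t or is replaced by a monotone bound, so an interval is
  settled by numbers at its ends.\<close>

lemma two_point_strong_interval:
  fixes \<nu> x y w b T E Z t1 t2 :: real
  assumes nu: "13 / 27 \<le> \<nu>" "\<nu> \<le> 1" and x: "1 - kappa \<nu> \<le> x" "x \<le> kappa \<nu>"
    and w: "0 \<le> w" "w \<le> 1" and b: "0 \<le> b" "b \<le> 2 * \<nu> / (1 + \<nu>)"
    and y: "0 \<le> y" "y\<^sup>2 \<le> 2 * x - 1 + w\<^sup>2 - w powr ((1 + \<nu>) / \<nu>)"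
  defines "t \<equiv> (1 - \<nu>) / (1 + \<nu>)"
  assumes t: "0 \<le> t1" "t1 \<le> t" "t \<le> t2" "t2 \<le> 35/100"
    and T: "t2\<^sup>2 * (1 + t2\<^sup>2) / (1 + t2) \<le> T" "T \<le> 1/2"
    and E: "(T + t2 / 2) powr (1 / (1 - t1)) \<le> E" "E \<le> 1"
    and Z: "Z \<le> ((1 - T) / (1 + T)) powr ((1 + t2) / (1 - t2))" "0 \<le> Z"
    and K: "(1 - 3 / 4 * t1 ^ 3) / (1 + t1)\<^sup>2 \<le> Z * (1 - E)"
  shows "y powr ((1 + \<nu>) / \<nu>) + (1 + \<nu>) * b * x \<le> (x / kappa \<nu>) powr ((1 + \<nu>) / \<nu>)"
proof (rule two_point_strong_t[OF nu x w b y])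
  have t0: "0 \<le> t" using t by simp
  have tau: "0 \<le> t\<^sup>2 * (1 + t\<^sup>2) / (1 + t)" "t\<^sup>2 * (1 + t\<^sup>2) / (1 + t) \<le> T"
    using tau_mono[of t t2] t T t0 by auto
  then have T0: "0 \<le> T" by linarith
  from tau this show "((1 - \<nu>) / (1 + \<nu>))\<^sup>2 * (1 + ((1 - \<nu>) / (1 + \<nu>))\<^sup>2) / (1 + (1 - \<nu>) / (1 + \<nu>)) \<le> T" "0 \<le> T"
    by (auto simp: t_def)
  show "T + (1 - \<nu>) / (1 + \<nu>) \<le> 1" "T < 1" using T t by (auto simp flip: t_def)
  have "(T + t / 2) powr (1 / (1 - t)) \<le> (T + t2 / 2) powr (1 / (1 - t))"
    using t T0 by (intro powr_mono2) auto
  also have "\<dots> \<le> (T + t2 / 2) powr (1 / (1 - t1))"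
    using t T0 T by (intro powr_mono') (auto simp: frac_le)
  finally show "(T + (1 - \<nu>) / (1 + \<nu>) / 2) powr (1 / (1 - (1 - \<nu>) / (1 + \<nu>))) \<le> E"
    using E by (simp flip: t_def)
  have "((1 - T) / (1 + T)) powr ((1 + t2) / (1 - t2)) \<le> ((1 - T) / (1 + T)) powr ((1 + t) / (1 - t))"
    using t T0 T by (intro powr_mono') (auto simp: frac_le)
  then show "Z \<le> ((1 - T) / (1 + T)) powr ((1 + (1 - \<nu>) / (1 + \<nu>)) / (1 - (1 - \<nu>) / (1 + \<nu>)))"
    using Z by (simp flip: t_def)
  have "(1 - t) * (1 + t\<^sup>2 * (1 + t\<^sup>2) / (1 + t)) / (1 + t) = (1 - t ^ 3 * (1 - t + t\<^sup>2)) / (1 + t)\<^sup>2"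
    using t0 by (simp add: divide_simps) (simp add: algebra_simps power2_eq_square power3_eq_cube)
  also have "\<dots> \<le> (1 - 3 / 4 * t1 ^ 3) / (1 + t1)\<^sup>2"
  proof (rule frac_le)
    \<comment> \<open>Origin of the factor 3/4: it is the minimum of 1 - t + t^2.\<close>
    have "0 \<le> (t - 1/2)\<^sup>2" by simp
    then have "3 / 4 \<le> 1 - t + t\<^sup>2" by (simp add: power2_eq_square algebra_simps)
    then have "t1 ^ 3 * (3 / 4) \<le> t ^ 3 * (1 - t + t\<^sup>2)" using t t0 by (intro mult_mono power_mono) auto
    then show "1 - t ^ 3 * (1 - t + t\<^sup>2) \<le> 1 - 3 / 4 * t1 ^ 3" by simp
    show "(1 + t1)\<^sup>2 \<le> (1 + t)\<^sup>2" using t by (intro power_mono) auto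
    have "t1 ^ 3 \<le> 1 ^ 3" using t by (intro power_mono) auto
    then show "0 \<le> 1 - 3 / 4 * t1 ^ 3" by simp
    show "0 < (1 + t1)\<^sup>2" using t by simp
  qed
  finally show "(1 - (1 - \<nu>) / (1 + \<nu>)) * (1 + ((1 - \<nu>) / (1 + \<nu>))\<^sup>2 * (1 + ((1 - \<nu>) / (1 + \<nu>))\<^sup>2) / (1 + (1 - \<nu>) / (1 + \<nu>))) / (1 + (1 - \<nu>) / (1 + \<nu>)) \<le> Z * (1 - E)"
    using K by (simp flip: t_def)
qed (use E in auto)

text \<open>The condition on \<open>Z\<close> and \<open>E\<close> is an equality at t = 0, so
  constant bounds cannot work there. Up to t = 1/4 all bounds are linear in t and the slack is t
  times a nonnegative quadratic; further on, three intervals with constants suffice.\<close>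

lemma two_point_strong_range:
  fixes \<nu> x y w b :: real
  assumes nu: "13 / 27 \<le> \<nu>" "\<nu> \<le> 1" and x: "1 - kappa \<nu> \<le> x" "x \<le> kappa \<nu>"
    and w: "0 \<le> w" "w \<le> 1" and b: "0 \<le> b" "b \<le> 2 * \<nu> / (1 + \<nu>)"
    and y: "0 \<le> y" "y\<^sup>2 \<le> 2 * x - 1 + w\<^sup>2 - w powr ((1 + \<nu>) / \<nu>)"
  shows "y powr ((1 + \<nu>) / \<nu>) + (1 + \<nu>) * b * x \<le> (x / kappa \<nu>) powr ((1 + \<nu>) / \<nu>)"
proof -
  define t where "t = (1 - \<nu>) / (1 + \<nu>)"
  have t: "0 \<le> t" "t \<le> 35/100" using nu by (auto simp: t_def field_simps)
  have half: "z powr a \<ge> z\<^sup>2" if "0 \<le> z" "z \<le> 1" "a \<le> 2" for z a :: real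
    using powr_mono'[of a 2 z] that by (simp add: powr_numeral)
  consider "t \<le> 1/4" | "1/4 \<le> t" "t \<le> 3/10" | "3/10 \<le> t" "t \<le> 33/100" | "33/100 \<le> t" using t by linarith
  then show ?thesis
  proof cases
    case 1
    \<comment> \<open>17/80 is 1/5 times 17/16, the bounds for t / (1 + t) and 1 + t^2 up to t =
      1/4.\<close>
    define T where "T = 17 / 80 * t"
    have T: "0 \<le> T" "T \<le> 1/8" "T + t \<le> 1" using t 1 by (auto simp: T_def)
    have tau: "t\<^sup>2 * (1 + t\<^sup>2) / (1 + t) \<le> T"
    proof -
      have "t / (1 + t) \<le> 1/5" using 1 t by (simp add: field_simps)
      moreover have "1 + t\<^sup>2 \<le> 1 + (1/4)\<^sup>2" using 1 t by (intro add_left_mono power_mono) auto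
      then have "1 + t\<^sup>2 \<le> 17/16" by (simp add: power2_eq_square)
      ultimately have "t / (1 + t) * (1 + t\<^sup>2) \<le> 1/5 * (17/16)"
        using t by (intro mult_mono) auto
      then have "t * (1 + t\<^sup>2) / (1 + t) \<le> 17/80" by simp
      then have "t * (t * (1 + t\<^sup>2) / (1 + t)) \<le> t * (17/80)"
        using t by (intro mult_left_mono)
      then show ?thesis by (simp add: T_def power2_eq_square mult_ac)
    qed
    show ?thesis
    proof (rule two_point_strong_t[OF nu x w b y, folded t_def, where T = T and E = "T + t / 2" and Z = "1 - 4 * T"])
      show "t\<^sup>2 * (1 + t\<^sup>2) / (1 + t) \<le> T" by (rule tau)
      show "0 \<le> T" "T + t \<le> 1" "T < 1" "T + t / 2 \<le> 1" using T t by auto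
      show "(T + t / 2) powr (1 / (1 - t)) \<le> T + t / 2"
        using powr_mono'[of 1 "1 / (1 - t)" "T + t / 2"] T t 1 by (simp add: field_simps)
      have "1 - 4 * T \<le> ((1 - T) / (1 + T))\<^sup>2"
      proof -
        have "(1 - 4 * T) * (1 + T)\<^sup>2 \<le> (1 - T)\<^sup>2"
          using T by (simp add: power2_eq_square algebra_simps)
        then show ?thesis using T by (simp add: power_divide pos_le_divide_eq)
      qed
      also have "\<dots> \<le> ((1 - T) / (1 + T)) powr ((1 + t) / (1 - t))"
        using T t 1 by (intro half) (auto simp: field_simps)
      finally show "1 - 4 * T \<le> ((1 - T) / (1 + T)) powr ((1 + t) / (1 - t))" .
      have "(1 - t) * (1 + t\<^sup>2 * (1 + t\<^sup>2) / (1 + t)) \<le> (1 - t) * (1 + T)"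
        using tau t by (intro mult_left_mono) auto
      also have "\<dots> \<le> (1 - 4 * T) * (1 - (T + t / 2)) * (1 + t)"
      proof -
        have "(1 - 4 * T) * (1 - (T + t / 2)) * (1 + t) - (1 - t) * (1 + T)
            = t * ((9/40 - 1191/1600 * t) + 969/1600 * t\<^sup>2)"
          by (simp add: T_def field_simps power2_eq_square)
        moreover have "\<dots> \<ge> 0" using t 1 by (intro mult_nonneg_nonneg add_nonneg_nonneg) auto
        ultimately show ?thesis by linarith
      qed
      finally show "(1 - t) * (1 + t\<^sup>2 * (1 + t\<^sup>2) / (1 + t)) / (1 + t) \<le> (1 - 4 * T) * (1 - (T + t / 2))"
        using t by (simp add: pos_divide_le_eq)
    qed
  next
    case 2
    have E: "(76/1000 + (3/10) / 2) powr (1 / (1 - 1/4)) \<le> (138/1000::real)"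
      by (rule powr_le_of_power[of 3 _ _ _ 4]) (simp_all add: power_divide)
    have "(737/1000::real) \<le> ((1 - 76/1000) / (1 + 76/1000))\<^sup>2" by (simp add: power_divide)
    also have "\<dots> \<le> ((1 - 76/1000) / (1 + 76/1000)) powr ((1 + 3/10) / (1 - 3/10))" by (intro half) auto
    finally have Z: "737/1000 \<le> ((1 - 76/1000) / (1 + 76/1000)) powr ((1 + 3/10) / (1 - 3/10 :: real))" .
    show ?thesis
      by (rule two_point_strong_interval[OF nu x w b y, folded t_def, OF _ _ _ _ _ _ E _ Z])
         (use 2 in \<open>simp_all add: power2_eq_square power3_eq_cube\<close>)
  next
    case 3
    have E: "(91/1000 + (33/100) / 2) powr (1 / (1 - 3/10)) \<le> (144/1000::real)"
      by (rule powr_le_of_power[of 7 _ _ _ 10]) (simp_all add: power_divide)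
    have "(694/1000::real) \<le> ((1 - 91/1000) / (1 + 91/1000))\<^sup>2" by (simp add: power_divide)
    also have "\<dots> \<le> ((1 - 91/1000) / (1 + 91/1000)) powr ((1 + 33/100) / (1 - 33/100))" by (intro half) auto
    finally have Z: "694/1000 \<le> ((1 - 91/1000) / (1 + 91/1000)) powr ((1 + 33/100) / (1 - 33/100 :: real))" .
    show ?thesis
      by (rule two_point_strong_interval[OF nu x w b y, folded t_def, OF _ _ _ _ _ _ E _ Z])
         (use 3 in \<open>simp_all add: power2_eq_square power3_eq_cube\<close>)
  next
    case 4
    have "(102/1000 + (35/100) / 2) powr (1 / (1 - 33/100)) \<le> (102/1000 + (35/100) / 2 :: real) powr (16/11)"
      by (rule powr_mono') auto
    also have "\<dots> \<le> (155/1000::real)"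
      by (rule powr_le_of_power[of 11 _ _ _ 16]) (simp_all add: power_divide)
    finally have E: "(102/1000 + (35/100) / 2) powr (1 / (1 - 33/100)) \<le> (155/1000::real)" .
    have Z: "653/1000 \<le> ((1 - 102/1000) / (1 + 102/1000)) powr ((1 + 35/100) / (1 - 35/100 :: real))"
      by (rule powr_ge_of_power[of 13 _ _ 27]) (simp_all add: power_divide)
    show ?thesis
      by (rule two_point_strong_interval[OF nu x w b y, folded t_def, OF _ _ _ _ _ _ E _ Z])
         (use t 4 in \<open>simp_all add: power2_eq_square power3_eq_cube\<close>)
  qed
qed

section \<open>Numerical inequalities for the third-point argument\<close>

text \<open>Here \<open>be\<close> is at most 1/4, so its \<nu>-th power is at most exp (- 2 \<nu>
  ln 2), and ln 2 \<ge> 2/3. The constant 218/100 serves \<open>third_point_numeric\<close>, where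
  its double has to exceed 4/10 times the square of 33/10, that is 4.356.\<close>

lemma kappa_small:
  assumes nu: "0 < \<nu>" "\<nu> \<le> 1 / 7"
  shows "kappa \<nu> \<le> 1 - 218 / 100 * (\<nu> / (1 + \<nu>))"
proof -
  define be where "be = 2 * \<nu> / (1 + \<nu>)"
  have be: "0 < be" "be \<le> 1 / 4" using nu by (auto simp: be_def field_simps)
  define z where "z = 4 / 3 * \<nu>"
  have "be powr \<nu> \<le> (1 / 4) powr \<nu>" using be nu by (intro powr_mono2) auto
  also have "\<dots> = exp (- (2 * \<nu> * ln 2))"
    using ln_realpow[of 2 2] by (simp add: powr_def ln_div)
  also have "\<dots> \<le> exp (- z)" using ln2_ge_two_thirds nu by (simp add: z_def)
  also have "\<dots> \<le> 1 / (1 + z + z\<^sup>2 / 2)"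
  proof -
    have z: "0 \<le> z" using nu by (simp add: z_def)
    then have "0 < 1 + z + z\<^sup>2 / 2" by (simp add: add_pos_nonneg)
    then have "inverse (exp z) \<le> inverse (1 + z + z\<^sup>2 / 2)"
      using exp_lower_Taylor_quadratic[OF z] by (intro le_imp_inverse_le)
    then show ?thesis by (simp add: exp_minus inverse_eq_divide)
  qed
  finally have "kappa \<nu> \<le> 1 / (1 + z + z\<^sup>2 / 2) / (1 + \<nu>)"
    unfolding kappa_def be_def[symmetric] using nu by (intro divide_right_mono) auto
  also have "\<dots> \<le> (1 - 118 / 100 * \<nu>) / (1 + \<nu>)"
  proof (rule divide_right_mono)
    have "(1 - 118 / 100 * \<nu>) * (1 + z + z\<^sup>2 / 2) - 1
        = \<nu> * ((23 / 150 - 154 / 225 * \<nu> - 236 / 225 * \<nu>\<^sup>2))"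
      by (simp add: z_def power2_eq_square algebra_simps)
    moreover have "\<nu>\<^sup>2 \<le> (1/7)\<^sup>2" using nu by (intro power_mono) auto
    then have "\<nu> * ((23 / 150 - 154 / 225 * \<nu> - 236 / 225 * \<nu>\<^sup>2)) \<ge> 0"
      using nu by (intro mult_nonneg_nonneg) (auto simp: power2_eq_square)
    ultimately have "1 \<le> (1 - 118 / 100 * \<nu>) * (1 + z + z\<^sup>2 / 2)" by linarith
    moreover have "1 + z + z\<^sup>2 / 2 > 0" using nu by (simp add: z_def add_pos_nonneg)
    ultimately show "1 / (1 + z + z\<^sup>2 / 2) \<le> 1 - 118 / 100 * \<nu>" by (simp add: pos_divide_le_eq)
  qed (use nu in auto)
  also have "\<dots> = 1 - 218 / 100 * (\<nu> / (1 + \<nu>))" using nu by (simp add: field_simps)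
  finally show ?thesis .
qed

lemma kappa_ge_7: assumes nu: "0 < \<nu>" "\<nu> \<le> 1 / 7" shows "kappa \<nu> \<ge> 7 / 10"
proof -
  have "8/10 \<le> (2 * (1/7) / (1 + 1/7)) powr (1/7::real)"
    by (rule powr_ge_of_power[of 7 _ _ 1]) (simp_all add: power_divide)
  then have "7/10 \<le> kappa (1/7)" by (simp add: kappa_def)
  then show ?thesis using kappa_antimono[of \<nu> "1/7"] nu by simp
qed

text \<open>Excludes a too small decrease for small \<open>\<nu>\<close>: the third-point argument shows that such a
  decrease would give the reverse inequality.\<close>

lemma third_point_numeric:
  fixes \<nu> \<sigma> Y \<theta> :: real
  assumes nu: "0 < \<nu>" "\<nu> \<le> 1 / 7" and th: "\<theta> = \<nu> / (1 + \<nu>)"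
    and s: "1 - kappa \<nu> \<le> kappa \<nu> * \<sigma>" "\<sigma> \<le> 1" and Y: "1 - kappa \<nu> * \<sigma> \<le> Y"
  shows "4 / 10 * Y\<^sup>2 - 8 / 10 * (1 - \<sigma> powr \<theta>) - \<theta> * (264 / 100 * Y - 2 * (1 - kappa \<nu> * \<sigma>)) > 0"
proof -
  define k where "k = kappa \<nu>"
  have k: "7/10 \<le> k" "k < 1" "k \<le> 1 - 218/100 * \<theta>"
    using kappa_ge_7[OF nu] kappa_less_1[of \<nu>] kappa_small[OF nu] nu by (auto simp: k_def th)
  have t: "0 < \<theta>" "\<theta> \<le> 1/8" using nu by (auto simp: th field_simps)
  have sk: "1 - k \<le> k * \<sigma>" using s by (simp add: k_def)
  then have "0 < k * \<sigma>" using k by linarith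
  then have s0: "0 < \<sigma>" using k by (simp add: zero_less_mult_iff)
  define Y0 where "Y0 = 1 - k * \<sigma>"
  have Y0: "Y0 \<le> Y" using Y by (simp add: Y0_def k_def)
  show ?thesis
  proof (cases "\<sigma> \<ge> 6/10")
    case True
    have "1 - \<sigma> powr \<theta> \<le> \<theta> * ((1 - \<sigma>) / \<sigma>)"
    proof -
      have "1 - \<theta> * ((1 - \<sigma>) / \<sigma>) \<le> (1 + (1 - \<sigma>) / \<sigma>) powr (- \<theta>)"
        using s s0 t by (intro powr_neg_ge_tangent) (auto simp: field_simps)
      also have "1 + (1 - \<sigma>) / \<sigma> = 1 / \<sigma>" using s0 by (simp add: field_simps)
      also have "(1 / \<sigma>) powr (- \<theta>) = \<sigma> powr \<theta>" using s0 by (simp add: powr_minus powr_divide)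
      finally show ?thesis by simp
    qed
    also have "\<dots> \<le> \<theta> * ((1 - \<sigma>) * (10/6))"
    proof -
      have "1 / \<sigma> \<le> 10/6" using True by (simp add: field_simps)
      then have "(1 - \<sigma>) * (1 / \<sigma>) \<le> (1 - \<sigma>) * (10/6)" using s by (intro mult_left_mono) auto
      then show ?thesis using t by (intro mult_left_mono) auto
    qed
    finally have "8/10 * (1 - \<sigma> powr \<theta>) \<le> 8/10 * (\<theta> * ((1 - \<sigma>) * (10/6)))" by (intro mult_left_mono) auto
    also have "\<dots> = \<theta> * ((1 - \<sigma>) * (4/3))" by simp
    finally have e: "8/10 * (1 - \<sigma> powr \<theta>) \<le> \<theta> * ((1 - \<sigma>) * (4/3))" .
    \<comment> \<open>Completing the square eliminates \<open>Y\<close>. The remainder - 4.356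
      \<theta>^2 is beaten by the 4.36 \<theta>^2 contained in 2 \<theta> \<open>Y0\<close>.\<close>
    have "4/10 * Y\<^sup>2 - 264/100 * (\<theta> * Y) + 4356/1000 * \<theta>\<^sup>2 = 4/10 * (Y - 33/10 * \<theta>)\<^sup>2"
      by (simp add: power2_eq_square algebra_simps)
    then have q: "4/10 * Y\<^sup>2 - 264/100 * (\<theta> * Y) \<ge> - (4356/1000 * \<theta>\<^sup>2)"
      using zero_le_power2[of "Y - 33/10 * \<theta>"] by linarith
    have "Y0 = (1 - k) + k * (1 - \<sigma>)" by (simp add: Y0_def algebra_simps)
    moreover have "k * (1 - \<sigma>) \<ge> 7/10 * (1 - \<sigma>)" using k s by (intro mult_right_mono) auto
    ultimately have "2 * Y0 \<ge> 436/100 * \<theta> + 14/10 * (1 - \<sigma>)" using k by linarith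
    then have "\<theta> * (2 * Y0) \<ge> \<theta> * (436/100 * \<theta> + 14/10 * (1 - \<sigma>))" using t by (intro mult_left_mono) auto
    moreover have "\<theta> * (14/10 * (1 - \<sigma>)) \<ge> \<theta> * ((1 - \<sigma>) * (4/3))" using t s by (intro mult_left_mono) auto
    moreover have "\<theta> * (436/100 * \<theta>) > 4356/1000 * \<theta>\<^sup>2" using t by (simp add: power2_eq_square)
    ultimately have "4/10 * Y\<^sup>2 - 264/100 * (\<theta> * Y) - 8/10 * (1 - \<sigma> powr \<theta>) + \<theta> * (2 * Y0) > 0"
      using e q by (simp only: ring_distribs)
    then show ?thesis by (simp add: Y0_def k_def algebra_simps)
  next
    case False
    then have s6: "\<sigma> < 6/10" by simp
    \<comment> \<open>For smaller \<sigma> the loss is bounded with denominator sqrt \<sigma>, so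
      everything is expressed in this root.\<close>
    define q where "q = sqrt \<sigma>"
    have q0: "0 < q" "\<sigma> = q\<^sup>2" using s0 by (auto simp: q_def)
    have q8: "q \<le> 775/1000"
    proof (rule ccontr)
      assume "\<not> q \<le> 775/1000"
      then have "(775/1000)\<^sup>2 \<le> q\<^sup>2" by (intro power_mono) auto
      then show False using s6 q0 by (simp add: power2_eq_square)
    qed
    define Z where "Z = 1 - q\<^sup>2"
    have Z: "4/10 < Z" "Z < 1" using s6 q0 by (auto simp: Z_def)
    have "k * \<sigma> \<le> (1 - 218/100 * \<theta>) * \<sigma>" using k s0 by (intro mult_right_mono) auto
    then have Y0Z: "Y0 \<ge> Z + 218/100 * \<theta> * q\<^sup>2" by (simp add: Y0_def Z_def q0 algebra_simps)
    have tq: "\<theta> \<le> 46/100 * q\<^sup>2"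
    proof -
      have "218/100 * \<theta> \<le> k * \<sigma>" using sk k by linarith
      also have "\<dots> \<le> 1 * \<sigma>" using k s0 by (intro mult_right_mono) auto
      finally have "218/100 * \<theta> \<le> q\<^sup>2" using q0 by simp
      then show ?thesis using zero_le_power2[of q] by linarith
    qed
    have e: "1 - \<sigma> powr \<theta> \<le> \<theta> * (Z / q)"
    proof -
      have "1 - \<sigma> powr \<theta> \<le> \<theta> * ((1 - \<sigma>) / sqrt \<sigma>)" using s0 s t by (intro one_minus_powr_le) auto
      moreover have "1 - \<sigma> = Z" by (simp only: Z_def q0(2))
      moreover have "sqrt \<sigma> = q" by (simp only: q_def)
      ultimately show ?thesis by (simp only:)
    qed
    have main: "1/2 * Z - 8/10 * \<theta> - \<theta> / q + 1635/1000 * (\<theta> * q\<^sup>2) > 2/100"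
    proof (cases "q \<ge> 1/2")
      case True
      have "(q - 1/2) * (775/1000 - q) \<ge> 0" using True q8 by simp
      moreover have "(q - 1/2) * (775/1000 - q) = 1275/1000 * q - 3875/10000 - q\<^sup>2"
        by (simp add: field_simps power2_eq_square)
      ultimately have q2: "q\<^sup>2 \<le> 1275/1000 * q - 3875/10000" by linarith
      have q1: "1 / q \<le> 330/100 - 258/100 * q"
      proof -
        have "1 \<le> (330/100 - 258/100 * q) * q"
        proof -
          have "(330/100 - 258/100 * q) * q = 330/100 * q - 258/100 * q\<^sup>2"
            by (simp add: algebra_simps power2_eq_square)
          then show ?thesis using q2 True q8 by linarith
        qed
        then show ?thesis using q0 by (simp add: pos_divide_le_eq)
      qed
      have "1 \<le> 1 / q" using q8 q0 by simp
      then have "0 \<le> 8/10 + 1 / q - 1635/1000 * q\<^sup>2" using q2 q8 by linarith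
      then have "\<theta> * (8/10 + 1 / q - 1635/1000 * q\<^sup>2) \<le> 1/8 * (8/10 + 1 / q - 1635/1000 * q\<^sup>2)"
        using t by (intro mult_right_mono) auto
      then have "8/10 * \<theta> + \<theta> / q - 1635/1000 * (\<theta> * q\<^sup>2) \<le> 1/8 * (8/10 + 1 / q - 1635/1000 * q\<^sup>2)"
        by (simp add: algebra_simps)
      moreover have "\<And>A B C E :: real. 8/10 * \<theta> + A - 1635/1000 * B \<le> 1/8 * (8/10 + C - 1635/1000 * E)
          \<Longrightarrow> C \<le> 330/100 - 258/100 * q \<Longrightarrow> E \<le> 1275/1000 * q - 3875/10000
          \<Longrightarrow> 1/2 * (1 - E) - 8/10 * \<theta> - A + 1635/1000 * B > 2/100"
        using q8 by (simp add: field_simps)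
      ultimately show ?thesis unfolding Z_def using q1 q2 by blast
    next
      case False
      have "q\<^sup>2 \<le> (1/2) * q" using False q0 by (simp add: power2_eq_square)
      moreover have "\<theta> / q \<le> 46/100 * q" using tq q0 by (simp add: pos_divide_le_eq power2_eq_square)
      moreover have "0 \<le> \<theta> * q\<^sup>2" using t by simp
      moreover have "\<And>A B E :: real. E \<le> 1/2 * q \<Longrightarrow> A \<le> 46/100 * q \<Longrightarrow> 0 \<le> B \<Longrightarrow> \<theta> \<le> 46/100 * E
          \<Longrightarrow> 1/2 * (1 - E) - 8/10 * \<theta> - A + 1635/1000 * B > 2/100"
        using False by (simp add: field_simps)
      ultimately show ?thesis unfolding Z_def using tq by blast
    qed
    \<comment> \<open>The quadratic increases beyond 33/10 \<theta>, so \<open>Y\<close> may be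
      replaced by its lower bound \<open>Y0\<close>. All constants are those of the claim divided by
      8/10.\<close>
    have inc: "1/2 * Y\<^sup>2 - 33/10 * (\<theta> * Y) \<ge> 1/2 * Y0\<^sup>2 - 33/10 * (\<theta> * Y0)"
    proof -
      have "(1 - 218/100 * \<theta>) * q\<^sup>2 \<le> (1 - 218/100 * \<theta>) * (6/10)"
        using s6 q0 t by (intro mult_left_mono) auto
      then have "Y0 \<ge> 33/10 * \<theta>" using Y0Z t by (simp add: Z_def algebra_simps)
      then have "(Y - Y0) * (1/2 * (Y + Y0) - 33/10 * \<theta>) \<ge> 0"
        using Y0 by (intro mult_nonneg_nonneg) auto
      then show ?thesis by (simp add: field_simps power2_eq_square)
    qed
    define \<delta> where "\<delta> = 218/100 * \<theta> * q\<^sup>2"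
    have d: "0 \<le> \<delta>" using t by (simp add: \<delta>_def)
    have Y0pos: "Y0 \<ge> Z" using Y0Z d by (simp add: \<delta>_def)
    have "1/2 * Y0\<^sup>2 - 8/10 * (\<theta> * Y0) \<ge> 1/2 * (Z + \<delta>)\<^sup>2 - 8/10 * (\<theta> * (Z + \<delta>))"
    proof -
      have "(Y0 - (Z + \<delta>)) * (1/2 * (Y0 + (Z + \<delta>)) - 8/10 * \<theta>) \<ge> 0"
      proof (rule mult_nonneg_nonneg)
        show "0 \<le> Y0 - (Z + \<delta>)" using Y0Z by (simp add: \<delta>_def)
        show "0 \<le> 1/2 * (Y0 + (Z + \<delta>)) - 8/10 * \<theta>" using Y0pos Z t d by argo
      qed
      then show ?thesis by (simp add: field_simps power2_eq_square)
    qed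
    moreover have "1/2 * (Z + \<delta>)\<^sup>2 - 8/10 * (\<theta> * (Z + \<delta>)) - \<theta> * (Z / q) > 0"
    proof -
      have "Z * (1/2 * Z - 8/10 * \<theta> - \<theta> / q + 3/4 * \<delta>) > 0"
        using main Z by (intro mult_pos_pos) (auto simp: \<delta>_def)
      moreover have "8/10 * \<theta> * \<delta> \<le> 1/4 * Z * \<delta>" using t Z d by (intro mult_right_mono) auto
      moreover have "0 \<le> \<delta>\<^sup>2" by simp
      moreover have "1/2 * (Z + \<delta>)\<^sup>2 - 8/10 * (\<theta> * (Z + \<delta>)) - \<theta> * (Z / q)
          = Z * (1/2 * Z - 8/10 * \<theta> - \<theta> / q + 3/4 * \<delta>) + 1/4 * Z * \<delta> - 8/10 * \<theta> * \<delta> + 1/2 * \<delta>\<^sup>2"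
        by (simp add: field_simps power2_eq_square)
      ultimately show ?thesis by linarith
    qed
    ultimately have "1/2 * Y0\<^sup>2 - 8/10 * (\<theta> * Y0) - (1 - \<sigma> powr \<theta>) > 0" using e by simp
    then have "4/10 * Y\<^sup>2 - 264/100 * (\<theta> * Y) - 8/10 * (1 - \<sigma> powr \<theta>) + 2 * (\<theta> * Y0) > 0"
      using inc by argo
    then show ?thesis by (simp add: Y0_def k_def algebra_simps)
  qed
qed

section \<open>Numerical inequalities for the displacement bound\<close>

text \<open>The left side increases with \<open>k\<close> and the right side decreases, so
  \<open>kappa\<close> may be replaced by an upper bound.\<close>

lemma path_numeric_mono:
  fixes k K b B :: real
  assumes k: "0 < k" "k \<le> K" "K < 1" and b: "0 \<le> b"
    and le: "B + b * K / sqrt (2 * (1 - K)) \<le> 1 / K\<^sup>2"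
  shows "B + b * k / sqrt (2 * (1 - k)) \<le> 1 / k\<^sup>2"
proof -
  have "b * k / sqrt (2 * (1 - k)) \<le> b * K / sqrt (2 * (1 - K))"
    using k b by (intro frac_le mult_left_mono real_sqrt_le_mono) auto
  moreover have "1 / K\<^sup>2 \<le> 1 / k\<^sup>2" using k by (intro divide_left_mono power_mono) auto
  ultimately show ?thesis using le by linarith
qed

lemma power_le_fifth:
  fixes u :: real
  assumes "0 \<le> u" "u \<le> 1 / 5"
  shows "u\<^sup>2 \<le> u / 5" "u ^ 3 \<le> u / 25" "u ^ 4 \<le> u / 125"
proof -
  have *: "u ^ Suc n \<le> u * (1 / 5) ^ n" for n
    using assms by (simp add: mult_left_mono power_mono)
  show "u\<^sup>2 \<le> u / 5" "u ^ 3 \<le> u / 25" "u ^ 4 \<le> u / 125"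
    using *[of 1] *[of 2] *[of 3] by (simp_all add: numeral_eq_Suc)
qed

text \<open>With (1 + \<tau>) / 2 in place of \<open>kappa\<close>, the root term is at most 41/100
  (\<open>sq\<close>), and what remains is the inequality \<open>key\<close> between t and
  \<tau>.\<close>

lemma path_numeric_large:
  fixes \<nu> :: real
  assumes nu: "1 / 7 \<le> \<nu>" "\<nu> \<le> 13 / 27"
  shows "(1 + \<nu>) / (1 - \<nu>) + 2 * \<nu> / (1 + \<nu>) * kappa \<nu> / sqrt (2 * (1 - kappa \<nu>)) \<le> 1 / (kappa \<nu>)\<^sup>2"
proof -
  define t where "t = (1 - \<nu>) / (1 + \<nu>)"
  have t: "35/100 \<le> t" "t \<le> 75/100" using nu by (auto simp: t_def field_simps)
  have nut: "(1 + \<nu>) / (1 - \<nu>) = 1 / t" "2 * \<nu> / (1 + \<nu>) = 1 - t" using nu by (auto simp: t_def field_simps)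
  define \<tau> where "\<tau> = t\<^sup>2 * (1 + t\<^sup>2) / (1 + t)"
  have tau0: "0 \<le> \<tau>" using t by (simp add: \<tau>_def)
  have mono: "\<tau> \<le> u\<^sup>2 * (1 + u\<^sup>2) / (1 + u)" if "t \<le> u" for u
    unfolding \<tau>_def using tau_mono[of t u] t that by simp
  have tau: "\<tau> < 51/100" using mono[of "75/100"] t by (simp add: power2_eq_square)
  have k: "2 * kappa \<nu> \<le> 1 + \<tau>" using kappa_t[of \<nu>] nu by (simp add: \<tau>_def t_def)
  have sq: "(1 - t) * (1 + \<tau>) \<le> 82/100 * sqrt (1 - \<tau>)"
  proof -
    have bd: "(1 - t) * (1 + \<tau>) \<le> (1 - 3/4 * u ^ 3) / (1 + u)" if u: "0 \<le> u" "u \<le> t" for u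
    proof -
      have "(1 - t) * (1 + \<tau>) = (1 - t ^ 3 * (1 - t + t\<^sup>2)) / (1 + t)"
        using t by (simp add: \<tau>_def divide_simps) (simp add: algebra_simps power2_eq_square power3_eq_cube)
      also have "\<dots> \<le> (1 - 3/4 * u ^ 3) / (1 + u)"
      proof (rule frac_le)
        have "0 \<le> (t - 1/2)\<^sup>2" by simp
        then have "3 / 4 \<le> 1 - t + t\<^sup>2" by (simp add: power2_eq_square algebra_simps)
        then have "u ^ 3 * (3 / 4) \<le> t ^ 3 * (1 - t + t\<^sup>2)" using t u by (intro mult_mono power_mono) auto
        then show "1 - t ^ 3 * (1 - t + t\<^sup>2) \<le> 1 - 3 / 4 * u ^ 3" by simp
        have "u ^ 3 \<le> 1 ^ 3" using t u by (intro power_mono) auto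
        then show "0 \<le> 1 - 3 / 4 * u ^ 3" by simp
      qed (use t u in auto)
      finally show ?thesis .
    qed
    have "\<exists>c d. (1 - t) * (1 + \<tau>) \<le> c \<and> \<tau> \<le> d \<and> 0 \<le> c \<and> c\<^sup>2 \<le> (82/100)\<^sup>2 * (1 - d)"
    proof -
      consider "t \<le> 45/100" | "45/100 \<le> t" "t \<le> 6/10" | "6/10 \<le> t" by linarith
      then show ?thesis
      proof cases
        case 1
        show ?thesis
          by (rule exI[of _ "717/1000"], rule exI[of _ "169/1000"])
             (use bd[of "35/100"] mono[of "45/100"] t 1 in \<open>simp add: power2_eq_square power3_eq_cube\<close>)
      next
        case 2
        show ?thesis
          by (rule exI[of _ "643/1000"], rule exI[of _ "307/1000"])
             (use bd[of "45/100"] mono[of "6/10"] t 2 in \<open>simp add: power2_eq_square power3_eq_cube\<close>)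
      next
        case 3
        show ?thesis
          by (rule exI[of _ "524/1000"], rule exI[of _ "503/1000"])
             (use bd[of "6/10"] mono[of "75/100"] t 3 in \<open>simp add: power2_eq_square power3_eq_cube\<close>)
      qed
    qed
    then obtain c d where c: "(1 - t) * (1 + \<tau>) \<le> c" "\<tau> \<le> d" "0 \<le> c" "c\<^sup>2 \<le> (82/100)\<^sup>2 * (1 - d)" by blast
    have "(82/100)\<^sup>2 * (1 - d) \<le> (82/100)\<^sup>2 * (1 - \<tau>)" using c by (intro mult_left_mono) auto
    then have "c\<^sup>2 \<le> (82/100)\<^sup>2 * (1 - \<tau>)" using c by linarith
    then have "c \<le> sqrt ((82/100)\<^sup>2 * (1 - \<tau>))" using c by (intro real_le_rsqrt)
    then show ?thesis using c by (simp add: real_sqrt_mult)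
  qed
  have key: "(1 + 41/100 * t) * (1 + \<tau>)\<^sup>2 \<le> 4 * t"
  proof (cases "t \<le> 55/100")
    case True
    define u where "u = t - 35/100"
    have u: "0 \<le> u" "u \<le> 2/10" "t = u + 35/100" using t True by (auto simp: u_def)
    \<comment> \<open>The chord of \<tau> between t = 35/100 and t = 55/100, rounded up; the other
      case uses the chord up to 75/100.\<close>
    have "\<tau> \<le> 1019/10000 + 762/1000 * u"
    proof -
      have "t\<^sup>2 * (1 + t\<^sup>2) \<le> (1019/10000 + 762/1000 * u) * (1 + t)"
      proof -
        have "(1019/10000 + 762/1000 * u) * (1 + t) - t\<^sup>2 * (1 + t\<^sup>2)
            = 5875/100000000 + 2591/10000 * u - 973/1000 * u\<^sup>2 - 14/10 * u ^ 3 - u ^ 4"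
          unfolding u(3) by (simp add: field_simps power2_eq_square power3_eq_cube power4_eq_xxxx)
        then show ?thesis using power_le_fifth[of u] u by simp
      qed
      then show ?thesis using t by (simp add: \<tau>_def pos_divide_le_eq)
    qed
    then have "(1 + \<tau>)\<^sup>2 \<le> (1 + (1019/10000 + 762/1000 * u))\<^sup>2" using tau0 by (intro power_mono) auto
    then have "(1 + 41/100 * t) * (1 + \<tau>)\<^sup>2 \<le> (1 + 41/100 * t) * (1 + (1019/10000 + 762/1000 * u))\<^sup>2"
      using t by (intro mult_left_mono) auto
    also have "\<dots> \<le> 4 * t"
    proof -
      have "4 * t - (1 + 41/100 * t) * (1 + (1019/10000 + 762/1000 * u))\<^sup>2
          = (14/10 - (1 + 41/100 * (35/100)) * (11019/10000)\<^sup>2)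
            + (4 - 41/100 * (11019/10000)\<^sup>2 - (1 + 41/100 * (35/100)) * (2 * (11019/10000) * (762/1000))) * u
            - (41/100 * (2 * (11019/10000) * (762/1000)) + (1 + 41/100 * (35/100)) * (762/1000)\<^sup>2) * u\<^sup>2
            - 41/100 * (762/1000)\<^sup>2 * u ^ 3"
        unfolding u(3) by (simp add: field_simps power2_eq_square power3_eq_cube)
      then show ?thesis using power_le_fifth[of u] u by (simp add: power2_eq_square[of "_ / _"])
    qed
    finally show ?thesis .
  next
    case False
    define u where "u = t - 55/100"
    have u: "0 \<le> u" "u \<le> 2/10" "t = u + 55/100" using t False by (auto simp: u_def)
    have "\<tau> \<le> 2542/10000 + 12403/10000 * u"
    proof -
      have "(2542/10000 + 12403/10000 * u) * (1 + t) - t\<^sup>2 * (1 + t\<^sup>2)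
          = 375/100000000 + 411165/1000000 * u - 15747/10000 * u\<^sup>2 - 22/10 * u ^ 3 - u ^ 4"
        unfolding u(3) by (simp add: field_simps power2_eq_square power3_eq_cube power4_eq_xxxx)
      then have "t\<^sup>2 * (1 + t\<^sup>2) \<le> (2542/10000 + 12403/10000 * u) * (1 + t)"
        using power_le_fifth[of u] u by simp
      then show ?thesis using t by (simp add: \<tau>_def pos_divide_le_eq)
    qed
    then have "(1 + \<tau>)\<^sup>2 \<le> (1 + (2542/10000 + 12403/10000 * u))\<^sup>2" using tau0 by (intro power_mono) auto
    then have "(1 + 41/100 * t) * (1 + \<tau>)\<^sup>2 \<le> (1 + 41/100 * t) * (1 + (2542/10000 + 12403/10000 * u))\<^sup>2"
      using t by (intro mult_left_mono) auto
    also have "\<dots> \<le> 4 * t"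
    proof -
      have "4 * t - (1 + 41/100 * t) * (1 + (2542/10000 + 12403/10000 * u))\<^sup>2
          = (22/10 - (1 + 41/100 * (55/100)) * (12542/10000)\<^sup>2)
            + (4 - 41/100 * (12542/10000)\<^sup>2 - (1 + 41/100 * (55/100)) * (2 * (12542/10000) * (12403/10000))) * u
            - (41/100 * (2 * (12542/10000) * (12403/10000)) + (1 + 41/100 * (55/100)) * (12403/10000)\<^sup>2) * u\<^sup>2
            - 41/100 * (12403/10000)\<^sup>2 * u ^ 3"
        unfolding u(3) by (simp add: field_simps power2_eq_square power3_eq_cube)
      then show ?thesis using power_le_fifth[of u] u by (simp add: power2_eq_square[of "_ / _"])
    qed
    finally show ?thesis .
  qed
  show ?thesis unfolding nut
  proof (rule path_numeric_mono[of _ "(1 + \<tau>) / 2"])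
    have "(1 - t) * ((1 + \<tau>) / 2) / sqrt (2 * (1 - (1 + \<tau>) / 2)) = (1 - t) * (1 + \<tau>) / (2 * sqrt (1 - \<tau>))"
      by (simp add: algebra_simps)
    also have "\<dots> \<le> 41/100" using sq tau by (simp add: pos_divide_le_eq)
    finally have "1 / t + (1 - t) * ((1 + \<tau>) / 2) / sqrt (2 * (1 - (1 + \<tau>) / 2)) \<le> 1 / t + 41/100" by simp
    also have "1 / t + 41/100 = (1 + 41/100 * t) / t" using t by (simp add: add_divide_distrib)
    finally have "1 / t + (1 - t) * ((1 + \<tau>) / 2) / sqrt (2 * (1 - (1 + \<tau>) / 2)) \<le> (1 + 41/100 * t) / t" .
    also have "\<dots> \<le> 4 / (1 + \<tau>)\<^sup>2" using key t tau0 by (simp add: divide_simps mult_ac)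
    finally show "1 / t + (1 - t) * ((1 + \<tau>) / 2) / sqrt (2 * (1 - (1 + \<tau>) / 2)) \<le> 1 / ((1 + \<tau>) / 2)\<^sup>2"
      by (simp add: power_divide)
  qed (use k tau t nu in \<open>auto simp: kappa_pos\<close>)
qed

lemma le_ln_of_power:
  fixes z L :: real
  assumes "0 < n" "0 < z" "real n * L = real m" "(272 / 100) ^ m \<le> z ^ n" "0 \<le> L"
  shows "L \<le> ln z"
proof -
  have "exp L = exp 1 powr L" by (simp add: powr_def)
  also have "\<dots> \<le> (272 / 100) powr L" using e_less_272 assms by (intro powr_mono2) auto
  also have "\<dots> \<le> z" using assms by (intro powr_le_of_power[of n _ _ _ m]) auto
  finally show ?thesis using assms by (simp add: ln_ge_iff)
qed

text \<open>Uses exp (- y) \<le> 1 / (1 + y) and keeps a logarithmic factor \<open>L\<close>, since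
  1 - \<open>kappa \<nu>\<close> is of order \<nu> ln (1 / \<nu>) for small \<nu>.\<close>

lemma kappa_le_of_log:
  assumes nu: "0 < \<nu>" and L: "0 \<le> L" "L \<le> ln ((1 + \<nu>) / (2 * \<nu>))"
  shows "kappa \<nu> \<le> 1 / ((1 + \<nu>) * (1 + \<nu> * L))"
proof -
  have "(2 * \<nu> / (1 + \<nu>)) powr \<nu> = exp (- (\<nu> * ln ((1 + \<nu>) / (2 * \<nu>))))"
    using nu by (simp add: powr_def ln_div algebra_simps)
  also have "\<dots> \<le> exp (- (\<nu> * L))" using L nu by simp
  also have "\<dots> \<le> inverse (1 + \<nu> * L)"
    unfolding exp_minus using nu L by (intro le_imp_inverse_le exp_ge_add_one_self) (simp add: add_pos_nonneg)
  finally have "kappa \<nu> \<le> inverse (1 + \<nu> * L) / (1 + \<nu>)"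
    unfolding kappa_def using nu by (intro divide_right_mono) auto
  then show ?thesis by (simp add: field_simps)
qed

text \<open>With 1 / Q for \<open>kappa\<close>, the condition \<open>aL\<close> makes the root at
  least 1 / (Q L), so the error term is at most 2 \<nu> L. This is exactly what the factor 1 + \<nu>
  L contributes to Q^2 in first order.\<close>

lemma path_numeric_interval:
  assumes nu: "0 < a" "a \<le> \<nu>" "\<nu> \<le> b" "b \<le> 1 / 7" and L: "1 \<le> L" "L \<le> ln ((1 + b) / (2 * b))"
    and aL: "1 \<le> 2 * a * (1 + L) * L\<^sup>2"
  shows "(1 + \<nu>) / (1 - \<nu>) + 2 * \<nu> / (1 + \<nu>) * kappa \<nu> / sqrt (2 * (1 - kappa \<nu>)) \<le> 1 / (kappa \<nu>)\<^sup>2"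
proof -
  define Q where "Q = (1 + \<nu>) * (1 + \<nu> * L)"
  have n0: "0 < \<nu>" "\<nu> \<le> 1/7" using nu by auto
  have "(1 + b) / (2 * b) \<le> (1 + \<nu>) / (2 * \<nu>)" using nu by (simp add: field_simps)
  then have "ln ((1 + b) / (2 * b)) \<le> ln ((1 + \<nu>) / (2 * \<nu>))" using nu by (subst ln_le_cancel_iff) auto
  then have kQ: "kappa \<nu> \<le> 1 / Q" unfolding Q_def using L n0 by (intro kappa_le_of_log) auto
  have Q1: "Q \<ge> 1 + \<nu> * (1 + L)" using n0 L by (simp add: Q_def algebra_simps)
  have Qpos: "Q > 1" using Q1 n0 L mult_pos_pos[of \<nu> "1 + L"] by linarith
  show ?thesis
  proof (rule path_numeric_mono[OF _ kQ])
    have "1 \<le> 2 * (Q - 1) * L\<^sup>2"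
    proof -
      have "a * ((1 + L) * L\<^sup>2) \<le> \<nu> * ((1 + L) * L\<^sup>2)" using nu L by (intro mult_right_mono) auto
      also have "\<dots> \<le> (Q - 1) * L\<^sup>2" using Q1 mult_right_mono[of "\<nu> * (1 + L)" "Q - 1" "L\<^sup>2"] by (simp add: mult_ac)
      finally show ?thesis using aL by (simp add: algebra_simps)
    qed
    also have "\<dots> \<le> Q * (2 * (Q - 1) * L\<^sup>2)" using Qpos mult_right_mono[of 1 Q "2 * (Q - 1) * L\<^sup>2"] by simp
    finally have "1 / (Q\<^sup>2 * L\<^sup>2) \<le> Q * (2 * (Q - 1) * L\<^sup>2) / (Q\<^sup>2 * L\<^sup>2)"
      by (intro divide_right_mono) auto
    also have "\<dots> = 2 * (1 - 1 / Q)" using Qpos L by (simp add: field_simps power2_eq_square)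
    finally have "(1 / (Q * L))\<^sup>2 \<le> 2 * (1 - 1 / Q)" by (simp add: power_divide power_mult_distrib)
    then have sq: "1 / (Q * L) \<le> sqrt (2 * (1 - 1 / Q))" by (rule real_le_rsqrt)
    have QL: "0 < 1 / (Q * L)" using Qpos L by simp
    have "2 * \<nu> / (1 + \<nu>) * (1 / Q) / sqrt (2 * (1 - 1 / Q)) \<le> 2 * \<nu> / (1 + \<nu>) * (1 / Q) / (1 / (Q * L))"
      using Qpos n0 by (intro divide_left_mono[OF sq _ mult_pos_pos[OF less_le_trans[OF QL sq] QL]]) simp
    also have "\<dots> = 2 * \<nu> / (1 + \<nu>) * L" using Qpos L by simp
    also have "\<dots> \<le> 2 * \<nu> * L" using n0 L by (simp add: field_simps)
    finally have e: "2 * \<nu> / (1 + \<nu>) * (1 / Q) / sqrt (2 * (1 - 1 / Q)) \<le> 2 * \<nu> * L" .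
    have b: "(1 + \<nu>) / (1 - \<nu>) \<le> 1 + 2 * \<nu> + 5 * \<nu>\<^sup>2"
    proof -
      have "(1 + 2 * \<nu> + 5 * \<nu>\<^sup>2) * (1 - \<nu>) - (1 + \<nu>) = \<nu>\<^sup>2 * (3 - 5 * \<nu>)"
        by (simp add: algebra_simps power2_eq_square)
      moreover have "\<dots> \<ge> 0" using n0 by (intro mult_nonneg_nonneg) auto
      ultimately have "1 + \<nu> \<le> (1 + 2 * \<nu> + 5 * \<nu>\<^sup>2) * (1 - \<nu>)" by linarith
      then show ?thesis using n0 by (simp add: pos_divide_le_eq)
    qed
    have "1 + 2 * \<nu> + 5 * \<nu>\<^sup>2 + 2 * \<nu> * L \<le> Q\<^sup>2"
    proof -
      have "(1 + \<nu>)\<^sup>2 = 1 + 2 * \<nu> + \<nu>\<^sup>2" "(1 + \<nu> * L)\<^sup>2 = 1 + 2 * (\<nu> * L) + (\<nu> * L)\<^sup>2"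
        by (simp_all add: power2_sum)
      then have "(1 + 2 * \<nu> + \<nu>\<^sup>2) * (1 + 2 * (\<nu> * L)) \<le> Q\<^sup>2"
        unfolding Q_def power_mult_distrib using n0 L by (intro mult_mono) auto
      moreover have "(1 + 2 * \<nu> + \<nu>\<^sup>2) * (1 + 2 * (\<nu> * L)) \<ge> 1 + 2 * \<nu> + \<nu>\<^sup>2 + 2 * \<nu> * L + 4 * \<nu>\<^sup>2 * L"
        using n0 L by (simp add: algebra_simps power2_eq_square)
      moreover have "4 * \<nu>\<^sup>2 * L \<ge> 4 * \<nu>\<^sup>2 * 1" using L by (intro mult_left_mono) auto
      ultimately show ?thesis by linarith
    qed
    then show "(1 + \<nu>) / (1 - \<nu>) + 2 * \<nu> / (1 + \<nu>) * (1 / Q) / sqrt (2 * (1 - 1 / Q)) \<le> 1 / (1 / Q)\<^sup>2"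
      using e b by (simp add: power_divide)
  qed (use Qpos n0 in \<open>auto simp: kappa_pos\<close>)
qed

lemma path_numeric:
  assumes nu: "1 / 64 \<le> \<nu>" "\<nu> \<le> 13 / 27"
  shows "(1 + \<nu>) / (1 - \<nu>) + 2 * \<nu> / (1 + \<nu>) * kappa \<nu> / sqrt (2 * (1 - kappa \<nu>)) \<le> 1 / (kappa \<nu>)\<^sup>2"
proof -
  consider "\<nu> \<le> 1/36" | "1/36 \<le> \<nu>" "\<nu> \<le> 1/20" | "1/20 \<le> \<nu>" "\<nu> \<le> 1/13" | "1/13 \<le> \<nu>" "\<nu> \<le> 1/9"
    | "1/9 \<le> \<nu>" "\<nu> \<le> 1/7" | "1/7 \<le> \<nu>" by linarith
  then show ?thesis
  proof cases
    case 1
    have L: "29/10 \<le> ln (37/2::real)" by (rule le_ln_of_power[of 10 _ _ 29]) (simp_all add: power_divide)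
    show ?thesis by (rule path_numeric_interval[of "1/64" _ "1/36" "29/10"]) (use nu 1 L in \<open>simp_all add: power2_eq_square\<close>)
  next
    case 2
    have L: "7/3 \<le> ln (21/2::real)" by (rule le_ln_of_power[of 3 _ _ 7]) (simp_all add: power_divide)
    show ?thesis by (rule path_numeric_interval[of "1/36" _ "1/20" "7/3"]) (use nu 2 L in \<open>simp_all add: power2_eq_square\<close>)
  next
    case 3
    have L: "19/10 \<le> ln (7::real)" by (rule le_ln_of_power[of 10 _ _ 19]) (simp_all add: power_divide)
    show ?thesis by (rule path_numeric_interval[of "1/20" _ "1/13" "19/10"]) (use nu 3 L in \<open>simp_all add: power2_eq_square\<close>)
  next
    case 4
    have L: "8/5 \<le> ln (5::real)" by (rule le_ln_of_power[of 5 _ _ 8]) (simp_all add: power_divide)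
    show ?thesis by (rule path_numeric_interval[of "1/13" _ "1/9" "8/5"]) (use nu 4 L in \<open>simp_all add: power2_eq_square\<close>)
  next
    case 5
    have L: "69/50 \<le> ln (4::real)" by (rule le_ln_of_power[of 50 _ _ 69]) (simp_all add: power_divide)
    show ?thesis by (rule path_numeric_interval[of "1/9" _ "1/7" "69/50"]) (use nu 5 L in \<open>simp_all add: power2_eq_square\<close>)
  next
    case 6
    then show ?thesis using nu by (intro path_numeric_large) auto
  qed
qed

section \<open>The normalized problem\<close>

text \<open>The radius 3 r in the Hoelder condition: auxiliary points are at most 2 r away from a
  point of the level set, which itself has norm at most r.\<close>

locale normalized_problem =
  fixes s :: "'a::euclidean_space \<Rightarrow> real" and g :: "'a \<Rightarrow> 'a" and \<nu> \<theta> \<rho> r S :: real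
  assumes conv: "convex_on UNIV s"
    and grad: "\<And>y. (s has_derivative (\<lambda>h. g y \<bullet> h)) (at y)"
    and nonneg: "\<And>y. 0 \<le> s y"
    and attained: "\<exists>y. s y = 0"
    and nu: "0 < \<nu>" "\<nu> \<le> 1"
    and S: "0 \<le> S"
    and level_ball: "\<And>y. s y \<le> S \<Longrightarrow> norm y \<le> r"
    and hoelder: "\<And>y z. norm y \<le> 3 * r \<Longrightarrow> norm z \<le> 3 * r \<Longrightarrow> norm (g y - g z) \<le> norm (y - z) powr \<nu>"
    and theta: "0 < \<theta>" "\<theta> < 1"
    and rho: "0 < \<rho>"
    and KL: "\<And>y. norm y \<le> r \<Longrightarrow> s y powr \<theta> \<le> \<rho> * norm (g y)"
begin

definition X where "X = {y. s y = 0}"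
definition c0 where "c0 = \<nu> / (1 + \<nu>)"
definition p where "p = (1 + \<nu>) / \<nu>"

lemma p_pos: "0 < p"
  using nu by (simp add: p_def)

lemma above_tangent: "s y \<ge> s x + g x \<bullet> (y - x)"
  using conv grad by (rule gradient_convex_ineq)

lemma cont: "continuous_on A s"
  using grad by (intro continuous_at_imp_continuous_on) (blast intro: has_derivative_continuous)

lemma r_nonneg: "0 \<le> r"
  using attained level_ball S norm_ge_zero order_trans by metis

lemma X_level: "y \<in> X \<Longrightarrow> s y \<le> S"
  using S by (simp add: X_def)

lemma g_X: assumes "y \<in> X" shows "g y = 0"
proof (rule ccontr)
  assume "g y \<noteq> 0"
  have hd: "((\<lambda>t. s (y + t *\<^sub>R (- g y))) has_real_derivative (g y \<bullet> (- g y))) (at 0)"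
    using grad by (intro has_real_derivative_along_line) simp
  have "g y \<bullet> (- g y) < 0" using \<open>g y \<noteq> 0\<close> by simp
  from DERIV_neg_dec_right[OF hd this] obtain d where
    "d > 0" "\<forall>h>0. h < d \<longrightarrow> s (y + 0 *\<^sub>R (- g y)) > s (y + (0 + h) *\<^sub>R (- g y))" by blast
  from this(2)[rule_format, of "d/2"] \<open>d > 0\<close> nonneg[of "y + (d/2) *\<^sub>R (- g y)"] assms
  show False by (simp add: X_def)
qed

lemma g_nz: assumes "s y \<noteq> 0" "s y \<le> S" shows "g y \<noteq> 0"
  using KL[OF level_ball[OF assms(2)]] assms(1) nonneg[of y] by auto

lemma closed_X: "closed X"
proof -
  have "X = s -` {0}" by (auto simp: X_def)
  then show ?thesis using continuous_closed_vimage[of "{0}" s] cont[of UNIV]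
    by (auto simp: continuous_on_eq_continuous_at)
qed

lemma X_ne: "X \<noteq> {}" using attained by (auto simp: X_def)

lemma compact_level: "compact {y. s y \<le> S}"
proof -
  have "closed {y. s y \<le> S}" by (intro closed_Collect_le cont continuous_intros)
  moreover have "bounded {y. s y \<le> S}"
    using level_ball by (auto simp: bounded_iff)
  ultimately show ?thesis by (simp add: compact_eq_bounded_closed)
qed

lemma hoelder_level: "s x \<le> S \<Longrightarrow> s y \<le> S \<Longrightarrow> norm (g x - g y) \<le> norm (x - y) powr \<nu>"
  using level_ball[of x] level_ball[of y] r_nonneg by (intro hoelder) auto

lemma descent:
  assumes "norm a \<le> 3 * r" "norm b \<le> 3 * r"
  shows "s b \<le> s a + g a \<bullet> (b - a) + norm (b - a) powr (1 + \<nu>) / (1 + \<nu>)"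
proof (rule hoelder_descent[OF grad])
  fix y assume "y \<in> closed_segment a b"
  moreover have "closed_segment a b \<subseteq> cball 0 (3 * r)"
    using assms by (intro closed_segment_subset) auto
  ultimately show "norm (g y - g a) \<le> norm (y - a) powr \<nu>"
    using assms by (intro hoelder) auto
qed (use nu in auto)

text \<open>The tangent at \<open>y\<close> and the Hoelder upper bound at \<open>x\<close> are
  compared at the point \<open>z\<close> where the upper model of s - g y \<bullet> (.) at
  \<open>x\<close> is minimal. By the Hoelder condition \<open>z\<close> is no farther from
  \<open>x\<close> than \<open>y\<close> is, so it stays within radius 3 r.\<close>

lemma cocoercive:
  assumes "s x \<le> S" "s y \<le> S"
  shows "s x \<ge> s y + g y \<bullet> (x - y) + c0 * norm (g x - g y) powr p"
proof (cases "g x = g y")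
  case True
  then show ?thesis using above_tangent[of y x] by simp
next
  case False
  define w where "w = g x - g y"
  have w: "norm w > 0" using False by (simp add: w_def)
  define z where "z = x - (norm w powr (1 / \<nu> - 1)) *\<^sub>R w"
  have nz: "norm (z - x) = norm w powr (1 / \<nu>)"
    using w by (simp add: z_def powr_diff)
  also have "\<dots> \<le> (norm (x - y) powr \<nu>) powr (1 / \<nu>)"
    using hoelder_level[OF assms] nu by (intro powr_mono2) (auto simp: w_def)
  also have "\<dots> = norm (x - y)" using nu by (simp add: powr_powr)
  also have "\<dots> \<le> 2 * r" using level_ball[OF assms(1)] level_ball[OF assms(2)] norm_triangle_ineq4[of x y] by linarith
  finally have "norm (z - x) \<le> 2 * r" .
  then have z3: "norm z \<le> 3 * r" using level_ball[OF assms(1)] norm_triangle_ineq[of "z - x" x] by simp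
  have x3: "norm x \<le> 3 * r" using level_ball[OF assms(1)] r_nonneg by linarith
  have "s y + g y \<bullet> (z - y) \<le> s z" by (rule above_tangent)
  also have "\<dots> \<le> s x + g x \<bullet> (z - x) + norm (z - x) powr (1 + \<nu>) / (1 + \<nu>)"
    using descent[OF x3 z3] .
  finally have "s y + g y \<bullet> (x - y) \<le> s x + w \<bullet> (z - x) + norm (z - x) powr (1 + \<nu>) / (1 + \<nu>)"
    by (simp add: w_def algebra_simps inner_simps)
  moreover have "w \<bullet> (z - x) = - (norm w powr p)"
    using w nu by (simp add: z_def p_def add_divide_distrib powr_add powr_diff flip: power2_norm_eq_inner)
       (simp add: power2_eq_square)
  moreover have "norm (z - x) powr (1 + \<nu>) = norm w powr p"
    using nu by (simp add: nz powr_powr p_def)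
  moreover have "- A + A / (1 + \<nu>) = - (c0 * A)" for A
    using nu by (simp add: c0_def field_simps)
  ultimately show ?thesis unfolding w_def by (smt (verit))
qed

text \<open>The point \<open>z\<close> minimizes \<open>M (max (s z) \<tau>) powr (1 - \<theta>) + \<parallel>x - z\<parallel>\<close>; above the level \<open>\<tau>\<close> the
  Kurdyka-Lojasiewicz inequality makes the negative gradient a descent direction of this function.\<close>

lemma level_dist:
  assumes x: "s x \<le> S" and t: "0 \<le> \<tau>" "\<tau> \<le> s x" and M: "M > \<rho> / (1 - \<theta>)"
  shows "\<exists>z. s z \<le> \<tau> \<and> norm (x - z) \<le> M * (s x powr (1 - \<theta>) - \<tau> powr (1 - \<theta>))"
proof -
  define \<phi> where "\<phi> y = M * (max (s y) \<tau>) powr (1 - \<theta>) + norm (x - y)" for y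
  have "continuous_on {y. s y \<le> S} (\<lambda>y. (max (s y) \<tau>) powr (1 - \<theta>))"
    using theta t by (intro continuous_on_powr' continuous_intros cont) (auto simp: max_def)
  then have "continuous_on {y. s y \<le> S} \<phi>"
    unfolding \<phi>_def by (intro continuous_on_add continuous_on_mult continuous_on_const continuous_on_norm continuous_on_diff continuous_on_id)
  then obtain z where z: "s z \<le> S" and zmin: "\<And>y. s y \<le> S \<Longrightarrow> \<phi> z \<le> \<phi> y"
    using continuous_attains_inf[OF compact_level] x by blast
  have "s z \<le> \<tau>"
  proof (rule ccontr)
    assume "\<not> s z \<le> \<tau>"
    then have sz: "s z > \<tau>" "s z > 0" using t by auto
    have gz: "g z \<noteq> 0" using g_nz[of z] sz z by auto
    define e where "e = - (1 / norm (g z)) *\<^sub>R g z"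
    have ne: "norm e = 1" "g z \<bullet> e = - norm (g z)"
      using gz by (auto simp: e_def power2_eq_square simp flip: power2_norm_eq_inner)
    define h where "h t = s (z + t *\<^sub>R e)" for t
    have hd: "(h has_real_derivative (- norm (g z))) (at 0)"
      unfolding h_def ne(2)[symmetric] using grad by (intro has_real_derivative_along_line) simp
    have h0: "h 0 = s z" by (simp add: h_def)
    have gpos: "norm (g z) > 0" using gz by simp
    obtain d1 where d1: "d1 > 0" "\<And>u. 0 < u \<Longrightarrow> u < d1 \<Longrightarrow> h u < h 0"
      using DERIV_neg_dec_right[OF hd] gpos by auto
    have hd2: "((\<lambda>t. M * h t powr (1 - \<theta>) + t) has_real_derivative
             (M * ((1 - \<theta>) * s z powr (- \<theta>) * (- norm (g z))) + 1)) (at 0)"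
      using sz h0 hd by (auto intro!: derivative_eq_intros simp: field_simps)
    \<comment> \<open>Per unit of length the first term of \<open>\<phi>\<close> loses more than the
      distance gains: the Kurdyka-Lojasiewicz inequality bounds s powr (- \<theta>) times the
      gradient norm below by 1 / \<rho>, and M (1 - \<theta>) > \<rho>.\<close>
    have neg: "M * ((1 - \<theta>) * s z powr (- \<theta>) * (- norm (g z))) + 1 < 0"
    proof -
      have "1 = s z powr (-\<theta>) * s z powr \<theta>" using sz by (simp flip: powr_add)
      also have "\<dots> \<le> s z powr (-\<theta>) * (\<rho> * norm (g z))"
        using KL[OF level_ball[OF z]] by (intro mult_left_mono) auto
      finally have "1 \<le> \<rho> * (s z powr (-\<theta>) * norm (g z))" by (simp add: mult_ac)
      moreover have "s z powr (-\<theta>) * norm (g z) > 0" using sz gpos by simp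
      moreover have "\<rho> < M * (1 - \<theta>)" using M theta by (simp add: field_simps)
      ultimately have "1 < M * (1 - \<theta>) * (s z powr (-\<theta>) * norm (g z))"
        by (smt (verit) mult_strict_right_mono)
      then show ?thesis by (simp add: mult_ac)
    qed
    obtain d2 where d2: "d2 > 0"
        "\<And>u. 0 < u \<Longrightarrow> u < d2 \<Longrightarrow> M * h u powr (1 - \<theta>) + u < M * h 0 powr (1 - \<theta>)"
      using DERIV_neg_dec_right[OF hd2 neg] by auto
    have "isCont h 0" using hd by (rule DERIV_isCont)
    then have "\<forall>\<^sub>F u in at 0. h u > \<tau>"
      using sz h0 by (auto simp: isCont_def intro: order_tendstoD)
    then obtain d3 where d3: "d3 > 0" "\<And>u. 0 < u \<Longrightarrow> u < d3 \<Longrightarrow> h u > \<tau>"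
      by (auto simp: eventually_at)
    define u where "u = min d1 (min d2 d3) / 2"
    have u: "0 < u" "u < d1" "u < d2" "u < d3" using d1 d2 d3 by (auto simp: u_def)
    have "\<phi> z \<le> \<phi> (z + u *\<^sub>R e)"
      using d1(2)[OF u(1,2)] z by (intro zmin) (auto simp: h_def)
    also have "\<dots> \<le> M * h u powr (1 - \<theta>) + (norm (x - z) + u)"
      using d3(2)[OF u(1) u(4)] norm_triangle_ineq4[of "x - z" "u *\<^sub>R e"] u ne
      by (simp add: \<phi>_def h_def max_def algebra_simps)
    also have "\<dots> < M * s z powr (1 - \<theta>) + norm (x - z)"
      using d2(2)[OF u(1,3)] h0 by simp
    also have "\<dots> = \<phi> z" using sz by (simp add: \<phi>_def)
    finally show False by simp
  qed
  moreover have "\<phi> z \<le> \<phi> x" using zmin x by blast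
  ultimately show ?thesis using t by (intro exI[of _ z]) (auto simp: \<phi>_def max_def algebra_simps)
qed

text \<open>\<open>level_dist\<close> at level 0, letting \<open>M\<close> tend to the value that it
  excludes.\<close>

lemma growth:
  assumes "s x \<le> S"
  shows "infdist x X \<le> \<rho> / (1 - \<theta>) * s x powr (1 - \<theta>)"
proof (rule field_le_epsilon)
  fix e :: real assume e: "e > 0"
  define q where "q = s x powr (1 - \<theta>)"
  define M where "M = \<rho> / (1 - \<theta>) + e / (q + 1)"
  have q: "q \<ge> 0" by (simp add: q_def)
  obtain z where "s z \<le> 0" "norm (x - z) \<le> M * (q - 0 powr (1 - \<theta>))"
    using level_dist[of x 0 M] assms nonneg e q unfolding q_def M_def by force
  then have "z \<in> X" "dist x z \<le> M * q"
    using nonneg[of z] by (auto simp: X_def dist_norm)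
  then have "infdist x X \<le> M * q" using infdist_le2 by blast
  also have "\<dots> = \<rho> / (1 - \<theta>) * q + e * (q / (q + 1))" using q by (simp add: M_def algebra_simps)
  also have "\<dots> \<le> \<rho> / (1 - \<theta>) * q + e * 1" using q e by (intro add_left_mono mult_left_mono) auto
  finally show "infdist x X \<le> \<rho> / (1 - \<theta>) * s x powr (1 - \<theta>) + e" by (simp add: q_def)
qed

lemma grad_le_dist:
  assumes "s x \<le> S"
  shows "norm (g x) powr (1 / \<nu>) \<le> infdist x X"
proof -
  obtain P where P: "P \<in> X" "infdist x X = dist x P"
    using infdist_attains_inf[OF closed_X X_ne] by blast
  have "norm (g x) \<le> norm (x - P) powr \<nu>"
    using hoelder_level[OF assms X_level[OF P(1)]] g_X[OF P(1)] by simp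
  then have "norm (g x) powr (1 / \<nu>) \<le> (norm (x - P) powr \<nu>) powr (1 / \<nu>)"
    using nu by (intro powr_mono2) auto
  then show ?thesis using nu P by (simp add: powr_powr dist_norm)
qed

end

section \<open>One step: decrease, Fejer monotonicity and the next gradient\<close>

context normalized_problem begin

definition be where "be = 2 * c0"
definition kap where "kap = be powr \<nu> / (1 + \<nu>)"
definition cf where "cf b x = b * norm (g x) powr ((1 - \<nu>) / \<nu>)"
definition step where "step b x = x - cf b x *\<^sub>R g x"

lemma be_pos: "0 < be" and be_le: "be \<le> 1"
  using nu by (auto simp: be_def c0_def field_simps)

lemma kap_pos: "0 < kap" using be_pos nu by (simp add: kap_def)

lemma kap_less: "kap < 1"
proof -
  have "be powr \<nu> \<le> 1" using be_pos be_le nu by (simp add: powr_le1)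
  then show ?thesis using nu by (simp add: kap_def field_simps)
qed

lemma cf_nonneg: "0 \<le> b \<Longrightarrow> 0 \<le> cf b x" by (simp add: cf_def)

lemma cf_norm: "cf b x * norm (g x) = b * norm (g x) powr (1 / \<nu>)"
proof (cases "g x = 0")
  case False
  then have "norm (g x) powr ((1 - \<nu>) / \<nu>) * norm (g x) powr 1 = norm (g x) powr (1 / \<nu>)"
    using nu unfolding powr_add[symmetric] by (simp add: field_simps)
  then show ?thesis using False by (simp add: cf_def)
qed (simp add: cf_def)

lemma norm_powr_p: "norm (g x) powr (1 / \<nu>) * norm (g x) = norm (g x) powr p"
proof (cases "g x = 0")
  case False
  then have "norm (g x) powr (1 / \<nu>) * norm (g x) powr 1 = norm (g x) powr p"
    using nu unfolding powr_add[symmetric] by (simp add: p_def field_simps)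
  then show ?thesis using False by simp
qed simp

lemma cf_norm2: "cf b x * (norm (g x))\<^sup>2 = b * norm (g x) powr p"
  using cf_norm[of b x] norm_powr_p[of x] by (metis mult.assoc power2_eq_square)

lemma norm_step: "0 \<le> b \<Longrightarrow> norm (step b x - x) = b * norm (g x) powr (1 / \<nu>)"
  using cf_norm[of b x] cf_nonneg[of b x] by (simp add: step_def)

lemma infdist_le_2r: assumes "s x \<le> S" shows "infdist x X \<le> 2 * r"
proof -
  obtain P where P: "P \<in> X" "infdist x X = dist x P"
    using infdist_attains_inf[OF closed_X X_ne] by blast
  show ?thesis using P level_ball[OF assms] level_ball[OF X_level[OF P(1)]]
      norm_triangle_ineq4[of x P] by (simp add: dist_norm)
qed

lemma step_length_le:
  assumes "s x \<le> S" "0 \<le> b" "b \<le> be"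
  shows "norm (step b x - x) \<le> b * infdist x X" "norm (step b x - x) \<le> infdist x X"
proof -
  show 1: "norm (step b x - x) \<le> b * infdist x X"
    using grad_le_dist[OF assms(1)] assms by (simp add: norm_step mult_left_mono)
  have "b * infdist x X \<le> 1 * infdist x X"
    using assms be_le by (intro mult_right_mono infdist_nonneg) auto
  then show "norm (step b x - x) \<le> infdist x X" using 1 by simp
qed

text \<open>A step is no longer than the distance to the minimizers, hence at most 2 r, and the
  descent lemma applies; for b \<le> \<open>be\<close> its error term takes at most the share
  \<open>kap\<close> of the first-order decrease.\<close>

lemma step_decrease:
  assumes x: "s x \<le> S" and b: "0 \<le> b" "b \<le> be"
  shows "s x - s (step b x) \<ge> (1 - kap) * (b * norm (g x) powr p)"
    and "s x - s (step b x) \<le> b * norm (g x) powr p"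
    and "s (step b x) \<le> s x" and "s (step b x) \<le> S"
proof -
  let ?n = "norm (g x)"
  have "norm (step b x - x) \<le> 2 * r"
    using step_length_le(2)[OF x b] infdist_le_2r[OF x] by simp
  then have "norm (step b x) \<le> 3 * r"
    using level_ball[OF x] norm_triangle_ineq[of "step b x - x" x] by simp
  then have "s (step b x) \<le> s x + g x \<bullet> (step b x - x) + norm (step b x - x) powr (1 + \<nu>) / (1 + \<nu>)"
    using level_ball[OF x] r_nonneg by (intro descent) auto
  moreover have gs: "g x \<bullet> (step b x - x) = - (b * ?n powr p)"
    using cf_norm2[of b x] by (simp add: step_def power2_norm_eq_inner)
  moreover have "norm (step b x - x) powr (1 + \<nu>) = b powr \<nu> * (b * ?n powr p)"
  proof -
    have "norm (step b x - x) powr (1 + \<nu>) = b powr (1 + \<nu>) * ?n powr p"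
      using b nu by (simp add: norm_step powr_mult powr_powr p_def)
    also have "b powr (1 + \<nu>) = b powr \<nu> * b"
      using b by (cases "b = 0") (auto simp: powr_add)
    finally show ?thesis by simp
  qed
  moreover have "b powr \<nu> * (b * ?n powr p) / (1 + \<nu>) \<le> kap * (b * ?n powr p)"
  proof -
    have "b powr \<nu> * (b * ?n powr p) \<le> be powr \<nu> * (b * ?n powr p)"
      using b nu by (intro mult_right_mono powr_mono2) auto
    then show ?thesis using nu by (simp add: kap_def divide_right_mono)
  qed
  ultimately show 1: "s x - s (step b x) \<ge> (1 - kap) * (b * ?n powr p)"
    by (simp add: algebra_simps)
  then show "s (step b x) \<le> s x" using kap_less b
    by (smt (verit) mult_nonneg_nonneg powr_ge_zero)
  then show "s (step b x) \<le> S" using x by simp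
  show "s x - s (step b x) \<le> b * ?n powr p"
    using above_tangent[of x "step b x"] gs by simp
qed

text \<open>Cocoercivity against a minimizer, whose gradient is zero, adds c0 times the p-th power
  of the gradient norm to the inner product. The condition b \<le> \<open>be\<close> = 2
  \<open>c0\<close> is exactly what lets this term absorb the squared step.\<close>

lemma fejer:
  assumes x: "s x \<le> S" and b: "0 \<le> b" "b \<le> be" and z: "z \<in> X"
  shows "(norm (step b x - z))\<^sup>2 \<le> (norm (x - z))\<^sup>2 - 2 * cf b x * s x"
proof -
  let ?c = "cf b x" and ?n = "norm (g x)"
  have "s z \<ge> s x + g x \<bullet> (z - x) + c0 * norm (g z - g x) powr p"
    using x X_level[OF z] by (intro cocoercive)
  then have ip: "g x \<bullet> (x - z) \<ge> s x + c0 * ?n powr p"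
    using z g_X[OF z] by (simp add: X_def inner_diff_right)
  have "?c\<^sup>2 * ?n\<^sup>2 = ?c * (b * ?n powr p)" using cf_norm2[of b x] by (simp add: power2_eq_square mult_ac)
  also have "\<dots> \<le> ?c * (be * ?n powr p)" using b by (intro mult_left_mono mult_right_mono cf_nonneg) auto
  finally have c2: "?c\<^sup>2 * ?n\<^sup>2 \<le> 2 * ?c * (c0 * ?n powr p)" by (simp add: be_def mult_ac)
  have "step b x - z = (x - z) - ?c *\<^sub>R g x" by (simp add: step_def)
  then have "(norm (step b x - z))\<^sup>2 = (norm (x - z))\<^sup>2 - 2 * ?c * (g x \<bullet> (x - z)) + ?c\<^sup>2 * ?n\<^sup>2"
    by (simp only: power2_norm_eq_inner) (simp add: inner_simps inner_commute power2_eq_square algebra_simps)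
  also have "\<dots> \<le> (norm (x - z))\<^sup>2 - 2 * ?c * (s x + c0 * ?n powr p) + 2 * ?c * (c0 * ?n powr p)"
    using ip c2 b by (intro add_mono diff_mono mult_left_mono) (auto intro: cf_nonneg)
  finally show ?thesis by (simp add: algebra_simps)
qed

lemma fejer_infdist:
  assumes x: "s x \<le> S" and b: "0 \<le> b" "b \<le> be"
  shows "(infdist (step b x) X)\<^sup>2 \<le> (infdist x X)\<^sup>2 - 2 * cf b x * s x"
proof -
  obtain P where P: "P \<in> X" "infdist x X = dist x P"
    using infdist_attains_inf[OF closed_X X_ne] by blast
  have "(infdist (step b x) X)\<^sup>2 \<le> (norm (step b x - P))\<^sup>2"
    using infdist_le[OF P(1), of "step b x"] by (intro power_mono infdist_nonneg) (simp add: dist_norm)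
  then show ?thesis using fejer[OF x b P(1)] P(2) by (simp add: dist_norm)
qed

lemma grad_change_le:
  assumes x: "s x \<le> S" and b: "0 \<le> b" "b \<le> be"
  shows "norm (g x - g (step b x)) \<le> norm (g x)"
proof -
  have "norm (g x - g (step b x)) \<le> norm (x - step b x) powr \<nu>"
    using x step_decrease(4)[OF x b] by (rule hoelder_level)
  also have "\<dots> = (b * norm (g x) powr (1 / \<nu>)) powr \<nu>"
    using b by (simp add: norm_minus_commute[of x] norm_step)
  also have "\<dots> \<le> (1 * norm (g x) powr (1 / \<nu>)) powr \<nu>"
    using b be_le nu by (intro powr_mono2 mult_right_mono) auto
  also have "\<dots> = norm (g x)" using nu by (simp add: powr_powr)
  finally show ?thesis .
qed

text \<open>Cocoercivity between consecutive points, with the inner product of the gradients eliminated: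
  it bounds the new gradient in terms of the decrease.\<close>

lemma next_grad_bound:
  assumes x: "s x \<le> S" and b: "0 < b" "b \<le> be" and n: "g x \<noteq> 0"
  defines "n \<equiv> norm (g x)" and "w \<equiv> norm (g x - g (step b x)) / norm (g x)"
  shows "(norm (g (step b x)) / n)\<^sup>2 \<le> 2 * ((s x - s (step b x)) / (b * n powr p)) - 1 + w\<^sup>2 - w powr p"
    and "0 \<le> w" "w \<le> 1"
proof -
  let ?c = "cf b x" and ?v = "g (step b x)" and ?D = "s x - s (step b x)"
  have n0: "n > 0" using n by (simp add: n_def)
  show w: "0 \<le> w" "w \<le> 1"
    using grad_change_le[OF x] b n by (auto simp: w_def field_simps)
  have "s x \<ge> s (step b x) + ?v \<bullet> (x - step b x) + c0 * norm (g x - ?v) powr p"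
    using x step_decrease(4)[OF x] b by (intro cocoercive) auto
  moreover have "?v \<bullet> (x - step b x) = ?c * (?v \<bullet> g x)" by (simp add: step_def)
  moreover have "2 * (?v \<bullet> g x) = (norm ?v)\<^sup>2 + n\<^sup>2 - (norm (g x - ?v))\<^sup>2"
    by (simp add: power2_norm_eq_inner n_def inner_simps inner_commute)
  ultimately have "2 * ?D \<ge> ?c * ((norm ?v)\<^sup>2 + n\<^sup>2 - (norm (g x - ?v))\<^sup>2) + be * norm (g x - ?v) powr p"
    by (simp add: be_def flip: \<open>2 * (?v \<bullet> g x) = _\<close>)
  moreover have "norm (g x - ?v) = w * n" using n by (simp add: w_def n_def)
  moreover have "be * (w * n) powr p \<ge> w powr p * (b * n powr p)"
    using b w n0 by (simp add: powr_mult mult_ac mult_right_mono)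
  ultimately have bound: "2 * ?D \<ge> ?c * ((norm ?v)\<^sup>2 + n\<^sup>2 - (w * n)\<^sup>2) + w powr p * (b * n powr p)" by simp
  have cn: "?c * n\<^sup>2 = b * n powr p" unfolding n_def by (rule cf_norm2)
  have wn: "?c * (w * n)\<^sup>2 = w\<^sup>2 * (b * n powr p)"
    unfolding cn[symmetric] power_mult_distrib by (simp only: mult_ac)
  have vn: "?c * (norm ?v)\<^sup>2 = (norm ?v / n)\<^sup>2 * (b * n powr p)"
    unfolding cn[symmetric] using n0 by (simp add: field_simps)
  have "?c * ((norm ?v)\<^sup>2 + n\<^sup>2 - (w * n)\<^sup>2)
      = (norm ?v / n)\<^sup>2 * (b * n powr p) + b * n powr p - w\<^sup>2 * (b * n powr p)"
    by (simp only: ring_distribs cn wn vn)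
  with bound have "2 * ?D \<ge> ((norm ?v / n)\<^sup>2 + 1 - w\<^sup>2 + w powr p) * (b * n powr p)"
    by (simp add: algebra_simps)
  moreover have "b * n powr p > 0" using b n0 by simp
  ultimately have "(norm ?v / n)\<^sup>2 + 1 - w\<^sup>2 + w powr p \<le> 2 * ?D / (b * n powr p)"
    by (simp add: pos_le_divide_eq)
  then show "(norm (g (step b x)) / n)\<^sup>2 \<le> 2 * ((s x - s (step b x)) / (b * n powr p)) - 1 + w\<^sup>2 - w powr p"
    by simp
qed

end

context normalized_problem begin

text \<open>An affine minorant at a point bounds the distance to lower level sets from below, and the
  Kurdyka-Lojasiewicz inequality bounds it from above.\<close>

lemma minorant_bound:
  assumes x: "s x \<le> S" and t: "0 \<le> \<tau>" "\<tau> \<le> s x"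
    and minor: "\<And>z. s z \<ge> s x + a \<bullet> (z - x) - e"
  shows "s x - \<tau> - e \<le> norm a * (\<rho> / (1 - \<theta>) * (s x powr (1 - \<theta>) - \<tau> powr (1 - \<theta>)))"
proof (rule field_le_epsilon)
  fix d :: real assume d: "0 < d"
  define q where "q = s x powr (1 - \<theta>) - \<tau> powr (1 - \<theta>)"
  have q: "0 \<le> q" using t theta by (simp add: q_def powr_mono2)
  define M where "M = \<rho> / (1 - \<theta>) + d / (norm a * q + 1)"
  have aq: "0 \<le> norm a * q" using q by simp
  have "M > \<rho> / (1 - \<theta>)" using d aq by (simp add: M_def)
  from level_dist[OF x t this] obtain z where z: "s z \<le> \<tau>" "norm (x - z) \<le> M * q"
    unfolding q_def by blast
  have "s x + a \<bullet> (z - x) - e \<le> \<tau>" using minor[of z] z by simp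
  moreover have "- (a \<bullet> (z - x)) \<le> norm a * norm (x - z)"
    using norm_cauchy_schwarz[of a "x - z"] by (simp add: inner_diff_right)
  moreover have "norm a * norm (x - z) \<le> norm a * (M * q)" using z by (intro mult_left_mono) auto
  moreover have "norm a * (M * q) = norm a * (\<rho> / (1 - \<theta>) * q) + d * (norm a * q / (norm a * q + 1))"
    using aq by (simp add: M_def algebra_simps)
  moreover have "d * (norm a * q / (norm a * q + 1)) \<le> d * 1"
    using d aq by (intro mult_left_mono) auto
  ultimately show "s x - \<tau> - e \<le> norm a * (\<rho> / (1 - \<theta>) * (s x powr (1 - \<theta>) - \<tau> powr (1 - \<theta>))) + d"
    unfolding q_def by linarith
qed

lemma kap_kappa: "kap = kappa \<nu>" and be_eq: "be = 2 * \<nu> / (1 + \<nu>)"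
  by (simp_all add: kap_def be_def c0_def kappa_def)

end

section \<open>Decrease of one step at the critical exponent\<close>

locale critical_problem = normalized_problem +
  assumes crit: "\<theta> = \<nu> / (1 + \<nu>)"
begin

definition U where "U x = (1 + \<nu>) * \<rho> * s x powr (1 / (1 + \<nu>))"
definition R where "R = \<rho> powr p"
text \<open>Measures how tight the Kurdyka-Lojasiewicz inequality is at a point that is not a
  minimizer: at most 1, and 1 iff it is an equality.\<close>

definition sig where "sig x = s x / (R * norm (g x) powr p)"

lemma one_minus_theta: "1 - \<theta> = 1 / (1 + \<nu>)" and theta_p: "\<theta> * p = 1" "p * \<theta> = 1" "1 / p = \<theta>"
proof -
  have "\<nu> \<noteq> 0" "1 + \<nu> \<noteq> 0" using nu by auto
  then show "1 - \<theta> = 1 / (1 + \<nu>)" "\<theta> * p = 1" "p * \<theta> = 1" "1 / p = \<theta>"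
    by (simp_all add: crit p_def diff_divide_eq_iff)
qed

lemma R_pos: "0 < R" using rho by (simp add: R_def)

lemma U_nonneg: "0 \<le> U x" using nu rho by (simp add: U_def)

lemma infdist_le_U: "s x \<le> S \<Longrightarrow> infdist x X \<le> U x"
  using growth[of x] by (simp add: one_minus_theta U_def mult_ac)

lemma grad_le_U: "s x \<le> S \<Longrightarrow> norm (g x) powr (1 / \<nu>) \<le> U x"
  using grad_le_dist[of x] infdist_le_U[of x] by linarith

lemma KL_R: assumes "s x \<le> S" shows "s x \<le> R * norm (g x) powr p"
proof -
  have "(s x powr \<theta>) powr p \<le> (\<rho> * norm (g x)) powr p"
    using KL[OF level_ball[OF assms]] p_pos by (intro powr_mono2) auto
  then show ?thesis using nonneg[of x] rho by (simp add: powr_powr theta_p powr_mult R_def)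
qed

context
  fixes x assumes x: "s x \<le> S" and pos: "0 < s x"
begin

lemma grad_pos: "0 < norm (g x)" using g_nz[of x] x pos by simp

lemma sig: "0 < sig x" "sig x \<le> 1" and s_sig: "s x = sig x * (R * norm (g x) powr p)"
  using pos R_pos grad_pos KL_R[OF x] by (auto simp: sig_def)

lemma sig_theta: "sig x powr \<theta> = s x powr \<theta> / (\<rho> * norm (g x))"
  using pos R_pos grad_pos rho by (simp add: sig_def powr_divide powr_mult R_def powr_powr theta_p)

lemma n_over_s: "norm (g x) powr p / s x \<le> (1 + \<nu>) / sig x powr \<theta>"
proof -
  have "norm (g x) powr p = norm (g x) powr (1 / \<nu>) * norm (g x)" by (simp add: norm_powr_p)
  also have "\<dots> \<le> U x * norm (g x)" using grad_le_U[OF x] by (intro mult_right_mono) auto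
  also have "\<dots> = (1 + \<nu>) * (\<rho> * norm (g x)) * s x powr (1 - \<theta>)" by (simp add: U_def one_minus_theta mult_ac)
  also have "s x powr (1 - \<theta>) = s x / s x powr \<theta>" using pos by (simp add: powr_diff)
  finally have "norm (g x) powr p / s x \<le> (1 + \<nu>) * (\<rho> * norm (g x)) * (s x / s x powr \<theta>) / s x"
    using pos by (intro divide_right_mono) auto
  then show ?thesis using pos by (simp add: sig_theta)
qed

text \<open>At a point that is not optimal the gradient is bounded from above by Hoelder continuity
  and from below by the Kurdyka-Lojasiewicz inequality, which ties the two constants
  together.\<close>

lemma inv_R_le: "1 / R \<le> 1 + \<nu>"
proof -
  have "1 / (sig x * R) = norm (g x) powr p / s x" using s_sig grad_pos pos by (subst s_sig) simp
  also have "\<dots> \<le> (1 + \<nu>) / sig x powr \<theta>" by (rule n_over_s)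
  also have "\<dots> \<le> (1 + \<nu>) / sig x"
    using sig theta nu powr_mono'[of \<theta> 1 "sig x"] by (intro divide_left_mono) auto
  finally have "sig x * (1 / (sig x * R)) \<le> sig x * ((1 + \<nu>) / sig x)" using sig by (intro mult_left_mono) auto
  then show ?thesis using sig by simp
qed

context
  fixes b assumes b: "0 < b" "b \<le> be"
begin

text \<open>Actual over first-order decrease; the \<open>x\<close> of the two-point
  estimates.\<close>

definition "drop_ratio = (s x - s (step b x)) / (b * norm (g x) powr p)"

lemma drop_ratio: "1 - kap \<le> drop_ratio" and D_drop_ratio: "s x - s (step b x) = drop_ratio * (b * norm (g x) powr p)"
proof -
  have A: "0 < b * norm (g x) powr p" using b grad_pos by simp
  then have "b * norm (g x) powr p \<noteq> 0" by (rule less_imp_neq[THEN not_sym])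
  then show "s x - s (step b x) = drop_ratio * (b * norm (g x) powr p)"
    using nonzero_eq_divide_eq[THEN iffD1, OF _ drop_ratio_def] by simp
  with step_decrease(1)[OF x, of b] b have "(1 - kap) * (b * norm (g x) powr p) \<le> drop_ratio * (b * norm (g x) powr p)"
    by simp
  then show "1 - kap \<le> drop_ratio" using A by (rule mult_right_le_imp_le)
qed

text \<open>The value at \<open>x\<close> is the decrease plus the new value, and the latter is
  bounded by the Kurdyka-Lojasiewicz inequality at the new point.\<close>

lemma sig_le_next: "sig x \<le> (norm (g (step b x)) / norm (g x)) powr p + (1 + \<nu>) * b * drop_ratio"
proof -
  let ?n = "norm (g x)" let ?v = "norm (g (step b x))"
  have "s x = s (step b x) + drop_ratio * (b * ?n powr p)" using D_drop_ratio by linarith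
  also have "\<dots> \<le> R * ?v powr p + drop_ratio * (b * ?n powr p)"
    using KL_R[OF step_decrease(4)[OF x]] b by simp
  finally have "sig x \<le> (R * ?v powr p + drop_ratio * (b * ?n powr p)) / (R * ?n powr p)"
    unfolding sig_def using R_pos by (intro divide_right_mono) auto
  also have "\<dots> = (?v / ?n) powr p + (1 / R) * (b * drop_ratio)"
    using R_pos grad_pos by (simp add: powr_divide field_simps)
  also have "\<dots> \<le> (?v / ?n) powr p + (1 + \<nu>) * (b * drop_ratio)"
    using inv_R_le b drop_ratio kap_less by (intro add_left_mono mult_right_mono) auto
  finally show ?thesis by (simp add: mult_ac)
qed

text \<open>Otherwise the two-point estimate yields sig \<le> (drop_ratio / kap) powr p, whose
  \<theta>-th power contradicts the assumption since \<theta> p = 1. The exponent \<theta> on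
  \<open>sig\<close> is what later bounds the trajectory length; exponent 1 only gives the
  rate.\<close>

lemma decrease_strong:
  assumes "13 / 27 \<le> \<nu>"
  shows "kap * sig x powr \<theta> \<le> drop_ratio"
proof (rule ccontr)
  assume "\<not> ?thesis"
  then have less: "drop_ratio < kap * sig x powr \<theta>" by simp
  have "sig x powr \<theta> \<le> 1" using sig theta by (simp add: powr_le1)
  then have xk: "drop_ratio \<le> kap" using less kap_pos mult_left_le[of "sig x powr \<theta>" kap] by linarith
  have gx: "g x \<noteq> 0" using grad_pos by simp
  note nb = next_grad_bound[OF x b gx]
  have "(norm (g (step b x)) / norm (g x)) powr p + (1 + \<nu>) * b * drop_ratio \<le> (drop_ratio / kap) powr p"
    unfolding p_def kap_kappa
    by (rule two_point_strong_range[OF assms nu(2) _ _ nb(2,3)])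
       (use drop_ratio xk b nb(1) in \<open>auto simp: kap_kappa be_eq drop_ratio_def p_def\<close>)
  then have "sig x \<le> (drop_ratio / kap) powr p" using sig_le_next by linarith
  then have "sig x powr \<theta> \<le> ((drop_ratio / kap) powr p) powr \<theta>" using sig theta by (intro powr_mono2) auto
  also have "\<dots> = drop_ratio / kap" using drop_ratio kap_less kap_pos by (simp add: powr_powr theta_p)
  finally show False using less kap_pos by (simp add: field_simps)
qed

lemma decrease_weak_large:
  assumes "1 / 7 \<le> \<nu>" "\<nu> \<le> 13 / 27"
  shows "kap * sig x \<le> drop_ratio"
proof (rule ccontr)
  assume "\<not> ?thesis"
  then have less: "drop_ratio < kap * sig x" by simp
  then have xk: "drop_ratio \<le> kap" using sig kap_pos mult_left_le[of "sig x" kap] by linarith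
  have gx: "g x \<noteq> 0" using grad_pos by simp
  note nb = next_grad_bound[OF x b gx]
  have "kap * (norm (g (step b x)) / norm (g x)) powr p \<le> drop_ratio * (1 - (1 + \<nu>) * kap * b)"
    unfolding p_def kap_kappa
    by (rule two_point_weak_range[OF assms _ _ nb(2,3)])
       (use drop_ratio xk b nb(1) kap_less in \<open>auto simp: kap_kappa be_eq drop_ratio_def p_def\<close>)
  moreover have "kap * sig x \<le> kap * ((norm (g (step b x)) / norm (g x)) powr p + (1 + \<nu>) * b * drop_ratio)"
    using sig_le_next kap_pos by (intro mult_left_mono) auto
  ultimately show False using less by (simp add: algebra_simps)
qed

text \<open>For small \<open>\<nu>\<close> the gradients at the two points do not suffice. If the decrease were too small, the
  gradient would have dropped along the step, so a convex combination of the two tangents would be a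
  minorant with a slope smaller than the Kurdyka-Lojasiewicz inequality allows.\<close>

lemma decrease_weak_small:
  assumes small: "\<nu> \<le> 1 / 7"
  shows "kap * sig x \<le> drop_ratio"
proof (rule ccontr)
  assume "\<not> ?thesis"
  then have less: "drop_ratio < kap * sig x" by simp
  let ?n = "norm (g x)" let ?v = "g (step b x)" let ?c = "cf b x"
  define w where "w = g x - ?v"
  define A where "A = b * ?n powr p"
  define D where "D = s x - s (step b x)"
  have A: "0 < A" using b grad_pos by (simp add: A_def)
  have D: "D = drop_ratio * A" using D_drop_ratio by (simp add: D_def A_def)
  have cA: "?c * ?n\<^sup>2 = A" unfolding A_def by (rule cf_norm2)
  have n2: "?n\<^sup>2 > 0" using grad_pos by simp
  define \<omega> where "\<omega> = (w \<bullet> g x) / ?n\<^sup>2"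
  have wg: "w \<bullet> g x = \<omega> * ?n\<^sup>2" using n2 by (simp add: \<omega>_def)
  have wn: "norm w \<le> ?n" using grad_change_le[OF x] b by (simp add: w_def)
  have "w \<bullet> g x \<le> ?n * ?n"
    using norm_cauchy_schwarz[of w "g x"] mult_right_mono[OF wn, of ?n] by simp
  then have om1: "\<omega> \<le> 1" using n2 by (simp add: \<omega>_def power2_eq_square)
  \<comment> \<open>\<delta> A is the gap at \<open>x\<close> between \<open>s\<close> and the
    tangent at the new point, nonnegative by convexity.\<close>
  define \<delta> where "\<delta> = drop_ratio - 1 + \<omega>"
  have cw: "?c * (w \<bullet> g x) = \<omega> * A" unfolding wg by (simp flip: cA)
  have cv: "?v \<bullet> (x - step b x) = A - \<omega> * A"
  proof -
    have "?v \<bullet> (x - step b x) = ?c * (g x \<bullet> g x) - ?c * (w \<bullet> g x)"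
      by (simp add: step_def w_def inner_diff_left algebra_simps)
    then show ?thesis by (simp add: cw cA flip: power2_norm_eq_inner)
  qed
  have gap: "D - ?v \<bullet> (x - step b x) = \<delta> * A"
    unfolding cv D \<delta>_def by (simp add: algebra_simps)
  have "0 \<le> \<delta> * A" using above_tangent[of "step b x" x] unfolding gap[symmetric] D_def by simp
  then have d0: "0 \<le> \<delta>" using A by (simp add: zero_le_mult_iff)
  \<comment> \<open>The weight of the second tangent. The bound on the slope would be minimal at
    \<omega>; \<open>Y\<close> lies below it by the shortfall kap * sig x - drop_ratio, and no
    longer involves \<open>drop_ratio\<close> except through \<delta>.\<close>
  define Y where "Y = 1 - kap * sig x + \<delta>"
  have ks: "kap * sig x < 1" using kap_less sig kap_pos mult_left_le[of "sig x" kap] by linarith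
  have Y: "0 < Y" "Y \<le> \<omega>" "Y \<le> 1" using d0 ks less om1 by (auto simp: Y_def \<delta>_def)
  define h where "h = 8 / 10 * Y"
  have h: "0 < h" "h < 1" using Y by (auto simp: h_def)
  define a where "a = g x - Y *\<^sub>R w"
  have na: "norm a \<le> ?n * (1 - Y\<^sup>2 / 2)"
  proof -
    have "(norm a)\<^sup>2 = ?n\<^sup>2 - 2 * Y * (w \<bullet> g x) + Y\<^sup>2 * (norm w)\<^sup>2"
      by (simp only: a_def power2_norm_eq_inner) (simp add: inner_simps inner_commute power2_eq_square algebra_simps)
    also have "\<dots> \<le> ?n\<^sup>2 - 2 * Y * (Y * ?n\<^sup>2) + Y\<^sup>2 * ?n\<^sup>2"
      unfolding wg using Y wn by (intro add_mono diff_mono mult_left_mono mult_right_mono power_mono) auto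
    also have "\<dots> = ?n\<^sup>2 * (1 - Y\<^sup>2)" by (simp add: algebra_simps power2_eq_square)
    also have "\<dots> \<le> ?n\<^sup>2 * (1 - Y\<^sup>2 / 2)\<^sup>2"
    proof (rule mult_left_mono)
      show "1 - Y\<^sup>2 \<le> (1 - Y\<^sup>2 / 2)\<^sup>2" by (simp add: power2_diff power_divide)
    qed simp
    finally have "(norm a)\<^sup>2 \<le> (?n * (1 - Y\<^sup>2 / 2))\<^sup>2" by (simp add: power_mult_distrib)
    moreover have "Y\<^sup>2 \<le> 1" using Y by (simp add: power_le_one)
    ultimately show ?thesis by (rule_tac power2_le_imp_le) auto
  qed
  \<comment> \<open>Chosen so that \<tau> powr (1 - \<theta>) is 1 - h times that power of s
    x.\<close>
  define \<tau> where "\<tau> = s x * (1 - h) powr (1 + \<nu>)"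
  have hp: "(1 - h) powr (1 + \<nu>) \<le> 1" using h nu by (simp add: powr_le1)
  have tau: "0 \<le> \<tau>" "\<tau> \<le> s x" using pos mult_left_mono[OF hp, of "s x"] by (auto simp: \<tau>_def)
  have minor: "s z \<ge> s x + a \<bullet> (z - x) - Y * (\<delta> * A)" for z
  proof -
    have "(1 - Y) * s z \<ge> (1 - Y) * (s x + g x \<bullet> (z - x))"
      using above_tangent[of x z] Y by (intro mult_left_mono) auto
    moreover have "s (step b x) + ?v \<bullet> (z - step b x) = s x - \<delta> * A + ?v \<bullet> (z - x)"
      using gap by (simp add: D_def inner_diff_right algebra_simps)
    then have "Y * s z \<ge> Y * (s x - \<delta> * A + ?v \<bullet> (z - x))"
      using above_tangent[of "step b x" z] Y by (intro mult_left_mono) auto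
    moreover have "a \<bullet> (z - x) = (1 - Y) * (g x \<bullet> (z - x)) + Y * (?v \<bullet> (z - x))"
      by (simp add: a_def w_def inner_diff_left algebra_simps)
    ultimately show ?thesis by (simp add: algebra_simps)
  qed
  have "s x - \<tau> - Y * (\<delta> * A) \<le> norm a * (\<rho> / (1 - \<theta>) * (s x powr (1 - \<theta>) - \<tau> powr (1 - \<theta>)))"
    by (rule minorant_bound[OF x tau minor])
  also have "\<rho> / (1 - \<theta>) = (1 + \<nu>) * \<rho>" by (simp add: one_minus_theta)
  also have "\<tau> powr (1 - \<theta>) = s x powr (1 - \<theta>) * (1 - h)"
  proof -
    have "(1 + \<nu>) * (1 - \<theta>) = 1" using nu by (simp add: one_minus_theta)
    then show ?thesis using pos h by (simp add: \<tau>_def powr_mult powr_powr)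
  qed
  also have "s x powr (1 - \<theta>) - s x powr (1 - \<theta>) * (1 - h) = s x * h / s x powr \<theta>"
    using pos by (simp add: powr_diff algebra_simps diff_divide_distrib)
  also have "norm a * ((1 + \<nu>) * \<rho> * (s x * h / s x powr \<theta>))
      \<le> ?n * (1 - Y\<^sup>2 / 2) * ((1 + \<nu>) * \<rho> * (s x * h / s x powr \<theta>))"
    using na nu rho pos h by (intro mult_right_mono) auto
  also have "\<dots> = s x * ((1 + \<nu>) * (1 - Y\<^sup>2 / 2) * h / sig x powr \<theta>)"
    using grad_pos rho pos by (simp add: sig_theta)
  finally have "s x * (1 - (1 - h) powr (1 + \<nu>)) \<le> Y * (\<delta> * A) + s x * ((1 + \<nu>) * (1 - Y\<^sup>2 / 2) * h / sig x powr \<theta>)"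
    by (simp add: \<tau>_def algebra_simps)
  moreover have "A \<le> s x * (2 * \<nu> / sig x powr \<theta>)"
  proof -
    have "?n powr p \<le> s x * ((1 + \<nu>) / sig x powr \<theta>)" using n_over_s pos by (simp add: pos_divide_le_eq mult.commute)
    then have "A \<le> be * (s x * ((1 + \<nu>) / sig x powr \<theta>))"
      unfolding A_def using b be_pos by (intro mult_mono) auto
    also have "\<dots> = s x * (2 * \<nu> / sig x powr \<theta>)" using nu by (simp add: be_eq)
    finally show ?thesis .
  qed
  then have "Y * (\<delta> * A) \<le> Y * (\<delta> * (s x * (2 * \<nu> / sig x powr \<theta>)))"
    using Y d0 by (intro mult_left_mono) auto
  moreover have "Y * (\<delta> * (s x * (2 * \<nu> / T))) + s x * (k * h / T) = s x * ((2 * \<nu> * \<delta> * Y + k * h) / T)" for T k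
    by (simp add: distrib_left add_divide_distrib mult_ac)
  ultimately have "s x * (1 - (1 - h) powr (1 + \<nu>)) \<le> s x * ((2 * \<nu> * \<delta> * Y + (1 + \<nu>) * (1 - Y\<^sup>2 / 2) * h) / sig x powr \<theta>)"
    by (smt (verit, best))
  then have "1 - (1 - h) powr (1 + \<nu>) \<le> (2 * \<nu> * \<delta> * Y + (1 + \<nu>) * (1 - Y\<^sup>2 / 2) * h) / sig x powr \<theta>"
    using pos by (rule mult_left_le_imp_le)
  moreover have "(1 - h) powr (1 + \<nu>) \<le> (1 - h) * (1 - \<nu> * h)"
  proof -
    have "(1 + (- h)) powr \<nu> \<le> 1 + \<nu> * (- h)" using nu h by (intro powr_le_tangent) auto
    then have "(1 - h) * (1 - h) powr \<nu> \<le> (1 - h) * (1 - \<nu> * h)" using h by (intro mult_left_mono) auto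
    then show ?thesis using h by (simp add: powr_add)
  qed
  then have "(1 + \<nu>) * h - \<nu> * h\<^sup>2 \<le> 1 - (1 - h) powr (1 + \<nu>)"
    by (simp add: algebra_simps power2_eq_square)
  ultimately have "(1 + \<nu>) * h - \<nu> * h\<^sup>2 \<le> (2 * \<nu> * \<delta> * Y + (1 + \<nu>) * (1 - Y\<^sup>2 / 2) * h) / sig x powr \<theta>"
    by linarith
  then have "((1 + \<nu>) * h - \<nu> * h\<^sup>2) * sig x powr \<theta> \<le> 2 * \<nu> * \<delta> * Y + (1 + \<nu>) * (1 - Y\<^sup>2 / 2) * h"
    using sig by (simp add: pos_le_divide_eq)
  then have "Y * (((1 + \<nu>) * (8/10) - 64/100 * \<nu> * Y) * sig x powr \<theta>) \<le> Y * (2 * \<nu> * \<delta> + (1 + \<nu>) * (1 - Y\<^sup>2 / 2) * (8/10))"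
    by (simp add: h_def field_simps power2_eq_square)
  then have "((1 + \<nu>) * (8/10) - 64/100 * \<nu> * Y) * sig x powr \<theta> \<le> 2 * \<nu> * \<delta> + (1 + \<nu>) * (1 - Y\<^sup>2 / 2) * (8/10)"
    using Y by simp
  moreover have "64/100 * \<nu> * Y * sig x powr \<theta> \<le> 64/100 * \<nu> * Y * 1"
    using nu Y sig theta by (intro mult_left_mono powr_le1) auto
  ultimately have "(1 + \<nu>) * (4/10 * Y\<^sup>2 - 8/10 * (1 - sig x powr \<theta>)) \<le> \<nu> * (2 * \<delta> + 64/100 * Y)"
    by (simp add: field_simps)
  then have "4/10 * Y\<^sup>2 - 8/10 * (1 - sig x powr \<theta>) \<le> \<nu> * (2 * \<delta> + 64/100 * Y) / (1 + \<nu>)"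
    using nu by (simp add: pos_le_divide_eq mult.commute)
  also have "\<dots> = \<theta> * (264/100 * Y - 2 * (1 - kap * sig x))"
  proof -
    have "2 * \<delta> + 64/100 * Y = 264/100 * Y - 2 * (1 - kap * sig x)" unfolding Y_def by argo
    then show ?thesis by (simp add: crit)
  qed
  finally have "4/10 * Y\<^sup>2 - 8/10 * (1 - sig x powr \<theta>) - \<theta> * (264/100 * Y - 2 * (1 - kap * sig x)) \<le> 0" by simp
  moreover have "4/10 * Y\<^sup>2 - 8/10 * (1 - sig x powr \<theta>) - \<theta> * (264/100 * Y - 2 * (1 - kap * sig x)) > 0"
    unfolding kap_kappa
    by (rule third_point_numeric[OF nu(1) small crit])
       (use drop_ratio less sig d0 in \<open>auto simp: kap_kappa Y_def\<close>)
  ultimately show False by simp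
qed

end
end
end

section \<open>One step under the critical exponent\<close>

text \<open>The difference of the sides vanishes at 1; up to the factor y powr (- \<nu>), the sign
  of its derivative is Bernoulli's inequality for y powr (1 + \<nu>) with exponent 2 \<nu> / (1 +
  \<nu>).\<close>

lemma powr_diff_le:
  fixes q \<nu> :: real
  assumes q: "0 \<le> q" "q \<le> 1" and nu: "0 < \<nu>" "\<nu> < 1"
  shows "q powr (1 - \<nu>) - q powr (1 + \<nu>) \<le> \<nu> * (1 - q\<^sup>2)"
proof (cases "q = 0")
  case True
  then show ?thesis using nu by simp
next
  case False
  define f where "f y = \<nu> * (1 - y\<^sup>2) - y powr (1 - \<nu>) + y powr (1 + \<nu>)" for y :: real
  have "f 1 \<le> f q"
  proof (rule DERIV_nonpos_imp_nonincreasing[OF q(2)])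
    fix y assume "q \<le> y" "y \<le> 1"
    then have y: "0 < y" using q False by simp
    let ?D = "- (2 * \<nu> * y) - (1 - \<nu>) * y powr (- \<nu>) + (1 + \<nu>) * y powr \<nu>"
    have "(f has_real_derivative ?D) (at y)"
      unfolding f_def using y by (auto intro!: derivative_eq_intros simp: field_simps)
    moreover have "?D \<le> 0"
    proof -
      have "(1 + (y powr (1 + \<nu>) - 1)) powr (2 * \<nu> / (1 + \<nu>)) \<le> 1 + 2 * \<nu> / (1 + \<nu>) * (y powr (1 + \<nu>) - 1)"
        using nu by (intro powr_le_tangent) auto
      then have "(1 + \<nu>) * y powr (2 * \<nu>) \<le> (1 + \<nu>) * (1 + 2 * \<nu> / (1 + \<nu>) * (y powr (1 + \<nu>) - 1))"
        using nu by (intro mult_left_mono) (simp_all add: powr_powr)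
      also have "\<dots> = 1 - \<nu> + 2 * \<nu> * y powr (1 + \<nu>)" using nu by (simp add: field_simps)
      finally have "y powr (- \<nu>) * ((1 + \<nu>) * y powr (2 * \<nu>)) \<le> y powr (- \<nu>) * (1 - \<nu> + 2 * \<nu> * y powr (1 + \<nu>))"
        by (intro mult_left_mono) auto
      moreover have "y powr (- \<nu>) * y powr (2 * \<nu>) = y powr \<nu>" "y powr (- \<nu>) * y powr (1 + \<nu>) = y"
        using y by (simp_all flip: powr_add)
      ultimately show ?thesis by (simp add: algebra_simps)
    qed
    ultimately show "\<exists>d. (f has_real_derivative d) (at y) \<and> d \<le> 0" by blast
  qed
  then show ?thesis by (simp add: f_def)
qed

context critical_problem begin

text \<open>The growth constant: s is at least m times the distance to \<open>X\<close> to the power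
  1 + \<nu>.\<close>

definition m where "m = ((1 + \<nu>) * \<rho>) powr (- (1 + \<nu>))"

lemma m_pos: "0 < m" using nu rho by (simp add: m_def)

lemma s_eq_U: "s x = m * U x powr (1 + \<nu>)"
proof -
  have "U x powr (1 + \<nu>) = ((1 + \<nu>) * \<rho>) powr (1 + \<nu>) * s x"
    using nu nonneg[of x] by (simp add: U_def powr_mult powr_powr)
  moreover have "m * ((1 + \<nu>) * \<rho>) powr (1 + \<nu>) = 1"
    using nu rho by (simp add: m_def flip: powr_add)
  ultimately show ?thesis by (metis mult.assoc mult_1)
qed

lemma s_ge: "s x \<le> S \<Longrightarrow> m * infdist x X powr (1 + \<nu>) \<le> s x"
  unfolding s_eq_U[of x] using m_pos nu infdist_le_U
  by (intro mult_left_mono powr_mono2) (auto simp: s_eq_U infdist_nonneg)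

text \<open>The first bound is concavity of the power 1 / (1 + \<nu>); the second holds because 2 /
  (1 + \<nu>) is at least 1.\<close>

lemma U_drop:
  assumes "0 < s x" "s y \<le> s x"
  shows "U x / (1 + \<nu>) * ((s x - s y) / s x) \<le> U x - U y"
    and "(U x)\<^sup>2 * ((s x - s y) / s x) \<le> (U x)\<^sup>2 - (U y)\<^sup>2"
    and "U y \<le> U x"
proof -
  define q where "q = s y / s x"
  have q: "0 \<le> q" "q \<le> 1" using assms nonneg[of y] by (auto simp: q_def)
  have D: "(s x - s y) / s x = 1 - q" using assms by (simp add: q_def diff_divide_distrib)
  have Uy: "U y = U x * q powr (1 / (1 + \<nu>))"
  proof -
    have "s y = s x * q" using assms by (simp add: q_def)
    then show ?thesis using assms q by (simp add: U_def powr_mult)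
  qed
  have "(1 + (q - 1)) powr (1 / (1 + \<nu>)) \<le> 1 + 1 / (1 + \<nu>) * (q - 1)"
    using nu q by (intro powr_le_tangent) auto
  then have "U y \<le> U x * (1 + 1 / (1 + \<nu>) * (q - 1))"
    unfolding Uy using U_nonneg by (intro mult_left_mono) auto
  then show 1: "U x / (1 + \<nu>) * ((s x - s y) / s x) \<le> U x - U y"
    unfolding D by (simp add: algebra_simps diff_divide_distrib)
  have "q powr (1 / (1 + \<nu>)) * q powr (1 / (1 + \<nu>)) = q powr (2 / (1 + \<nu>))"
    by (simp flip: powr_add)
  also have "\<dots> \<le> q powr 1" using nu q by (intro powr_mono') auto
  finally have "(U x)\<^sup>2 * (q powr (1 / (1 + \<nu>)) * q powr (1 / (1 + \<nu>))) \<le> (U x)\<^sup>2 * q"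
    using q by (intro mult_left_mono) auto
  then have "(U y)\<^sup>2 \<le> (U x)\<^sup>2 * q" unfolding Uy by (simp add: power2_eq_square mult_ac)
  then show "(U x)\<^sup>2 * ((s x - s y) / s x) \<le> (U x)\<^sup>2 - (U y)\<^sup>2"
    unfolding D by (simp add: algebra_simps)
  have "0 \<le> U x / (1 + \<nu>) * (1 - q)" using U_nonneg[of x] nu q by simp
  then show "U y \<le> U x" using 1 unfolding D by simp
qed

lemma step_minimizer: "s x = 0 \<Longrightarrow> step b x = x"
  using g_X[of x] by (simp add: X_def step_def)

text \<open>From the continuous analogue: per unit of \<open>cf\<close>, the squared distance d^2
  falls by 2 s \<ge> 2 m d powr (1 + \<nu>), so d powr (1 - \<nu>) / ((1 - \<nu>) m) falls at least
  at rate 1.\<close>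

definition "G z = infdist z X powr (1 - \<nu>) / ((1 - \<nu>) * m)"

lemma G_le: assumes "\<nu> < 1" "s z \<le> S" shows "G z \<le> U z powr (1 - \<nu>) / ((1 - \<nu>) * m)"
  unfolding G_def using assms m_pos infdist_le_U[of z]
  by (intro divide_right_mono powr_mono2) (auto simp: infdist_nonneg)

lemma G_nonneg: "\<nu> < 1 \<Longrightarrow> 0 \<le> G z" using m_pos by (simp add: G_def)

context
  fixes x b assumes x: "s x \<le> S" and b: "0 < b" "b \<le> be"
begin

lemma decrease_ratio: "s (step b x) \<le> (1 - kap * b / R) * s x"
proof (cases "s x = 0")
  case True
  then show ?thesis by (simp add: step_minimizer)
next
  case False
  then have pos: "0 < s x" using nonneg[of x] by simp
  note ctx = x pos b
  consider "13/27 \<le> \<nu>" | "1/7 \<le> \<nu>" "\<nu> \<le> 13/27" | "\<nu> \<le> 1/7" by linarith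
  then have "kap * sig x \<le> drop_ratio x b"
  proof cases
    case 1
    have "sig x powr 1 \<le> sig x powr \<theta>" using sig[OF x pos] theta by (intro powr_mono') auto
    then have "kap * sig x \<le> kap * sig x powr \<theta>" using kap_pos sig[OF x pos] by simp
    then show ?thesis using decrease_strong[OF ctx 1] by linarith
  next
    case 2
    then show ?thesis by (rule decrease_weak_large[OF ctx])
  next
    case 3
    then show ?thesis by (rule decrease_weak_small[OF ctx])
  qed
  then have "kap * sig x * (b * norm (g x) powr p) \<le> s x - s (step b x)"
    unfolding D_drop_ratio[OF ctx] using b by (intro mult_right_mono) auto
  moreover have "kap * sig x * (b * norm (g x) powr p) = kap * b / R * s x"
    using R_pos by (subst s_sig[OF x pos]) simp
  ultimately show ?thesis by (simp add: algebra_simps)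
qed

text \<open>The left side is the linearized decrease of the concave function \<open>U\<close> of the
  value. A lower bound on \<open>drop_ratio\<close> proportional to sig powr \<theta> therefore
  telescopes to a bound on the length.\<close>

lemma length_le_U_drop:
  assumes pos: "0 < s x"
  shows "drop_ratio x b * norm (step b x - x) / sig x powr \<theta> \<le> U x - U (step b x)"
proof -
  have "U x / (1 + \<nu>) * ((s x - s (step b x)) / s x) = drop_ratio x b * norm (step b x - x) / sig x powr \<theta>"
  proof -
    have "s x powr (1 - \<theta>) = s x / s x powr \<theta>" using pos by (simp add: powr_diff)
    then have "U x / (1 + \<nu>) = \<rho> * s x / s x powr \<theta>" using nu by (simp add: U_def one_minus_theta)
    moreover have "norm (step b x - x) * norm (g x) = b * norm (g x) powr p"
      using b by (simp add: norm_step norm_powr_p mult.assoc)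
    then have "s x - s (step b x) = drop_ratio x b * (norm (step b x - x) * norm (g x))"
      using D_drop_ratio[OF x pos b] by simp
    ultimately have "U x / (1 + \<nu>) * ((s x - s (step b x)) / s x)
        = \<rho> * s x / s x powr \<theta> * (drop_ratio x b * (norm (step b x - x) * norm (g x)) / s x)" by simp
    also have "\<dots> = drop_ratio x b * norm (step b x - x) / (s x powr \<theta> / (\<rho> * norm (g x)))"
      using pos by simp
    finally show ?thesis unfolding sig_theta[OF x pos] .
  qed
  then show ?thesis using U_drop(1)[of x "step b x"] pos step_decrease(3)[OF x, of b] b by simp
qed

lemma length_le_strong: assumes "13/27 \<le> \<nu>" shows "kap * norm (step b x - x) \<le> U x - U (step b x)"
proof (cases "s x = 0")
  case True
  then show ?thesis by (simp add: step_minimizer)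
next
  case False
  then have pos: "0 < s x" using nonneg[of x] by simp
  have "kap \<le> drop_ratio x b / sig x powr \<theta>"
    using decrease_strong[OF x pos b assms] sig[OF x pos] by (simp add: pos_le_divide_eq)
  then have "kap * norm (step b x - x) \<le> drop_ratio x b / sig x powr \<theta> * norm (step b x - x)"
    by (intro mult_right_mono) auto
  then show ?thesis using length_le_U_drop[OF pos] by simp
qed

lemma length_le_weak: "(1 - kap) * norm (step b x - x) \<le> U x - U (step b x)"
proof (cases "s x = 0")
  case True
  then show ?thesis by (simp add: step_minimizer)
next
  case False
  then have pos: "0 < s x" using nonneg[of x] by simp
  have "sig x powr \<theta> \<le> 1" using sig[OF x pos] theta by (simp add: powr_le1)
  then have "(1 - kap) * sig x powr \<theta> \<le> 1 - kap" using kap_less by (intro mult_left_le) auto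
  then have "(1 - kap) * sig x powr \<theta> \<le> drop_ratio x b" using drop_ratio[OF x pos b] by linarith
  then have "1 - kap \<le> drop_ratio x b / sig x powr \<theta>" using sig[OF x pos] by (simp add: pos_le_divide_eq)
  then have "(1 - kap) * norm (step b x - x) \<le> drop_ratio x b / sig x powr \<theta> * norm (step b x - x)"
    by (intro mult_right_mono) auto
  then show ?thesis using length_le_U_drop[OF pos] by simp
qed

lemma U_step_le: "U (step b x) \<le> U x"
  using step_decrease(3)[OF x, of b] b nu rho nonneg
  unfolding U_def by (intro mult_left_mono powr_mono2) auto

text \<open>Fejer monotonicity and growth lower the squared distance by 2 c m d powr (1 + \<nu>);
  concavity of d^2 \<mapsto> d powr (1 - \<nu>) turns this into a drop of \<open>G\<close>.\<close>

lemma coeff_le_G_drop: assumes nu1: "\<nu> < 1" shows "cf b x \<le> G x - G (step b x)"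
proof (cases "s x = 0")
  case True
  then have "cf b x = 0" using g_X[of x] nu1 nu by (simp add: X_def cf_def)
  then show ?thesis using True by (simp add: step_minimizer)
next
  case False
  then have pos: "0 < s x" using nonneg[of x] by simp
  let ?c = "cf b x"
  define d where "d = infdist x X"
  define d' where "d' = infdist (step b x) X"
  have "d \<noteq> 0"
    using False in_closed_iff_infdist_zero[OF closed_X X_ne, of x] by (simp add: d_def X_def)
  then have d: "0 < d" and d': "0 \<le> d'"
    using infdist_nonneg[of x X] infdist_nonneg[of "step b x" X] unfolding d_def d'_def by linarith+
  have c: "0 \<le> ?c" using b by (simp add: cf_nonneg)
  have "2 * ?c * (m * d powr (1 + \<nu>)) \<le> 2 * ?c * s x"
    using s_ge[OF x] c by (intro mult_left_mono) (auto simp: d_def)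
  also have "\<dots> \<le> d\<^sup>2 - d'\<^sup>2" using fejer_infdist[OF x, of b] b by (simp add: d_def d'_def)
  finally have drop: "2 * ?c * (m * d powr (1 + \<nu>)) \<le> d\<^sup>2 - d'\<^sup>2" .
  have "(1 + ((d' / d)\<^sup>2 - 1)) powr ((1 - \<nu>) / 2) \<le> 1 + (1 - \<nu>) / 2 * ((d' / d)\<^sup>2 - 1)"
    using nu nu1 by (intro powr_le_tangent) auto
  moreover have "((d' / d)\<^sup>2) powr ((1 - \<nu>) / 2) = (d' / d) powr (1 - \<nu>)"
  proof -
    have "2 * ((1 - \<nu>) / 2) = 1 - \<nu>" by argo
    moreover have "(d' / d)\<^sup>2 = (d' / d) powr 2" using d d' by simp
    ultimately show ?thesis by (metis powr_powr)
  qed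
  ultimately have "(d' / d) powr (1 - \<nu>) \<le> 1 + (1 - \<nu>) / 2 * ((d' / d)\<^sup>2 - 1)" by simp
  then have "d powr (1 - \<nu>) * (d' / d) powr (1 - \<nu>) \<le> d powr (1 - \<nu>) * (1 + (1 - \<nu>) / 2 * ((d' / d)\<^sup>2 - 1))"
    by (intro mult_left_mono) auto
  also have "d powr (1 - \<nu>) * (d' / d) powr (1 - \<nu>) = d' powr (1 - \<nu>)"
    using d d' by (simp add: powr_divide)
  also have "d powr (1 - \<nu>) * (1 + (1 - \<nu>) / 2 * ((d' / d)\<^sup>2 - 1))
      = d powr (1 - \<nu>) - (1 - \<nu>) / 2 * (d powr (1 - \<nu>) / d\<^sup>2) * (d\<^sup>2 - d'\<^sup>2)"
    using d by (simp add: field_simps power2_eq_square)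
  finally have "(1 - \<nu>) / 2 * (d powr (1 - \<nu>) / d\<^sup>2) * (d\<^sup>2 - d'\<^sup>2) \<le> d powr (1 - \<nu>) - d' powr (1 - \<nu>)" by simp
  moreover have "(1 - \<nu>) / 2 * (d powr (1 - \<nu>) / d\<^sup>2) * (2 * ?c * (m * d powr (1 + \<nu>)))
      \<le> (1 - \<nu>) / 2 * (d powr (1 - \<nu>) / d\<^sup>2) * (d\<^sup>2 - d'\<^sup>2)"
    using drop nu1 by (intro mult_left_mono) auto
  moreover have "(1 - \<nu>) / 2 * (d powr (1 - \<nu>) / d\<^sup>2) * (2 * ?c * (m * d powr (1 + \<nu>))) = ?c * ((1 - \<nu>) * m)"
  proof -
    have "d powr (1 - \<nu>) * d powr (1 + \<nu>) = d\<^sup>2" using d by (simp flip: powr_add)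
    then show ?thesis using d by (simp add: field_simps)
  qed
  ultimately have "?c * ((1 - \<nu>) * m) \<le> d powr (1 - \<nu>) - d' powr (1 - \<nu>)" by linarith
  then have "?c \<le> (d powr (1 - \<nu>) - d' powr (1 - \<nu>)) / ((1 - \<nu>) * m)"
    using nu1 m_pos by (simp add: pos_le_divide_eq)
  then show ?thesis by (simp add: G_def d_def d'_def diff_divide_distrib)
qed

text \<open>After bounding \<open>G\<close> by a power of \<open>U\<close>, both sides scale like
  U^2, which leaves the one-variable inequality \<open>powr_diff_le\<close> for the ratio of the two
  values of \<open>U\<close>.\<close>

lemma G_U_drop:
  assumes nu1: "\<nu> < 1"
  shows "(s x - s (step b x)) * (G x + G (step b x)) \<le> (1 + \<nu>) / (1 - \<nu>) * ((U x)\<^sup>2 - (U (step b x))\<^sup>2)"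
proof (cases "s x = 0")
  case True
  then show ?thesis by (simp add: step_minimizer)
next
  case False
  then have pos: "0 < s x" using nonneg[of x] by simp
  define u where "u = U x"
  define v where "v = U (step b x)"
  have u: "0 < u" using pos nu rho by (simp add: u_def U_def)
  have v: "0 \<le> v" "v \<le> u" by (auto simp: v_def u_def U_nonneg U_step_le)
  define q where "q = v / u"
  have q: "0 \<le> q" "q \<le> 1" using u v by (auto simp: q_def)
  have vq: "v powr a = u powr a * q powr a" for a using u v by (simp add: q_def powr_divide)
  have le: "s (step b x) \<le> s x" using step_decrease(3)[OF x, of b] b by simp
  have "(s x - s (step b x)) * (G x + G (step b x))
      \<le> (s x - s (step b x)) * (u powr (1 - \<nu>) / ((1 - \<nu>) * m) + v powr (1 - \<nu>) / ((1 - \<nu>) * m))"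
    unfolding u_def v_def using le nu1 x by (intro mult_left_mono add_mono G_le) auto
  also have "\<dots> = (u powr (1 + \<nu>) - v powr (1 + \<nu>)) * (u powr (1 - \<nu>) + v powr (1 - \<nu>)) / (1 - \<nu>)"
  proof -
    have e1: "s x - s (step b x) = m * (u powr (1 + \<nu>) - v powr (1 + \<nu>))"
      unfolding u_def v_def right_diff_distrib by (simp only: s_eq_U[symmetric])
    have e2: "u powr (1 - \<nu>) / ((1 - \<nu>) * m) + v powr (1 - \<nu>) / ((1 - \<nu>) * m)
        = (u powr (1 - \<nu>) + v powr (1 - \<nu>)) / ((1 - \<nu>) * m)"
      by (simp only: add_divide_distrib)
    have "m * a * (e / (n * m)) = a * e / n" for a e n :: real using m_pos by simp
    then show ?thesis unfolding e1 e2 .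
  qed
  also have "\<dots> = u\<^sup>2 * ((1 - q powr (1 + \<nu>)) * (1 + q powr (1 - \<nu>))) / (1 - \<nu>)"
  proof -
    have "u powr (1 + \<nu>) * u powr (1 - \<nu>) = u\<^sup>2" using u by (simp flip: powr_add)
    then show ?thesis unfolding vq by (simp add: algebra_simps)
  qed
  also have "(1 - q powr (1 + \<nu>)) * (1 + q powr (1 - \<nu>)) = 1 - q\<^sup>2 + (q powr (1 - \<nu>) - q powr (1 + \<nu>))"
  proof -
    have "q powr (1 + \<nu>) * q powr (1 - \<nu>) = q\<^sup>2" using q by (simp flip: powr_add)
    then show ?thesis by (simp add: algebra_simps)
  qed
  also have "u\<^sup>2 * \<dots> / (1 - \<nu>) \<le> u\<^sup>2 * (1 - q\<^sup>2 + \<nu> * (1 - q\<^sup>2)) / (1 - \<nu>)"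
    using powr_diff_le[OF q nu(1) nu1] nu1 by (intro divide_right_mono mult_left_mono add_left_mono) auto
  also have "\<dots> = (1 + \<nu>) / (1 - \<nu>) * (u\<^sup>2 - v\<^sup>2)"
  proof -
    have "v = u * q" using u by (simp add: q_def)
    then have "u\<^sup>2 * (1 - q\<^sup>2 + \<nu> * (1 - q\<^sup>2)) = (1 + \<nu>) * (u\<^sup>2 - v\<^sup>2)"
      by (simp add: power_mult_distrib algebra_simps)
    then show ?thesis by simp
  qed
  finally show ?thesis by (simp add: u_def v_def)
qed

text \<open>\<open>G\<close> bounds the sum of all future coefficients \<open>cf\<close>, so the mixed term \<open>2 (s y - s x) G x\<close> pays for
  the growth of the squared displacement from \<open>y\<close>.\<close>

lemma potential_step:
  assumes nu1: "\<nu> < 1" and y: "s x \<le> s y"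
  defines "T \<equiv> (1 + \<nu>) / (1 - \<nu>)" and "c \<equiv> cf b x"
  shows "(norm (step b x - y))\<^sup>2 + 2 * (s y - s (step b x)) * G (step b x) + T * (U (step b x))\<^sup>2
    \<le> (norm (x - y))\<^sup>2 + 2 * (s y - s x) * G x + T * (U x)\<^sup>2 + c * (c * (norm (g x))\<^sup>2 - (s x - s (step b x)))"
proof -
  have c: "0 \<le> c" using b by (simp add: c_def cf_nonneg)
  have step: "step b x - y = (x - y) - c *\<^sub>R g x" by (simp add: step_def c_def)
  have F1: "(norm (step b x - y))\<^sup>2 = (norm (x - y))\<^sup>2 + 2 * (c * (g x \<bullet> (y - x))) + c * (c * (norm (g x))\<^sup>2)"
    unfolding step power2_norm_eq_inner by (simp add: inner_simps inner_commute algebra_simps)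
  have F2: "c * (g x \<bullet> (y - x)) \<le> c * (s y - s x)"
    using above_tangent[of x y] c by (intro mult_left_mono) auto
  have F3: "(s y - s x) * c \<le> (s y - s x) * (G x - G (step b x))"
    using coeff_le_G_drop[OF nu1] y by (intro mult_left_mono) (auto simp: c_def)
  have F4: "(s x - s (step b x)) * c \<le> (s x - s (step b x)) * (G x - G (step b x))"
    using coeff_le_G_drop[OF nu1] step_decrease(3)[OF x, of b] b by (intro mult_left_mono) (auto simp: c_def)
  \<comment> \<open>The leftover D (c + 2 G') is at most D (H + G') because c \<le> H - G'; this
    symmetric sum is what the drop of U^2 pays for.\<close>
  have comb: "N' + 2 * (A + D) * G' + T * u' \<le> N + 2 * A * H + T * u + c * (E - D)"
    if "N' = N + 2 * P + c * E" "P \<le> c * A" "A * c \<le> A * (H - G')" "D * c \<le> D * (H - G')"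
      "D * (H + G') \<le> T * (u - u')" for N' N P E A H G' D u u'
    using that by (simp add: algebra_simps)
  show ?thesis
    using comb[OF F1 F2 F3 F4 G_U_drop[OF nu1, folded T_def]] by simp
qed

lemma error_term_le: "cf b x * (norm (g x))\<^sup>2 - (s x - s (step b x)) \<le> kap * (b * norm (g x) powr p)"
  using step_decrease(1)[OF x, of b] b by (simp add: cf_norm2 algebra_simps)

lemma length_sq: "(norm (step b x - x))\<^sup>2 = cf b x * (b * norm (g x) powr p)"
proof -
  have "(norm (step b x - x))\<^sup>2 = (cf b x)\<^sup>2 * (norm (g x))\<^sup>2"
    using b cf_nonneg[of b x] by (simp add: step_def power_mult_distrib)
  then show ?thesis by (simp add: power2_eq_square mult.assoc flip: cf_norm2)
qed

text \<open>The error is at most kap * c * A. Both c s (through the distance) and c A^2 / s (through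
  U^2) are bounded by telescoping drops, and their geometric mean is c A.\<close>

lemma error_telescopes:
  shows "cf b x * (cf b x * (norm (g x))\<^sup>2 - (s x - s (step b x)))
    \<le> be * kap / sqrt (2 * (1 - kap)) / 2 *
      ((infdist x X)\<^sup>2 - (infdist (step b x) X)\<^sup>2 + ((U x)\<^sup>2 - (U (step b x))\<^sup>2))"
proof (cases "s x = 0")
  case True
  then have "g x = 0" using g_X[of x] by (simp add: X_def)
  then show ?thesis using True by (simp add: step_minimizer)
next
  case False
  then have pos: "0 < s x" using nonneg[of x] by simp
  let ?c = "cf b x"
  define A where "A = b * norm (g x) powr p"
  define D where "D = s x - s (step b x)"
  define u where "u = sqrt (2 * (1 - kap))"
  have u: "0 < u" "u\<^sup>2 = 2 * (1 - kap)" using kap_less by (auto simp: u_def)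
  have c: "0 \<le> ?c" using b by (simp add: cf_nonneg)
  have A: "0 \<le> A" using b by (simp add: A_def)
  have D: "u\<^sup>2 * A / 2 \<le> D" 
  proof -
    have "u\<^sup>2 * A / 2 = (1 - kap) * A" unfolding u(2) by argo
    then show ?thesis using step_decrease(1)[OF x, of b] b unfolding A_def D_def by linarith
  qed
  have "?c * A \<le> be\<^sup>2 * (U x)\<^sup>2"
  proof -
    have "norm (step b x - x) \<le> be * U x"
      using grad_le_U[OF x] b be_pos by (simp add: norm_step mult_mono)
    then have "(norm (step b x - x))\<^sup>2 \<le> (be * U x)\<^sup>2" by (intro power_mono) auto
    then show ?thesis by (simp add: length_sq A_def power_mult_distrib)
  qed
  then have "?c * A * (u\<^sup>2 * A / 2) \<le> be\<^sup>2 * (U x)\<^sup>2 * D"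
    using D A c by (rule_tac mult_mono) (auto intro: mult_nonneg_nonneg simp del: mult_le_cancel_left_pos)
  then have "(?c * A * (u\<^sup>2 * A / 2)) / (be\<^sup>2 * s x) \<le> (be\<^sup>2 * (U x)\<^sup>2 * D) / (be\<^sup>2 * s x)"
    using pos be_pos by (intro divide_right_mono) auto
  also have "\<dots> = (U x)\<^sup>2 * (D / s x)" using be_pos by simp
  also have "\<dots> \<le> (U x)\<^sup>2 - (U (step b x))\<^sup>2"
    unfolding D_def using U_drop(2)[OF pos] step_decrease(3)[OF x, of b] b by simp
  finally have 1: "?c * (A\<^sup>2 * u\<^sup>2 / (2 * be\<^sup>2 * s x)) \<le> (U x)\<^sup>2 - (U (step b x))\<^sup>2"
    by (simp add: power2_eq_square mult_ac)
  have 2: "2 * ?c * s x \<le> (infdist x X)\<^sup>2 - (infdist (step b x) X)\<^sup>2"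
    using fejer_infdist[OF x, of b] b by simp
  have amgm: "2 * (A * u / be) \<le> 2 * s x + A\<^sup>2 * u\<^sup>2 / (2 * be\<^sup>2 * s x)"
  proof -
    have "0 \<le> (2 * s x * be - A * u)\<^sup>2 / (2 * be\<^sup>2 * s x)" using pos by simp
    also have "\<dots> = 2 * s x + A\<^sup>2 * u\<^sup>2 / (2 * be\<^sup>2 * s x) - 2 * (A * u / be)"
      using pos be_pos by (simp add: field_simps power2_eq_square)
    finally show ?thesis by simp
  qed
  have "?c * (2 * (A * u / be)) \<le> ?c * (2 * s x + A\<^sup>2 * u\<^sup>2 / (2 * be\<^sup>2 * s x))"
    using amgm c by (intro mult_left_mono)
  also have "\<dots> \<le> (infdist x X)\<^sup>2 - (infdist (step b x) X)\<^sup>2 + ((U x)\<^sup>2 - (U (step b x))\<^sup>2)"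
    using 1 2 by (simp add: algebra_simps)
  finally have "be * kap / u / 2 * (?c * (2 * (A * u / be))) \<le> be * kap / u / 2 *
      ((infdist x X)\<^sup>2 - (infdist (step b x) X)\<^sup>2 + ((U x)\<^sup>2 - (U (step b x))\<^sup>2))"
    using be_pos kap_pos u by (intro mult_left_mono) auto
  moreover have "be * kap / u / 2 * (?c * (2 * (A * u / be))) = ?c * (kap * A)"
    using be_pos u by simp
  moreover have "?c * (?c * (norm (g x))\<^sup>2 - (s x - s (step b x))) \<le> ?c * (kap * A)"
    unfolding A_def using error_term_le c by (rule mult_left_mono)
  ultimately show ?thesis unfolding u_def by linarith
qed

end

end

section \<open>Length of the trajectory\<close>

context normalized_problem begin

context
  fixes x :: "nat \<Rightarrow> 'a" and b :: "nat \<Rightarrow> real"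
  assumes init: "s (x 0) \<le> S" and b: "\<And>k. 0 < b k" "\<And>k. b k \<le> be"
    and iter: "\<And>k. x (Suc k) = step (b k) (x k)"
begin

lemma iter_level: "s (x k) \<le> S"
proof (induction k)
  case (Suc k)
  then show ?case unfolding iter using less_imp_le[OF b(1)] b(2) by (rule step_decrease(4))
qed (rule init)

lemma iter_antimono: "i \<le> j \<Longrightarrow> s (x j) \<le> s (x i)"
proof (rule lift_Suc_antimono_le[of "\<lambda>k. s (x k)"])
  show "s (x (Suc k)) \<le> s (x k)" for k
    unfolding iter by (rule step_decrease(3)[OF iter_level less_imp_le[OF b(1)] b(2)])
qed

lemma iter_fejer:
  assumes "z \<in> X" "i \<le> j"
  shows "norm (x j - z) \<le> norm (x i - z)"
proof (rule lift_Suc_antimono_le[of "\<lambda>k. norm (x k - z)", OF _ assms(2)])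
  fix k
  have "0 \<le> 2 * cf (b k) (x k) * s (x k)" using cf_nonneg[of "b k"] b(1)[of k] nonneg by simp
  then have "(norm (x (Suc k) - z))\<^sup>2 \<le> (norm (x k - z))\<^sup>2"
    using fejer[OF iter_level less_imp_le[OF b(1)] b(2) assms(1), of k k] unfolding iter by linarith
  then show "norm (x (Suc k) - z) \<le> norm (x k - z)" by (rule power2_le_imp_le) simp
qed

lemma iter_near:
  assumes "i \<le> j"
  shows "norm (x i - x j) \<le> 2 * infdist (x i) X"
    and "infdist (x j) X \<le> infdist (x i) X"
proof -
  obtain P where P: "P \<in> X" "infdist (x i) X = dist (x i) P"
    using infdist_attains_inf[OF closed_X X_ne] by blast
  have "norm (x j - P) \<le> infdist (x i) X"
    using iter_fejer[OF P(1) assms] P(2) by (simp add: dist_norm)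
  then show "norm (x i - x j) \<le> 2 * infdist (x i) X" "infdist (x j) X \<le> infdist (x i) X"
    using P norm_triangle_ineq4[of "x i - P" "x j - P"] infdist_le[OF P(1), of "x j"] by (simp_all add: dist_norm)
qed

end
end

section \<open>Displacement bounds in the three ranges of \<nu>\<close>

context critical_problem begin

lemma kap_tiny:
  assumes "\<nu> \<le> 1 / 64"
  shows "kap \<le> 1 / ((1 + \<nu>) * (1 + \<nu> * (10 / 3)))"
  unfolding kap_kappa
proof (rule kappa_le_of_log[OF nu(1)])
  show "10 / 3 \<le> ln ((1 + \<nu>) / (2 * \<nu>))"
  proof (rule le_ln_of_power[of 3 _ _ 10])
    \<comment> \<open>325/10 is the value of (1 + \<nu>) / (2 \<nu>) at \<nu> = 1/64.\<close>
    have "(325 / 10 :: real) ^ 3 \<le> ((1 + \<nu>) / (2 * \<nu>)) ^ 3"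
      using assms nu by (intro power_mono) (auto simp: field_simps)
    moreover have "(272 / 100 :: real) ^ 10 \<le> (325 / 10) ^ 3" by (simp add: power_divide)
    ultimately show "(272 / 100) ^ 10 \<le> ((1 + \<nu>) / (2 * \<nu>)) ^ 3" by linarith
  qed (use nu in auto)
qed simp

lemma kap_tiny_gap: assumes "\<nu> \<le> 1 / 64" shows "2 * \<nu> \<le> 1 - kap"
proof -
  have "(1 - 2 * \<nu>) * ((1 + \<nu>) * (1 + \<nu> * (10 / 3))) = 1 + \<nu> * (7 / 3 - 16 / 3 * \<nu> - 20 / 3 * \<nu>\<^sup>2)"
    by (simp add: field_simps power2_eq_square)
  moreover have "\<nu>\<^sup>2 \<le> (1 / 64)\<^sup>2" using assms nu by (intro power_mono) auto
  then have "0 \<le> 7 / 3 - 16 / 3 * \<nu> - 20 / 3 * \<nu>\<^sup>2" using assms by (simp add: power_divide)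
  ultimately have "1 \<le> (1 - 2 * \<nu>) * ((1 + \<nu>) * (1 + \<nu> * (10 / 3)))" using nu by simp
  then have "1 / ((1 + \<nu>) * (1 + \<nu> * (10 / 3))) \<le> 1 - 2 * \<nu>"
    using nu by (simp add: pos_divide_le_eq)
  then show ?thesis using kap_tiny[OF assms] by linarith
qed

lemma be_le_2nu: "be \<le> 2 * \<nu>"
  using nu by (simp add: be_eq pos_divide_le_eq)

text \<open>The linear terms balance exactly: 10/3 is both the logarithmic factor in
  \<open>kap_tiny\<close> and the constant for the sum of squared lengths, and \<open>be\<close> is
  at most 2 \<nu>.\<close>

lemma path_numeric_tiny:
  assumes "\<nu> \<le> 1 / 64"
  shows "(1 + \<nu>) / (1 - \<nu>) + kap * (10 / 3 * be) \<le> 1 / kap\<^sup>2"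
proof -
  define Q where "Q = (1 + \<nu>) * (1 + \<nu> * (10 / 3))"
  have "1 * 1 \<le> Q" unfolding Q_def using nu by (intro mult_mono) auto
  then have Q: "0 < Q" "1 \<le> Q" by auto
  have "kap * (10 / 3 * be) \<le> 1 * (20 / 3 * \<nu>)"
    using kap_pos kap_less be_pos be_le_2nu by (rule_tac mult_mono) auto
  moreover have "(1 + \<nu>) / (1 - \<nu>) \<le> 1 + 2 * \<nu> + 3 * \<nu>\<^sup>2"
  proof -
    have "(1 + 2 * \<nu> + 3 * \<nu>\<^sup>2) * (1 - \<nu>) = 1 + \<nu> + \<nu>\<^sup>2 * (1 - 3 * \<nu>)"
      by (simp add: algebra_simps power2_eq_square)
    moreover have "0 \<le> \<nu>\<^sup>2 * (1 - 3 * \<nu>)" using assms by simp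
    ultimately show ?thesis using assms by (simp add: pos_divide_le_eq)
  qed
  moreover have "Q\<^sup>2 \<ge> 1 + 2 * \<nu> + 3 * \<nu>\<^sup>2 + 20 / 3 * \<nu>"
  proof -
    have "Q \<ge> 1 + 13 / 3 * \<nu> + 10 / 3 * \<nu>\<^sup>2" unfolding Q_def power2_eq_square by argo
    then have "(1 + (13 / 3 * \<nu> + 10 / 3 * \<nu>\<^sup>2))\<^sup>2 \<le> Q\<^sup>2" using nu by (intro power_mono) auto
    moreover have bern: "1 + 2 * z \<le> (1 + z)\<^sup>2" for z :: real by (simp add: power2_sum)
    ultimately have "1 + 2 * (13 / 3 * \<nu> + 10 / 3 * \<nu>\<^sup>2) \<le> Q\<^sup>2"
      using bern[of "13 / 3 * \<nu> + 10 / 3 * \<nu>\<^sup>2"] by linarith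
    then show ?thesis using zero_le_power2[of \<nu>] by argo
  qed
  moreover have "Q\<^sup>2 \<le> 1 / kap\<^sup>2"
  proof -
    have "kap \<le> 1 / Q" using kap_tiny[OF assms] unfolding Q_def .
    then have "Q \<le> 1 / kap" using kap_pos Q by (simp add: pos_le_divide_eq mult.commute)
    then have "Q\<^sup>2 \<le> (1 / kap)\<^sup>2" using Q by (intro power_mono) auto
    then show ?thesis by (simp add: power_divide)
  qed
  ultimately show ?thesis by linarith
qed

context
  fixes x :: "nat \<Rightarrow> 'a" and b :: "nat \<Rightarrow> real"
  assumes init: "s (x 0) \<le> S" and b: "\<And>k. 0 < b k" "\<And>k. b k \<le> be"
    and iter: "\<And>k. x (Suc k) = step (b k) (x k)"
begin

lemmas level = iter_level[OF init b iter] and antimono = iter_antimono[OF init b iter]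
  and near = iter_near[OF init b iter]

lemma path_strong:
  assumes "13 / 27 \<le> \<nu>"
  shows "kap * norm (x k - x 0) \<le> U (x 0) - U (x k)"
proof (induction k)
  case (Suc k)
  have "kap * norm (x (Suc k) - x 0) \<le> kap * (norm (x (Suc k) - x k) + norm (x k - x 0))"
    using kap_pos norm_triangle_ineq[of "x (Suc k) - x k" "x k - x 0"] by (intro mult_left_mono) auto
  also have "\<dots> \<le> (U (x k) - U (x (Suc k))) + (U (x 0) - U (x k))"
    unfolding distrib_left using length_le_strong[OF level b assms] Suc by (intro add_mono) (auto simp: iter)
  finally show ?case by simp
qed simp

lemma sum_lengths: "(1 - kap) * (\<Sum>i<k. norm (x (Suc i) - x i)) \<le> U (x 0) - U (x k)"
proof (induction k)
  case (Suc k)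
  then show ?case using length_le_weak[OF level b, of k k] by (simp add: distrib_left iter)
qed simp

lemma sum_A: "(1 - kap) * (\<Sum>i<k. b i * norm (g (x i)) powr p) \<le> s (x 0) - s (x k)"
proof (induction k)
  case (Suc k)
  then show ?case using step_decrease(1)[OF level less_imp_le[OF b(1)] b(2), of k k] by (simp add: distrib_left iter)
qed simp

lemma sum_coeff: assumes "\<nu> < 1" shows "(\<Sum>i<k. cf (b i) (x i)) \<le> G (x 0) - G (x k)"
proof (induction k)
  case (Suc k)
  then show ?case using coeff_le_G_drop[OF level b assms, of k k] by (simp add: iter)
qed simp

lemma potential:
  assumes nu1: "\<nu> < 1"
  defines "T \<equiv> (1 + \<nu>) / (1 - \<nu>)"
  shows "(norm (x k - x 0))\<^sup>2 \<le> T * (U (x 0))\<^sup>2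
    + (\<Sum>i<k. cf (b i) (x i) * (cf (b i) (x i) * (norm (g (x i)))\<^sup>2 - (s (x i) - s (x (Suc i)))))"
    (is "_ \<le> _ + ?E k")
proof -
  have "(norm (x k - x 0))\<^sup>2 + 2 * (s (x 0) - s (x k)) * G (x k) + T * (U (x k))\<^sup>2 \<le> T * (U (x 0))\<^sup>2 + ?E k"
  proof (induction k)
    case (Suc k)
    show ?case
      using order_trans[OF potential_step[OF level b nu1 antimono[of 0 k], of k, folded iter T_def] add_right_mono[OF Suc]]
      unfolding sum.lessThan_Suc add.assoc[symmetric] by simp
  qed simp
  moreover have "0 \<le> 2 * (s (x 0) - s (x k)) * G (x k)"
    using antimono[of 0 k] G_nonneg[OF nu1] by simp
  moreover have "0 \<le> T * (U (x k))\<^sup>2" using nu nu1 by (simp add: T_def)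
  ultimately show ?thesis by linarith
qed

lemma path_of_square:
  assumes "(norm (x k - x 0))\<^sup>2 \<le> B * (U (x 0))\<^sup>2" "B \<le> 1 / kap\<^sup>2"
  shows "kap * norm (x k - x 0) \<le> U (x 0)"
proof (rule power2_le_imp_le)
  have "(norm (x k - x 0))\<^sup>2 \<le> 1 / kap\<^sup>2 * (U (x 0))\<^sup>2"
    using assms mult_right_mono[OF assms(2), of "(U (x 0))\<^sup>2"] by simp
  then show "(kap * norm (x k - x 0))\<^sup>2 \<le> (U (x 0))\<^sup>2"
    using kap_pos by (simp add: field_simps)
qed (rule U_nonneg)

lemma path_mid:
  assumes n: "1 / 64 \<le> \<nu>" "\<nu> \<le> 13 / 27"
  shows "kap * norm (x k - x 0) \<le> U (x 0)"
proof (rule path_of_square)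
  let ?e = "be * kap / sqrt (2 * (1 - kap))"
  have nu1: "\<nu> < 1" using n by simp
  have e0: "0 \<le> ?e" using be_pos kap_pos kap_less by simp
  have "(\<Sum>i<k. cf (b i) (x i) * (cf (b i) (x i) * (norm (g (x i)))\<^sup>2 - (s (x i) - s (x (Suc i)))))
      \<le> ?e / 2 * ((infdist (x 0) X)\<^sup>2 - (infdist (x k) X)\<^sup>2 + ((U (x 0))\<^sup>2 - (U (x k))\<^sup>2))"
  proof (induction k)
    case (Suc k)
    have "A + B \<le> e * (p - r + (q - t))"
      if "A \<le> e * (p - p' + (q - q'))" "B \<le> e * (p' - r + (q' - t))" for A B e p p' q q' r t :: real
      using that by (simp add: algebra_simps)
    from this[OF Suc error_telescopes[OF level b, of k k, folded iter]] show ?case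
      unfolding sum.lessThan_Suc .
  qed simp
  also have "\<dots> \<le> ?e / 2 * ((U (x 0))\<^sup>2 + (U (x 0))\<^sup>2)"
  proof (intro mult_left_mono)
    have "(infdist (x 0) X)\<^sup>2 \<le> (U (x 0))\<^sup>2"
      using infdist_le_U[OF level, of 0] by (intro power_mono infdist_nonneg)
    then show "(infdist (x 0) X)\<^sup>2 - (infdist (x k) X)\<^sup>2 + ((U (x 0))\<^sup>2 - (U (x k))\<^sup>2)
        \<le> (U (x 0))\<^sup>2 + (U (x 0))\<^sup>2"
      using zero_le_power2[of "infdist (x k) X"] zero_le_power2[of "U (x k)"] by linarith
  qed (use e0 in simp)
  finally show "(norm (x k - x 0))\<^sup>2 \<le> ((1 + \<nu>) / (1 - \<nu>) + ?e) * (U (x 0))\<^sup>2"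
    using potential[OF nu1, of k] by (simp add: distrib_right)
  show "(1 + \<nu>) / (1 - \<nu>) + ?e \<le> 1 / kap\<^sup>2"
    using path_numeric[OF n] by (simp add: kap_kappa be_eq)
qed

text \<open>For very small \<open>\<nu>\<close> all large gradients met along the iteration are nearly parallel, so the
  decrease of \<open>s\<close> along the chord to \<open>x J\<close> controls the sum of the lengths.\<close>

lemma half_space:
  assumes nu1: "\<nu> < 1" and big: "be * U (x 0) \<le> norm (g (x J)) powr (1 / \<nu>)"
  shows "(\<Sum>i<J. b i * norm (g (x i)) powr p)
    \<le> 2 * s (x 0) + (4 powr \<nu> - be powr (2 * \<nu>)) * U (x 0) powr (2 * \<nu>) * G (x 0)"
proof -
  let ?U = "U (x 0)"
  define K where "K = (4 powr \<nu> - be powr (2 * \<nu>)) * ?U powr (2 * \<nu>)"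
  have "be powr (2 * \<nu>) \<le> 1" using be_pos be_le nu by (simp add: powr_le1)
  moreover have "(1::real) \<le> 4 powr \<nu>" using nu by (simp add: ge_one_powr_ge_zero)
  ultimately have K: "0 \<le> K" by (simp add: K_def)
  \<comment> \<open>Polarization: the gradients differ by at most (2 U) powr \<nu>, while the one at
    \<open>x J\<close> has norm at least (be U) powr \<nu>. The difference K of the squares is small
    for small \<nu>.\<close>
  have ip: "(norm (g (x i)))\<^sup>2 - K \<le> 2 * (g (x i) \<bullet> g (x J))" if "i < J" for i
  proof -
    have "norm (x i - x J) \<le> 2 * ?U"
      using near[of i J] near(2)[of 0 i] infdist_le_U[OF level, of 0] that by simp
    then have "norm (g (x i) - g (x J)) \<le> (2 * ?U) powr \<nu>"
      using hoelder_level[OF level level, of i J] nu powr_mono2[of \<nu> "norm (x i - x J)" "2 * ?U"] by simp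
    then have "(norm (g (x i) - g (x J)))\<^sup>2 \<le> ((2 * ?U) powr \<nu>)\<^sup>2" by (intro power_mono) auto
    also have "\<dots> = 4 powr \<nu> * ?U powr (2 * \<nu>)"
    proof -
      have "((2 * ?U) powr \<nu>)\<^sup>2 = (2 * 2) powr \<nu> * (?U powr \<nu> * ?U powr \<nu>)"
        using U_nonneg by (simp only: powr_mult power2_eq_square mult_ac) 
      then show ?thesis by (simp flip: powr_add)
    qed
    finally have "(norm (g (x i) - g (x J)))\<^sup>2 \<le> 4 powr \<nu> * ?U powr (2 * \<nu>)" .
    moreover have "be powr (2 * \<nu>) * ?U powr (2 * \<nu>) \<le> (norm (g (x J)))\<^sup>2"
    proof -
      have "(be * ?U) powr (2 * \<nu>) \<le> (norm (g (x J)) powr (1 / \<nu>)) powr (2 * \<nu>)"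
        using big nu be_pos U_nonneg by (intro powr_mono2) auto
      then show ?thesis using nu be_pos U_nonneg by (simp add: powr_mult powr_powr)
    qed
    moreover have "(norm (g (x i) - g (x J)))\<^sup>2 = (norm (g (x i)))\<^sup>2 + (norm (g (x J)))\<^sup>2 - 2 * (g (x i) \<bullet> g (x J))"
      by (simp add: power2_norm_eq_inner inner_simps inner_commute)
    ultimately show ?thesis by (simp add: K_def left_diff_distrib)
  qed
  have tele: "x 0 - x j = (\<Sum>i<j. cf (b i) (x i) *\<^sub>R g (x i))" for j
  proof (induction j)
    case (Suc j)
    then show ?case by (simp add: iter step_def algebra_simps)
  qed simp
  have "(\<Sum>i<J. cf (b i) (x i) * ((norm (g (x i)))\<^sup>2 - K)) \<le> (\<Sum>i<J. cf (b i) (x i) * (2 * (g (x i) \<bullet> g (x J))))"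
    using ip b by (intro sum_mono mult_left_mono cf_nonneg) (auto simp: less_imp_le)
  also have "\<dots> = 2 * ((x 0 - x J) \<bullet> g (x J))"
    unfolding tele inner_sum_left sum_distrib_left by (simp add: mult_ac)
  also have "\<dots> \<le> 2 * s (x 0)"
    using above_tangent[of "x J" "x 0"] nonneg[of "x J"] by (simp add: inner_commute)
  finally have "(\<Sum>i<J. b i * norm (g (x i)) powr p) \<le> 2 * s (x 0) + K * (\<Sum>i<J. cf (b i) (x i))"
    by (simp add: right_diff_distrib sum_subtractf cf_norm2 sum_distrib_left mult_ac)
  also have "K * (\<Sum>i<J. cf (b i) (x i)) \<le> K * G (x 0)"
    using sum_coeff[OF nu1, of J] G_nonneg[OF nu1, of "x J"] K by (intro mult_left_mono) auto
  finally show ?thesis by (simp add: K_def)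
qed

lemma cf_le_U: assumes "\<nu> < 1" shows "cf (b i) (x i) \<le> be * U (x 0) powr (1 - \<nu>)"
proof -
  have "norm (g (x i)) powr (1 / \<nu>) \<le> U (x 0)"
    using grad_le_dist[OF level, of i] near(2)[of 0 i] infdist_le_U[OF level, of 0] by simp
  then have "(norm (g (x i)) powr (1 / \<nu>)) powr (1 - \<nu>) \<le> U (x 0) powr (1 - \<nu>)"
    using assms by (intro powr_mono2) auto
  then have "norm (g (x i)) powr ((1 - \<nu>) / \<nu>) \<le> U (x 0) powr (1 - \<nu>)" by (simp add: powr_powr)
  then show ?thesis unfolding cf_def using b[of i] by (intro mult_mono) auto
qed

lemma sum_squares_le_A:
  assumes "\<nu> < 1"
  shows "(\<Sum>i<k. (norm (x (Suc i) - x i))\<^sup>2)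
    \<le> be * U (x 0) powr (1 - \<nu>) * (\<Sum>i<k. b i * norm (g (x i)) powr p)"
proof -
  have "(norm (x (Suc i) - x i))\<^sup>2 \<le> be * U (x 0) powr (1 - \<nu>) * (b i * norm (g (x i)) powr p)" for i
    unfolding iter length_sq[OF level b] using cf_le_U[OF assms] b(1)[of i] by (intro mult_right_mono) auto
  then show ?thesis unfolding sum_distrib_left by (rule sum_mono)
qed

lemma U_sq: "U z powr (1 - \<nu>) * s z = m * (U z)\<^sup>2"
proof -
  have "U z powr (1 - \<nu>) * U z powr (1 + \<nu>) = (U z)\<^sup>2" using U_nonneg by (simp flip: powr_add)
  then show ?thesis by (simp add: s_eq_U mult_ac)
qed

text \<open>Summing the plain descent inequality costs the factor m / (1 - kap), harmless when
  \<open>m\<close> is small.\<close>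

lemma sum_squares_small_m:
  assumes "\<nu> < 1" "m \<le> 10 / 3 * (1 - kap)"
  shows "(\<Sum>i<k. (norm (x (Suc i) - x i))\<^sup>2) \<le> 10 / 3 * be * (U (x 0))\<^sup>2"
proof -
  have "(\<Sum>i<k. (norm (x (Suc i) - x i))\<^sup>2)
    \<le> be * U (x 0) powr (1 - \<nu>) * (\<Sum>i<k. b i * norm (g (x i)) powr p)" by (rule sum_squares_le_A[OF assms(1)])
  also have "(\<Sum>i<k. b i * norm (g (x i)) powr p) \<le> s (x 0) / (1 - kap)"
    using sum_A[of k] nonneg[of "x k"] kap_less by (simp add: pos_le_divide_eq mult.commute)
  then have "be * U (x 0) powr (1 - \<nu>) * (\<Sum>i<k. b i * norm (g (x i)) powr p)
      \<le> be * U (x 0) powr (1 - \<nu>) * (s (x 0) / (1 - kap))"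
    using be_pos by (intro mult_left_mono) auto
  also have "\<dots> = be * (m / (1 - kap)) * (U (x 0))\<^sup>2"
    using U_sq[of "x 0"] by (simp add: mult.assoc)
  also have "\<dots> \<le> be * (10 / 3) * (U (x 0))\<^sup>2"
    using be_pos kap_less assms by (intro mult_right_mono mult_left_mono) (auto simp: pos_divide_le_eq)
  finally show ?thesis by (simp add: mult_ac)
qed

text \<open>Growth bounds the p-th power of the gradient norm by s / m, so the squared lengths
  telescope with the squared distance; 3/20 solves 1 / (2 m) = 10/3.\<close>

lemma sum_squares_large_m:
  assumes "3 / 20 \<le> m"
  shows "(\<Sum>i<k. (norm (x (Suc i) - x i))\<^sup>2) \<le> 10 / 3 * be * (U (x 0))\<^sup>2"
proof -
  have one: "(norm (x (Suc i) - x i))\<^sup>2 \<le> be / (2 * m) * ((infdist (x i) X)\<^sup>2 - (infdist (x (Suc i)) X)\<^sup>2)" for i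
  proof -
    let ?c = "cf (b i) (x i)"
    have c: "0 \<le> ?c" using b(1)[of i] by (simp add: cf_nonneg)
    have "norm (g (x i)) powr p = (norm (g (x i)) powr (1 / \<nu>)) powr (1 + \<nu>)"
      by (simp add: powr_powr p_def)
    also have "\<dots> \<le> infdist (x i) X powr (1 + \<nu>)"
      using grad_le_dist[OF level] nu by (intro powr_mono2) auto
    also have "\<dots> \<le> s (x i) / m" using s_ge[OF level] m_pos by (simp add: pos_le_divide_eq mult.commute)
    finally have "b i * norm (g (x i)) powr p \<le> be * (s (x i) / m)"
      using b[of i] by (intro mult_mono) auto
    then have "?c * (b i * norm (g (x i)) powr p) \<le> ?c * (be * (s (x i) / m))"
      using c by (rule mult_left_mono)
    also have "\<dots> = be / (2 * m) * (2 * ?c * s (x i))" by simp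
    also have "\<dots> \<le> be / (2 * m) * ((infdist (x i) X)\<^sup>2 - (infdist (x (Suc i)) X)\<^sup>2)"
      using fejer_infdist[OF level _ b(2), of i i] b(1)[of i] be_pos m_pos
      by (intro mult_left_mono) (auto simp: iter)
    finally show ?thesis unfolding iter length_sq[OF level b] .
  qed
  have "(\<Sum>i<k. (norm (x (Suc i) - x i))\<^sup>2) \<le> be / (2 * m) * ((infdist (x 0) X)\<^sup>2 - (infdist (x k) X)\<^sup>2)"
  proof (induction k)
    case (Suc k)
    then show ?case using one[of k] by (simp add: right_diff_distrib)
  qed simp
  also have "\<dots> \<le> (10 / 3 * be) * (U (x 0))\<^sup>2"
  proof (rule mult_mono)
    show "be / (2 * m) \<le> 10 / 3 * be" using assms m_pos be_pos by (simp add: field_simps)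
    have "(infdist (x 0) X)\<^sup>2 \<le> (U (x 0))\<^sup>2"
      using infdist_le_U[OF level, of 0] by (intro power_mono infdist_nonneg)
    then show "(infdist (x 0) X)\<^sup>2 - (infdist (x k) X)\<^sup>2 \<le> (U (x 0))\<^sup>2"
      using zero_le_power2[of "infdist (x k) X"] by linarith
    show "0 \<le> 10 / 3 * be" using be_pos by simp
    have "(infdist (x k) X)\<^sup>2 \<le> (infdist (x 0) X)\<^sup>2" using near(2)[of 0 k] by (intro power_mono infdist_nonneg) auto
    then show "0 \<le> (infdist (x 0) X)\<^sup>2 - (infdist (x k) X)\<^sup>2" by simp
  qed
  finally show ?thesis .
qed

text \<open>\<open>C\<close> bounds the sum up to any index with a large gradient, by
  \<open>half_space\<close>. Steps with a small gradient have length at most be^2 U and are charged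
  to the total length; its factor 1 / (1 - kap) is harmless since be \<le> 2 \<nu> \<le> 1 -
  kap.\<close>

lemma sum_squares_medium_m:
  assumes small: "\<nu> \<le> 1 / 64" and m1: "10 / 3 * (1 - kap) \<le> m" and m2: "m \<le> 3 / 20"
  shows "(\<Sum>i<k. (norm (x (Suc i) - x i))\<^sup>2) \<le> 10 / 3 * be * (U (x 0))\<^sup>2"
proof -
  have nu1: "\<nu> < 1" using small by simp
  let ?U = "U (x 0)" and ?l = "\<lambda>i. norm (x (Suc i) - x i)"
  define Q where "Q = (4 powr \<nu> - be powr (2 * \<nu>)) / ((1 - \<nu>) * m)"
  define C where "C = be * ?U\<^sup>2 * (2 * m + Q + be)"
  have l: "?l i \<le> be * ?U" for i
    using step_length_le(1)[OF level less_imp_le[OF b(1)] b(2), of i i] b[of i] near(2)[of 0 i]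
      infdist_le_U[OF level, of 0] mult_mono[of "b i" be "infdist (x i) X" ?U] be_pos infdist_nonneg[of "x i" X]
    by (simp add: iter)
  have d4: "be powr (2 * \<nu>) \<le> 1" "(1::real) \<le> 4 powr \<nu>"
    using be_pos be_le nu by (auto simp: powr_le1 ge_one_powr_ge_zero)
  have Q0: "0 \<le> Q" using d4 m_pos nu1 by (simp add: Q_def)
  have C0: "0 \<le> C" using Q0 m_pos be_pos by (simp add: C_def)
  have bigC: "(\<Sum>i<J. (?l i)\<^sup>2) + (?l J)\<^sup>2 \<le> C" if "be * ?U \<le> norm (g (x J)) powr (1 / \<nu>)" for J
  proof -
    have "(\<Sum>i<J. (?l i)\<^sup>2) \<le> be * ?U powr (1 - \<nu>) * (\<Sum>i<J. b i * norm (g (x i)) powr p)"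
      by (rule sum_squares_le_A[OF nu1])
    also have "\<dots> \<le> be * ?U powr (1 - \<nu>) * (2 * s (x 0) + (4 powr \<nu> - be powr (2 * \<nu>)) * ?U powr (2 * \<nu>) * (?U powr (1 - \<nu>) / ((1 - \<nu>) * m)))"
    proof (intro mult_left_mono order_trans[OF half_space[OF nu1 that]] add_left_mono)
      show "G (x 0) \<le> ?U powr (1 - \<nu>) / ((1 - \<nu>) * m)" using nu1 init by (rule G_le)
    qed (use be_pos d4 in auto)
    also have "\<dots> = be * (2 * (?U powr (1 - \<nu>) * s (x 0)) + Q * (?U powr (1 - \<nu>) * ?U powr (2 * \<nu>) * ?U powr (1 - \<nu>)))"
      by (simp add: Q_def distrib_left mult_ac)
    also have "?U powr (1 - \<nu>) * ?U powr (2 * \<nu>) * ?U powr (1 - \<nu>) = ?U\<^sup>2"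
      using U_nonneg[of "x 0"] by (simp flip: powr_add)
    also have "?U powr (1 - \<nu>) * s (x 0) = m * ?U\<^sup>2" by (rule U_sq)
    finally have "(\<Sum>i<J. (?l i)\<^sup>2) \<le> be * ?U\<^sup>2 * (2 * m + Q)" by (simp add: algebra_simps)
    moreover have "(?l J)\<^sup>2 \<le> (be * ?U)\<^sup>2" using l by (intro power_mono) auto
    then have "(?l J)\<^sup>2 \<le> be * ?U\<^sup>2 * be" by (simp add: power2_eq_square mult_ac)
    ultimately show ?thesis by (simp add: C_def distrib_left)
  qed
  have "(\<Sum>i<k. (?l i)\<^sup>2) \<le> C + be\<^sup>2 * ?U * (\<Sum>i<k. ?l i)"
  proof (induction k)
    case (Suc k)
    show ?case
    \<comment> \<open>At a large gradient \<open>C\<close> already covers all earlier steps, so the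
      induction restarts there.\<close>
    proof (cases "be * ?U \<le> norm (g (x k)) powr (1 / \<nu>)")
      case True
      moreover have "0 \<le> be\<^sup>2 * ?U * (\<Sum>i<Suc k. ?l i)" using U_nonneg by (intro mult_nonneg_nonneg sum_nonneg) auto
      ultimately show ?thesis using bigC[of k] by simp
    next
      case False
      have "?l k \<le> be * (be * ?U)"
        unfolding iter norm_step[OF less_imp_le[OF b(1)]] using False b[of k] by (intro mult_mono) auto
      then have "?l k * ?l k \<le> be * (be * ?U) * ?l k" by (rule mult_right_mono) simp
      then have "(?l k)\<^sup>2 \<le> be\<^sup>2 * ?U * ?l k" by (simp add: power2_eq_square mult.assoc)
      then show ?thesis using Suc unfolding sum.lessThan_Suc distrib_left by linarith
    qed
  qed (use C0 in simp)
  also have "\<dots> \<le> C + be\<^sup>2 * ?U * (?U / (1 - kap))"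
    using sum_lengths[of k] U_nonneg[of "x k"] U_nonneg[of "x 0"] kap_less
    by (intro add_left_mono mult_left_mono) (auto simp: pos_le_divide_eq mult.commute)
  also have "\<dots> = be * (2 * m + Q + be + be / (1 - kap)) * ?U\<^sup>2"
    by (simp add: C_def power2_eq_square distrib_left distrib_right mult_ac)
  also have "\<dots> \<le> be * (10 / 3) * ?U\<^sup>2"
  proof (intro mult_right_mono mult_left_mono)
    define k1 where "k1 = 1 - kap"
    have k1: "2 * \<nu> \<le> k1" "0 < k1" using kap_tiny_gap[OF small] kap_less by (auto simp: k1_def)
    note be = be_le_2nu
    have "be / k1 \<le> 1" using k1 be by (simp add: pos_divide_le_eq)
    moreover have "Q \<le> 11 / 10"
    proof -
      have "(1 + 3) powr \<nu> \<le> 1 + \<nu> * 3" using nu by (intro powr_le_tangent) auto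
      moreover have "1 - 2 * k1 \<le> be powr (2 * \<nu>)"
      proof -
        have "kap * (1 + \<nu>) = be powr \<nu>" using nu by (simp add: kap_def)
        moreover have "kap * 1 \<le> kap * (1 + \<nu>)" using kap_pos nu by (intro mult_left_mono) auto
        ultimately have "(1 - k1)\<^sup>2 \<le> (be powr \<nu>)\<^sup>2" using kap_pos by (intro power_mono) (auto simp: k1_def)
        moreover have "(be powr \<nu>)\<^sup>2 = be powr (2 * \<nu>)" by (simp add: power2_eq_square flip: powr_add)
        moreover have "1 - 2 * k1 \<le> (1 - k1)\<^sup>2" by (simp add: power2_diff)
        ultimately show ?thesis by linarith
      qed
      ultimately have num: "4 powr \<nu> - be powr (2 * \<nu>) \<le> 7 / 2 * k1" using k1 by simp
      have "63 / 64 * (10 / 3 * k1) \<le> (1 - \<nu>) * m"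
        using small m1 k1 by (intro mult_mono) (auto simp: k1_def)
      then have "7 / 2 * k1 \<le> 11 / 10 * ((1 - \<nu>) * m)" using k1 by linarith
      then have "4 powr \<nu> - be powr (2 * \<nu>) \<le> 11 / 10 * ((1 - \<nu>) * m)" using num by linarith
      then show ?thesis unfolding Q_def using nu1 m_pos by (simp add: pos_divide_le_eq)
    qed
    ultimately show "2 * m + Q + be + be / (1 - kap) \<le> 10 / 3"
      using m2 be small by (simp add: k1_def)
  qed (use be_pos in auto)
  finally show ?thesis by (simp add: mult_ac)
qed

lemma path_tiny:
  assumes small: "\<nu> \<le> 1 / 64"
  shows "kap * norm (x k - x 0) \<le> U (x 0)"
proof (rule path_of_square)
  have nu1: "\<nu> < 1" using small by simp
  have sq: "(\<Sum>i<k. (norm (x (Suc i) - x i))\<^sup>2) \<le> 10 / 3 * be * (U (x 0))\<^sup>2"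
  proof -
    show ?thesis
    proof (cases "m \<le> 10 / 3 * (1 - kap)")
      case True
      then show ?thesis by (rule sum_squares_small_m[OF nu1])
    next
      case False
      then show ?thesis using sum_squares_large_m[of k] sum_squares_medium_m[OF small, of k] by linarith
    qed
  qed
  have "(\<Sum>i<k. cf (b i) (x i) * (cf (b i) (x i) * (norm (g (x i)))\<^sup>2 - (s (x i) - s (x (Suc i)))))
      \<le> (\<Sum>i<k. kap * (norm (x (Suc i) - x i))\<^sup>2)"
  proof (rule sum_mono)
    fix i
    have "cf (b i) (x i) * (cf (b i) (x i) * (norm (g (x i)))\<^sup>2 - (s (x i) - s (x (Suc i))))
      \<le> cf (b i) (x i) * (kap * (b i * norm (g (x i)) powr p))"
      using error_term_le[OF level b, of i i] b(1)[of i] by (intro mult_left_mono cf_nonneg) (auto simp: iter)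
    then show "cf (b i) (x i) * (cf (b i) (x i) * (norm (g (x i)))\<^sup>2 - (s (x i) - s (x (Suc i))))
      \<le> kap * (norm (x (Suc i) - x i))\<^sup>2"
      unfolding iter length_sq[OF level b] by (simp add: mult_ac)
  qed
  also have "\<dots> \<le> kap * (10 / 3 * be * (U (x 0))\<^sup>2)"
    unfolding sum_distrib_left[symmetric] using sq kap_pos by (intro mult_left_mono) auto
  finally show "(norm (x k - x 0))\<^sup>2 \<le> ((1 + \<nu>) / (1 - \<nu>) + kap * (10 / 3 * be)) * (U (x 0))\<^sup>2"
    using potential[OF nu1, of k] unfolding distrib_right by (simp only: mult.assoc)
qed (rule path_numeric_tiny[OF small])

lemma path: "kap * norm (x k - x 0) \<le> U (x 0)"
proof (cases "13 / 27 \<le> \<nu>")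
  case True
  then show ?thesis using path_strong[of k] U_nonneg[of "x k"] by linarith
next
  case False
  then show ?thesis using path_mid[of k] path_tiny[of k] by linarith
qed

end
end

section \<open>Convergence rates\<close>

text \<open>Only a subsequence is known to converge, so the bound is required against every later
  iterate.\<close>

lemma norm_diff_limit_le:
  fixes x :: "nat \<Rightarrow> 'a::real_normed_vector"
  assumes "strict_mono \<sigma>" "(x \<circ> \<sigma>) \<longlonglongrightarrow> l" "\<And>j. k \<le> j \<Longrightarrow> norm (x k - x j) \<le> B"
  shows "norm (x k - l) \<le> B"
proof (rule LIMSEQ_le_const2)
  show "(\<lambda>n. norm (x k - (x \<circ> \<sigma>) n)) \<longlonglongrightarrow> norm (x k - l)"
    using assms(2) by (intro tendsto_intros)
  show "\<exists>N. \<forall>n\<ge>N. norm (x k - (x \<circ> \<sigma>) n) \<le> B"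
  proof (intro exI allI impI)
    fix n assume "k \<le> n"
    then have "k \<le> \<sigma> n" using seq_suble[OF assms(1), of n] by linarith
    then show "norm (x k - (x \<circ> \<sigma>) n) \<le> B" using assms(3) by simp
  qed
qed

text \<open>By (1 - z) powr (- a) \<ge> 1 + a z, the quantity u powr (- a) grows by at least a c in
  every step as long as u stays positive.\<close>

lemma powr_recurrence_rate:
  fixes u :: "nat \<Rightarrow> real"
  assumes nonneg: "\<And>k. 0 \<le> u k" and a: "0 < a" and c: "0 < c"
    and rec: "\<And>k. u (Suc k) \<le> u k - c * u k powr (1 + a)"
    and k: "0 < k"
  shows "u k \<le> (a * c * real k) powr (- (1 / a))"
proof (cases "u k = 0")
  case False
  have "a * c * real k \<le> u k powr (- a)" if "0 < u k" for k
    using that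
  proof (induction k)
    case (Suc k)
    have "u (Suc k) \<le> u k" using rec[of k] c by (smt (verit) mult_nonneg_nonneg powr_ge_zero)
    then have pos: "0 < u k" using Suc.prems by linarith
    define z where "z = c * u k powr a"
    have le: "u (Suc k) \<le> u k * (1 - z)"
      using rec[of k] pos by (simp add: z_def powr_add algebra_simps)
    then have "0 < u k * (1 - z)" using Suc.prems by linarith
    then have z: "z < 1" using pos by (simp add: zero_less_mult_iff)
    have "1 + a * z \<le> (1 - z) powr (- a)"
    proof -
      have "ln (1 - z) \<le> - z" using ln_le_minus_one[of "1 - z"] z by simp
      then have "a * ln (1 - z) \<le> a * (- z)" using a by (intro mult_left_mono) auto
      then have "a * z \<le> - a * ln (1 - z)" by simp
      also have "1 + \<dots> \<le> exp (- a * ln (1 - z))" by (rule exp_ge_add_one_self)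
      finally show ?thesis using z by (simp add: powr_def)
    qed
    then have "u k powr (- a) * (1 + a * z) \<le> u k powr (- a) * (1 - z) powr (- a)"
      by (intro mult_left_mono) auto
    also have "\<dots> = (u k * (1 - z)) powr (- a)" using pos z by (simp add: powr_mult)
    also have "\<dots> \<le> u (Suc k) powr (- a)" using le a Suc.prems by (intro powr_mono2') auto
    finally have "u k powr (- a) * (1 + a * z) \<le> u (Suc k) powr (- a)" .
    moreover have "u k powr (- a) * (1 + a * z) = u k powr (- a) + a * c"
      using pos by (simp add: z_def distrib_left powr_minus)
    moreover have "a * c * real (Suc k) = a * c * real k + a * c" by (simp add: algebra_simps)
    ultimately show ?case using Suc.IH[OF pos] by linarith
  qed simp
  moreover have pos: "0 < u k" using nonneg[of k] False by simp
  ultimately have "(u k powr (- a)) powr (- (1 / a)) \<le> (a * c * real k) powr (- (1 / a))"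
    using a c k by (intro powr_mono2') auto
  then show ?thesis using a pos by (simp add: powr_powr)
qed simp

context normalized_problem begin

context
  fixes x :: "nat \<Rightarrow> 'a" and b :: "nat \<Rightarrow> real" and xs :: 'a and bb :: real and \<sigma> :: "nat \<Rightarrow> nat"
  assumes init: "s (x 0) \<le> S" and bb: "0 < bb" "\<And>k. bb \<le> b k" and b: "\<And>k. b k \<le> be"
    and iter: "\<And>k. x (Suc k) = step (b k) (x k)"
    and lim: "strict_mono \<sigma>" "(x \<circ> \<sigma>) \<longlonglongrightarrow> xs"
begin

lemma sublinear_rate:
  assumes super: "\<nu> / (1 + \<nu>) < \<theta>"
  shows "\<exists>M>0. \<forall>k>0. norm (x k - xs) \<le> M * real k powr (- (\<nu> * (1 - \<theta>) / (\<theta> * (1 + \<nu>) - \<nu>)))"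
proof -
  have b0: "0 < b k" for k using bb by (rule order_less_le_trans)
  note level = iter_level[OF init b0 b iter] and near = iter_near[OF init b0 b iter]
  define a where "a = \<theta> * p - 1"
  define c where "c = (1 - kap) * bb / \<rho> powr p"
  have a: "0 < a" "a = (\<theta> * (1 + \<nu>) - \<nu>) / \<nu>"
    using super nu by (auto simp: a_def p_def field_simps)
  have c: "0 < c" using bb rho kap_less by (simp add: c_def)
  have rec: "s (x (Suc k)) \<le> s (x k) - c * s (x k) powr (1 + a)" for k
  proof -
    have "(s (x k) powr \<theta>) powr p \<le> (\<rho> * norm (g (x k))) powr p"
      using KL[OF level_ball[OF level]] p_pos by (intro powr_mono2) auto
    then have "s (x k) powr (1 + a) \<le> \<rho> powr p * norm (g (x k)) powr p"
      using rho by (simp add: a_def powr_powr powr_mult)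
    then have "c * s (x k) powr (1 + a) \<le> c * (\<rho> powr p * norm (g (x k)) powr p)"
      using c by (intro mult_left_mono) auto
    also have "\<dots> = (1 - kap) * (bb * norm (g (x k)) powr p)" using rho by (simp add: c_def)
    also have "\<dots> \<le> (1 - kap) * (b k * norm (g (x k)) powr p)"
      using bb kap_less by (intro mult_left_mono mult_right_mono) auto
    also have "\<dots> \<le> s (x k) - s (x (Suc k))"
      unfolding iter by (rule step_decrease(1)[OF level less_imp_le[OF b0] b])
    finally show ?thesis by simp
  qed
  define M where "M = 2 * (\<rho> / (1 - \<theta>) * ((a * c) powr (- (1 / a))) powr (1 - \<theta>))"
  show ?thesis
  proof (intro exI conjI allI impI)
    have "0 < ((a * c) powr (- (1 / a))) powr (1 - \<theta>)" using a(1) c by simp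
    then show "0 < M" unfolding M_def using rho theta by (intro mult_pos_pos divide_pos_pos) auto
    fix k :: nat assume k: "0 < k"
    have "norm (x k - xs) \<le> 2 * infdist (x k) X"
      by (rule norm_diff_limit_le[OF lim near(1)])
    also have "\<dots> \<le> 2 * (\<rho> / (1 - \<theta>) * s (x k) powr (1 - \<theta>))"
      using growth[OF level, of k] by linarith
    also have "\<dots> \<le> 2 * (\<rho> / (1 - \<theta>) * ((a * c * real k) powr (- (1 / a))) powr (1 - \<theta>))"
      using powr_recurrence_rate[of "\<lambda>k. s (x k)", OF nonneg a(1) c rec k] rho theta nonneg
      by (intro mult_left_mono powr_mono2) auto
    also have "\<dots> = M * real k powr (- (\<nu> * (1 - \<theta>) / (\<theta> * (1 + \<nu>) - \<nu>)))"
    proof -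
      have "(- (1 / a)) * (1 - \<theta>) = - (\<nu> * (1 - \<theta>) / (\<theta> * (1 + \<nu>) - \<nu>))" by (simp add: a(2))
      then have "real k powr (- (\<nu> * (1 - \<theta>) / (\<theta> * (1 + \<nu>) - \<nu>))) = (real k powr (- (1 / a))) powr (1 - \<theta>)"
        by (simp only: powr_powr)
      then show ?thesis unfolding M_def using a(1) c by (simp add: powr_mult)
    qed
    finally show "norm (x k - xs) \<le> M * real k powr (- (\<nu> * (1 - \<theta>) / (\<theta> * (1 + \<nu>) - \<nu>)))" .
  qed
qed

end
end

context critical_problem begin

context
  fixes x :: "nat \<Rightarrow> 'a" and b :: "nat \<Rightarrow> real" and xs :: 'a and bb :: real and \<sigma> :: "nat \<Rightarrow> nat"
  assumes init: "s (x 0) \<le> S" and bb: "0 < bb" "\<And>k. bb \<le> b k" and b: "\<And>k. b k \<le> be"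
    and iter: "\<And>k. x (Suc k) = step (b k) (x k)"
    and lim: "strict_mono \<sigma>" "(x \<circ> \<sigma>) \<longlonglongrightarrow> xs"
begin

lemma linear_rate:
  assumes less: "bb < be"
  shows "norm (x k - xs) \<le> 2 * \<nu> * U (x 0) / bb powr (1 + \<nu>)
    * (1 - bb powr (1 + \<nu>) / ((1 + \<nu>) * R)) powr (real k / (1 + \<nu>))"
proof -
  have b0: "0 < b k" for k using bb by (rule order_less_le_trans)
  note level = iter_level[OF init b0 b iter] and near = iter_near[OF init b0 b iter]
  define q where "q = bb powr (1 + \<nu>) / ((1 + \<nu>) * R)"
  show ?thesis
  proof (cases "s (x 0) = 0")
    case True
    then have "infdist (x 0) X = 0" by (intro infdist_zero) (simp add: X_def)
    then have "infdist (x k) X \<le> 0" using near(2)[of 0 k] by simp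
    moreover have "norm (x k - xs) \<le> 2 * infdist (x k) X"
      by (rule norm_diff_limit_le[OF lim near(1)])
    ultimately have "norm (x k - xs) \<le> 0" by linarith
    moreover have "0 \<le> 2 * \<nu> * U (x 0) / bb powr (1 + \<nu>) * (1 - q) powr (real k / (1 + \<nu>))"
      using nu U_nonneg by simp
    ultimately show ?thesis unfolding q_def by linarith
  next
    case False
    then have pos: "0 < s (x 0)" using nonneg[of "x 0"] by simp
    have q1: "q < 1"
    proof -
      have "bb powr (1 + \<nu>) < 1 powr (1 + \<nu>)" using bb(1) less be_le nu by (intro powr_less_mono2) auto
      moreover have "1 \<le> (1 + \<nu>) * R" using inv_R_le[OF init pos] R_pos by (simp add: pos_divide_le_eq)
      ultimately show ?thesis using R_pos nu by (simp add: q_def pos_divide_less_eq)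
    qed
    have kq: "q \<le> kap * b k / R" for k
    proof -
      have "bb powr \<nu> * bb \<le> be powr \<nu> * b k"
        using bb(1) bb(2)[of k] less nu be_pos by (intro mult_mono powr_mono2) auto
      then have "bb powr (1 + \<nu>) / (1 + \<nu>) \<le> be powr \<nu> * b k / (1 + \<nu>)"
        using bb(1) nu by (intro divide_right_mono) (simp_all add: powr_add mult.commute)
      then have "bb powr (1 + \<nu>) / (1 + \<nu>) / R \<le> be powr \<nu> * b k / (1 + \<nu>) / R"
        using less_imp_le[OF R_pos] by (rule divide_right_mono)
      then show ?thesis by (simp add: q_def kap_def)
    qed
    have sk: "s (x k) \<le> (1 - q) ^ k * s (x 0)" for k
    proof (induction k)
      case (Suc k)
      have "s (x (Suc k)) \<le> (1 - kap * b k / R) * s (x k)"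
        unfolding iter by (rule decrease_ratio[OF level b0 b])
      also have "\<dots> \<le> (1 - q) * s (x k)" using kq nonneg by (intro mult_right_mono) auto
      also have "\<dots> \<le> (1 - q) * ((1 - q) ^ k * s (x 0))" using Suc q1 by (intro mult_left_mono) auto
      finally show ?case by (simp add: mult.assoc)
    qed simp
    have Uk: "U (x k) \<le> U (x 0) * (1 - q) powr (real k / (1 + \<nu>))"
    proof -
      have "s (x k) powr (1 / (1 + \<nu>)) \<le> ((1 - q) ^ k * s (x 0)) powr (1 / (1 + \<nu>))"
        using sk nonneg nu by (intro powr_mono2) auto
      also have "(1 - q) ^ k = (1 - q) powr real k" using q1 by (simp add: powr_realpow)
      finally have "s (x k) powr (1 / (1 + \<nu>)) \<le> (1 - q) powr (real k / (1 + \<nu>)) * s (x 0) powr (1 / (1 + \<nu>))"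
        using pos by (simp add: powr_mult powr_powr)
      then have "(1 + \<nu>) * \<rho> * s (x k) powr (1 / (1 + \<nu>))
          \<le> (1 + \<nu>) * \<rho> * ((1 - q) powr (real k / (1 + \<nu>)) * s (x 0) powr (1 / (1 + \<nu>)))"
        using nu rho by (intro mult_left_mono) auto
      then show ?thesis by (simp add: U_def mult_ac)
    qed
    have "norm (x k - x j) \<le> U (x k) / kap" if "k \<le> j" for j
    proof -
      have "kap * norm (x (k + (j - k)) - x (k + 0)) \<le> U (x (k + 0))"
        by (rule path[of "\<lambda>i. x (k + i)" "\<lambda>i. b (k + i)"]) (rule level b0 b | simp add: iter)+
      then show ?thesis using that kap_pos by (simp add: pos_le_divide_eq mult.commute norm_minus_commute)
    qed
    then have "norm (x k - xs) \<le> U (x k) / kap" by (rule norm_diff_limit_le[OF lim])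
    also have "\<dots> \<le> U (x k) * (2 * \<nu> / bb powr (1 + \<nu>))"
    proof -
      have "be * be powr \<nu> = 2 * \<nu> * kap" using nu by (simp add: kap_def be_eq)
      then have "be powr (1 + \<nu>) = 2 * \<nu> * kap" using be_pos by (simp add: powr_add)
      moreover have "bb powr (1 + \<nu>) \<le> be powr (1 + \<nu>)" using bb(1) less nu by (intro powr_mono2) auto
      ultimately have "1 / kap \<le> 2 * \<nu> / bb powr (1 + \<nu>)" using kap_pos bb(1) by (simp add: field_simps)
      then have "U (x k) * (1 / kap) \<le> U (x k) * (2 * \<nu> / bb powr (1 + \<nu>))"
        using U_nonneg by (intro mult_left_mono) auto
      then show ?thesis by simp
    qed
    also have "\<dots> \<le> U (x 0) * (1 - q) powr (real k / (1 + \<nu>)) * (2 * \<nu> / bb powr (1 + \<nu>))"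
      using Uk nu by (intro mult_right_mono) auto
    finally show ?thesis unfolding q_def by (simp add: mult_ac)
  qed
qed

end
end

section \<open>Scaling between the given and the normalized problem\<close>

theorem theorem3p21:
  fixes f :: "'a::euclidean_space \<Rightarrow> real" and g :: "'a \<Rightarrow> 'a"
    and \<nu> fstar L \<theta> \<rho> \<alpha>bar :: real and \<alpha> :: "nat \<Rightarrow> real"
    and x :: "nat \<Rightarrow> 'a" and x0 xstar :: 'a
  assumes conv: "convex_on UNIV f"
    and grad: "\<And>y. (f has_derivative (\<lambda>h. g y \<bullet> h)) (at y)"
    and gcont: "continuous_on UNIV g"
    and nu: "0 < \<nu>" "\<nu> \<le> 1"
    and hoelder: "locally_hoelder \<nu> g"
    and fstar_attained: "\<exists>xm. f xm = fstar"
    and fstar_min: "\<And>y. fstar \<le> f y"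
    and bdd: "bounded {y. f y \<le> f x0}"
    and L_pos: "L > 0"
    and L_hoelder: "\<And>y z. y \<in> cball 0 ((1 + 2 * (1 + \<nu>) powr (1 / \<nu>)) * Sup (norm ` {y. f y \<le> f x0}))
        \<Longrightarrow> z \<in> cball 0 ((1 + 2 * (1 + \<nu>) powr (1 / \<nu>)) * Sup (norm ` {y. f y \<le> f x0}))
        \<Longrightarrow> norm (g y - g z) \<le> L * norm (y - z) powr \<nu>"
    and KL: "KL_inequality f g fstar"
    and theta: "0 < \<theta>" "\<theta> < 1"
    and rho: "\<rho> > 0"
    and KL_Omega: "\<And>y. y \<in> cball 0 ((1 + 2 * (1 + \<nu>) powr (1 / \<nu>)) * Sup (norm ` {y. f y \<le> f x0}))
        \<Longrightarrow> (f y - fstar) powr \<theta> \<le> \<rho> * norm (g y)"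
    and x_init: "x 0 = x0"
    and x_step: "\<And>k. x (Suc k) = x k - (\<alpha> k * norm (g (x k)) powr ((1 - \<nu>) / \<nu>)) *\<^sub>R g (x k)"
    and alpha_bar: "0 < \<alpha>bar" "\<alpha>bar < 2 * \<nu> / ((1 + \<nu>) * L powr (1 / \<nu>))"
    and alpha: "\<And>k. \<alpha>bar \<le> \<alpha> k" "\<And>k. \<alpha> k \<le> 2 * \<nu> / ((1 + \<nu>) * L powr (1 / \<nu>))"
    and limit_point: "\<exists>s. strict_mono s \<and> (x \<circ> s) \<longlonglongrightarrow> xstar"
  shows "(\<theta> = \<nu> / (1 + \<nu>) \<longrightarrow>
           (\<forall>k. norm (x k - xstar) \<le>
              2 * \<theta> * \<rho> * (f x0 - fstar) powr (1 - \<theta>)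
                / ((1 - \<theta>)\<^sup>2 * L powr (1 / \<theta>) * \<alpha>bar powr (1 / (1 - \<theta>)))
              * (1 - (1 - \<theta>) * L * \<alpha>bar powr (1 / (1 - \<theta>)) * \<rho> powr (- (1 / \<theta>)))
                  powr (real k * (1 - \<theta>))))
       \<and> (\<theta> > \<nu> / (1 + \<nu>) \<longrightarrow>
           (\<exists>\<sigma>>0. \<forall>\<^sub>F k in sequentially. norm (x k - xstar) \<le>
              2 * \<nu> * \<rho> * \<sigma> powr (1 - \<theta>)
                / ((1 - \<theta>) * L powr ((1 + \<nu>) / \<nu>) * \<alpha>bar powr (1 + \<nu>))
              * real k powr (- (\<nu> * (1 - \<theta>) / (\<theta> * (1 + \<nu>) - \<nu>)))))"
proof -
  define r where "r = Sup (norm ` {y. f y \<le> f x0})"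
  define s where "s y = (f y - fstar) / L" for y
  define g' where "g' y = g y /\<^sub>R L" for y
  \<comment> \<open>Dividing by L powr \<theta> on the left and pulling L out of the gradient leaves
    the factor L powr (1 - \<theta>).\<close>
  define \<rho>' where "\<rho>' = \<rho> * L powr (1 - \<theta>)"
  define S where "S = (f x0 - fstar) / L"
  define b where "b k = \<alpha> k * L powr (1 / \<nu>)" for k
  define bb where "bb = \<alpha>bar * L powr (1 / \<nu>)"
  obtain \<sigma> where lim: "strict_mono \<sigma>" "(x \<circ> \<sigma>) \<longlonglongrightarrow> xstar" using limit_point by blast
  have bdd': "bdd_above (norm ` {y. f y \<le> f x0})"
    using bdd by (auto simp: bounded_iff bdd_above_def)
  have level: "norm y \<le> r" if "f y \<le> f x0" for y
    unfolding r_def using that bdd' by (intro cSup_upper) auto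
  have r0: "0 \<le> r" using level[of x0] norm_ge_zero[of x0] by linarith
  \<comment> \<open>Hence the given ball contains the one of radius 3 r.\<close>
  have "(1::real) \<le> (1 + \<nu>) powr (1 / \<nu>)" using nu by (intro ge_one_powr_ge_zero) auto
  then have "3 * r \<le> (1 + 2 * (1 + \<nu>) powr (1 / \<nu>)) * r" using r0 by (intro mult_right_mono) auto
  then have ball: "y \<in> cball 0 ((1 + 2 * (1 + \<nu>) powr (1 / \<nu>)) * r)" if "norm y \<le> 3 * r" for y
    using that by simp
  have gL: "norm (g y) = L * norm (g' y)" for y using L_pos by (simp add: g'_def)
  note rho_pos = rho
  interpret normalized_problem s g' \<nu> \<theta> \<rho>' r S
  proof
    have "convex_on UNIV (\<lambda>y. f y + - fstar)"
      using conv by (intro convex_on_add) (auto simp: convex_on_const)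
    then have "convex_on UNIV (\<lambda>y. (f y + - fstar) / L)" using L_pos by (intro convex_on_cdiv) auto
    then show "convex_on UNIV s" by (simp add: s_def[abs_def])
    have der: "(s has_derivative (\<lambda>h. (g y \<bullet> h - 0) * inverse L)) (at y)" for y
      unfolding s_def[abs_def] divide_inverse
      by (intro has_derivative_mult_left has_derivative_diff grad has_derivative_const)
    have "(\<lambda>h. (g y \<bullet> h - 0) * inverse L) = (\<lambda>h. g' y \<bullet> h)" for y
      by (simp add: g'_def mult.commute)
    with der show "(s has_derivative (\<lambda>h. g' y \<bullet> h)) (at y)" for y by metis
    show "0 \<le> s y" for y using fstar_min[of y] L_pos by (simp add: s_def)
    then show "0 \<le> S" by (simp add: s_def S_def)
    show "\<exists>y. s y = 0" using fstar_attained by (auto simp: s_def)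
    show "norm y \<le> r" if "s y \<le> S" for y
      using that L_pos by (intro level) (simp add: s_def S_def divide_le_cancel)
    show "norm (g' y - g' z) \<le> norm (y - z) powr \<nu>" if "norm y \<le> 3 * r" "norm z \<le> 3 * r" for y z
    proof -
      have "norm (g y - g z) \<le> L * norm (y - z) powr \<nu>"
        using L_hoelder[OF ball[OF that(1), unfolded r_def] ball[OF that(2), unfolded r_def]] .
      moreover have "norm (g' y - g' z) = norm (g y - g z) / L"
        using L_pos by (simp add: g'_def divide_inverse mult.commute flip: scaleR_diff_right)
      ultimately show ?thesis using L_pos by (simp add: pos_divide_le_eq mult.commute)
    qed
    show "0 < \<rho>'" using rho L_pos by (simp add: \<rho>'_def)
    show "s y powr \<theta> \<le> \<rho>' * norm (g' y)" if "norm y \<le> r" for y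
    proof -
      have "norm y \<le> 3 * r" using that r0 by linarith
      then have "(f y - fstar) powr \<theta> \<le> \<rho> * norm (g y)" using KL_Omega ball unfolding r_def by blast
      then have "(f y - fstar) powr \<theta> / L powr \<theta> \<le> \<rho> * (L * norm (g' y)) / L powr \<theta>"
        unfolding gL by (intro divide_right_mono) auto
      moreover have "\<rho> * (L * norm (g' y)) / L powr \<theta> = \<rho>' * norm (g' y)"
        using L_pos by (simp add: \<rho>'_def powr_diff)
      ultimately show ?thesis using L_pos fstar_min[of y] by (simp add: s_def powr_divide)
    qed
  qed (use nu theta in auto)
  have LL: "0 < L powr (1 / \<nu>)" using L_pos by simp
  have be: "be = 2 * \<nu> / ((1 + \<nu>) * L powr (1 / \<nu>)) * L powr (1 / \<nu>)"
    using LL by (simp add: be_eq)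
  have init: "s (x 0) \<le> S" by (simp add: s_def S_def x_init)
  have bb: "0 < bb" "bb \<le> b k" "b k \<le> be" "bb < be" for k
    using mult_pos_pos[OF alpha_bar(1) LL] mult_right_mono[OF alpha(1) less_imp_le[OF LL]]
      mult_right_mono[OF alpha(2) less_imp_le[OF LL]] mult_strict_right_mono[OF alpha_bar(2) LL]
    unfolding be bb_def b_def by this+
  have iter: "x (Suc k) = step (b k) (x k)" for k
  proof -
    have "\<alpha> k * norm (g (x k)) powr ((1 - \<nu>) / \<nu>) = cf (b k) (x k) / L"
    proof -
      have "(1 - \<nu>) / \<nu> = 1 / \<nu> - 1" using nu by (simp add: diff_divide_distrib)
      then have "L powr ((1 - \<nu>) / \<nu>) = L powr (1 / \<nu>) / L" using L_pos by (simp add: powr_diff)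
      then show ?thesis using L_pos by (simp add: cf_def b_def gL powr_mult)
    qed
    then show ?thesis by (simp add: x_step step_def g'_def divide_inverse)
  qed
  show ?thesis
  proof (intro conjI impI allI)
    fix k
    assume crit: "\<theta> = \<nu> / (1 + \<nu>)"
    interpret critical_problem s g' \<nu> \<theta> \<rho>' r S by unfold_locales (rule crit)
    define F where "F = f x0 - fstar"
    have F: "0 \<le> F" using fstar_min[of x0] by (simp add: F_def)
    have e: "1 / (1 - \<theta>) = 1 + \<nu>" "1 / (1 + \<nu>) = 1 - \<theta>" "1 / \<theta> = p"
      using nu one_minus_theta by (auto simp: crit p_def)
    have U0: "U (x 0) = (1 + \<nu>) * \<rho> * F powr (1 - \<theta>)"
      unfolding U_def e using F L_pos by (simp add: \<rho>'_def s_def x_init F_def powr_divide)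
    have bbp: "bb powr (1 + \<nu>) = \<alpha>bar powr (1 + \<nu>) * L powr p"
      using alpha_bar by (simp add: bb_def powr_mult powr_powr p_def)
    have Rp: "R = \<rho> powr p * L powr (p - 1)"
    proof -
      have "(1 - \<theta>) * p = p - 1" using theta_p by (simp add: left_diff_distrib)
      then show ?thesis unfolding R_def using rho by (simp add: \<rho>'_def powr_mult powr_powr)
    qed
    have "norm (x k - xstar) \<le> 2 * \<nu> * U (x 0) / bb powr (1 + \<nu>)
        * (1 - bb powr (1 + \<nu>) / ((1 + \<nu>) * R)) powr (real k / (1 + \<nu>))"
      by (rule linear_rate[OF init bb(1,2,3) iter lim bb(4)])
    also have "2 * \<nu> * U (x 0) / bb powr (1 + \<nu>)
        = 2 * \<theta> * \<rho> * (f x0 - fstar) powr (1 - \<theta>) / ((1 - \<theta>)\<^sup>2 * L powr (1 / \<theta>) * \<alpha>bar powr (1 / (1 - \<theta>)))"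
    proof -
      have "2 * (\<nu> / (1 + \<nu>)) / (1 / (1 + \<nu>))\<^sup>2 = 2 * \<nu> * (1 + \<nu>)"
        using nu by (simp add: power2_eq_square)
      then have "2 * \<theta> / (1 - \<theta>)\<^sup>2 = 2 * \<nu> * (1 + \<nu>)"
        unfolding one_minus_theta[symmetric] crit[symmetric] .
      moreover have "2 * \<theta> * \<rho> * A / ((1 - \<theta>)\<^sup>2 * B * C) = 2 * \<theta> / (1 - \<theta>)\<^sup>2 * (\<rho> * A / (B * C))" for A B C
        by (simp add: mult.assoc)
      ultimately have "2 * \<theta> * \<rho> * F powr (1 - \<theta>) / ((1 - \<theta>)\<^sup>2 * L powr p * \<alpha>bar powr (1 + \<nu>))
          = 2 * \<nu> * (1 + \<nu>) * (\<rho> * F powr (1 - \<theta>) / (L powr p * \<alpha>bar powr (1 + \<nu>)))" by simp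
      then show ?thesis by (simp add: e U0 bbp F_def mult_ac)
    qed
    also have "bb powr (1 + \<nu>) / ((1 + \<nu>) * R) = (1 - \<theta>) * L * \<alpha>bar powr (1 / (1 - \<theta>)) * \<rho> powr (- (1 / \<theta>))"
    proof -
      have "L powr p = L * L powr (p - 1)" using L_pos by (simp add: powr_diff)
      then show ?thesis
        unfolding e(1,3) bbp Rp e(2)[symmetric] using L_pos by (simp add: powr_minus divide_inverse mult_ac)
    qed
    also have "real k / (1 + \<nu>) = real k * (1 - \<theta>)" by (simp add: one_minus_theta)
    finally show "norm (x k - xstar) \<le>
              2 * \<theta> * \<rho> * (f x0 - fstar) powr (1 - \<theta>)
                / ((1 - \<theta>)\<^sup>2 * L powr (1 / \<theta>) * \<alpha>bar powr (1 / (1 - \<theta>)))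
              * (1 - (1 - \<theta>) * L * \<alpha>bar powr (1 / (1 - \<theta>)) * \<rho> powr (- (1 / \<theta>)))
                  powr (real k * (1 - \<theta>))" .
  next
    assume super: "\<nu> / (1 + \<nu>) < \<theta>"
    from sublinear_rate[OF init bb(1,2,3) iter lim super]
    obtain M where M: "0 < M" and rate: "\<And>k. 0 < k \<Longrightarrow>
        norm (x k - xstar) \<le> M * real k powr (- (\<nu> * (1 - \<theta>) / (\<theta> * (1 + \<nu>) - \<nu>)))" by blast
    define K where "K = 2 * \<nu> * \<rho> / ((1 - \<theta>) * L powr ((1 + \<nu>) / \<nu>) * \<alpha>bar powr (1 + \<nu>))"
    have K: "0 < K" unfolding K_def using nu rho_pos theta L_pos alpha_bar by (intro divide_pos_pos mult_pos_pos) auto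
    \<comment> \<open>Solves K \<tau> powr (1 - \<theta>) = M, so the free constant \<sigma> absorbs
      the prescribed prefactor.\<close>
    define \<tau> where "\<tau> = (M / K) powr (1 / (1 - \<theta>))"
    have "\<tau> powr (1 - \<theta>) = M / K" using M K theta by (simp add: \<tau>_def powr_powr)
    then have "M = K * \<tau> powr (1 - \<theta>)" using K by simp
    also have "\<dots> = 2 * \<nu> * \<rho> * \<tau> powr (1 - \<theta>) / ((1 - \<theta>) * L powr ((1 + \<nu>) / \<nu>) * \<alpha>bar powr (1 + \<nu>))"
      by (simp add: K_def)
    finally have MK: "M = \<dots>" .
    have "0 < \<tau>" using M K by (simp add: \<tau>_def)
    moreover have "\<forall>\<^sub>F k in sequentially. norm (x k - xstar) \<le>
        M * real k powr (- (\<nu> * (1 - \<theta>) / (\<theta> * (1 + \<nu>) - \<nu>)))"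
      using eventually_gt_at_top[of 0] by eventually_elim (rule rate)
    ultimately show "\<exists>\<sigma>>0. \<forall>\<^sub>F k in sequentially. norm (x k - xstar) \<le>
              2 * \<nu> * \<rho> * \<sigma> powr (1 - \<theta>)
                / ((1 - \<theta>) * L powr ((1 + \<nu>) / \<nu>) * \<alpha>bar powr (1 + \<nu>))
              * real k powr (- (\<nu> * (1 - \<theta>) / (\<theta> * (1 + \<nu>) - \<nu>)))"
      unfolding MK by blast
  qed
qed

end
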